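(* Let $\Sigma$ be a compact minimal surface in $B^n$, with nonempty boundary $\partial\Sigma\subset\partial B^n$, meeting $\partial B^n$ orthogonally along $\partial\Sigma$, given by the isometric immersion $\varphi:\Sigma\to B^n$. Then $$V_{bc}(\Sigma,n,\varphi)=L(\partial\Sigma),$$ the length of the boundary of $\Sigma$.
   Context: $B^n$ is the closed unit ball in $\mathbb{R}^n$ and $G$ is the group of conformal diffeomorphisms of $B^n$. Meeting $\partial B^n$ orthogonally means that the outward unit conormal of $\Sigma$ along $\partial\Sigma$ equals the position vector. For a compact $k$-dimensional Riemannian manifold $\Sigma$ with nonempty boundary and a conformal map $\varphi:\Sigma\to B^n$ with $\varphi(\partial\Sigma)\subset\partial B^n$, the boundary $n$-conformal volume of $\varphi$ is $$V_{bc}(\Sigma,n,\varphi)=\sup_{f\in G}V\big(f(\varphi(\partial\Sigma))\big),$$ where $V$ is the $(k-1)$-dimensional volume of the image counted with multiplicity, i.e. the volume of $\partial\Sigma$ in the metric pulled back by $f\circ\varphi|_{\partial\Sigma}$ (length when $k=2$). *)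

theory Defs
  imports "HOL-Analysis.Analysis"
begin

section \<open>Smooth maps on subsets of Euclidean space\<close>

fun Ck_on :: "nat \<Rightarrow> 'a::real_normed_vector set \<Rightarrow> ('a \<Rightarrow> 'b::real_normed_vector) \<Rightarrow> bool" where
  "Ck_on 0 U f \<longleftrightarrow> continuous_on U f"
| "Ck_on (Suc k) U f \<longleftrightarrow>
     (\<forall>x\<in>U. f differentiable (at x)) \<and> (\<forall>v. Ck_on k U (\<lambda>x. frechet_derivative f (at x) v))"

text \<open>On a set that need not be open, smooth means locally extendable to a smooth map.\<close>

definition smooth_on :: "'a::euclidean_space set \<Rightarrow> ('a \<Rightarrow> 'b::euclidean_space) \<Rightarrow> bool" where
  "smooth_on S f \<longleftrightarrow>
     (\<forall>x\<in>S. \<exists>U h. open U \<and> x \<in> U \<and> (\<forall>k. Ck_on k U h) \<and> (\<forall>y\<in>S \<inter> U. h y = f y))"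

section \<open>Smooth surfaces with boundary\<close>

definition half_plane :: "(real^2) set" where
  "half_plane = {z. 0 \<le> z $ 2}"

text \<open>A chart is a pair of its domain \<open>U\<close> and the coordinate map, whose values outside \<open>U\<close> are
  irrelevant.\<close>

type_synonym 'a chart = "'a set \<times> ('a \<Rightarrow> real^2)"

definition coord_image :: "'a chart \<Rightarrow> (real^2) set" where
  "coord_image c = snd c ` fst c"

definition param :: "'a chart \<Rightarrow> real^2 \<Rightarrow> 'a" where
  "param c = inv_into (fst c) (snd c)"

definition smooth_surface :: "'a topology \<Rightarrow> 'a chart set \<Rightarrow> bool" where
  "smooth_surface X A \<longleftrightarrow>
     Hausdorff_space X \<and> second_countable X \<and> topspace X = (\<Union>c\<in>A. fst c) \<and>
     (\<forall>c\<in>A. openin X (fst c) \<and>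
        openin (top_of_set half_plane) (coord_image c) \<and>
        homeomorphic_map (subtopology X (fst c)) (top_of_set (coord_image c)) (snd c)) \<and>
     (\<forall>c\<in>A. \<forall>d\<in>A. smooth_on (snd c ` (fst c \<inter> fst d)) (snd d \<circ> param c))"

definition surface_boundary :: "'a chart set \<Rightarrow> 'a set" where
  "surface_boundary A = {p. \<exists>c\<in>A. p \<in> fst c \<and> snd c p $ 2 = 0}"

definition smooth_map :: "'a chart set \<Rightarrow> ('a \<Rightarrow> 'b::euclidean_space) \<Rightarrow> bool" where
  "smooth_map A F \<longleftrightarrow> (\<forall>c\<in>A. smooth_on (coord_image c) (F \<circ> param c))"

text \<open>All derivatives are taken within the coordinate image, hence are one-sided at boundary
  points; there they are still uniquely determined.\<close>

definition chart_deriv :: "'a chart \<Rightarrow> (real^2 \<Rightarrow> 'b::real_normed_vector) \<Rightarrow> real^2 \<Rightarrow> real^2 \<Rightarrow> 'b" where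
  "chart_deriv c F z = frechet_derivative F (at z within coord_image c)"

definition chart_partial :: "'a chart \<Rightarrow> 2 \<Rightarrow> (real^2 \<Rightarrow> 'b::real_normed_vector) \<Rightarrow> real^2 \<Rightarrow> 'b" where
  "chart_partial c i F z = chart_deriv c F z (axis i 1)"

section \<open>Riemannian metrics and length of the boundary\<close>

text \<open>A symmetric 2-tensor is represented by its coefficient matrices: \<open>g c z $ i $ j\<close> is the
  \<open>(i, j)\<close> coefficient in the chart \<open>c\<close> at the coordinate point \<open>z\<close>.\<close>

type_synonym 'a tensor2 = "'a chart \<Rightarrow> real^2 \<Rightarrow> real^2^2"

definition riemannian_metric :: "'a chart set \<Rightarrow> 'a tensor2 \<Rightarrow> bool" where
  "riemannian_metric A g \<longleftrightarrow>
     (\<forall>c\<in>A. smooth_on (coord_image c) (g c) \<and>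
        (\<forall>z\<in>coord_image c. transpose (g c z) = g c z \<and> (\<forall>v. v \<noteq> 0 \<longrightarrow> 0 < v \<bullet> (g c z *v v)))) \<and>
     (\<forall>c\<in>A. \<forall>d\<in>A. \<forall>z\<in>snd c ` (fst c \<inter> fst d).
        let J = matrix (frechet_derivative (snd d \<circ> param c) (at z within snd c ` (fst c \<inter> fst d)))
        in g c z = transpose J ** g d (snd d (param c z)) ** J)"

text \<open>The pull-back of the Euclidean metric by a map.\<close>

definition pullback_metric :: "('a \<Rightarrow> real^'n) \<Rightarrow> 'a tensor2" where
  "pullback_metric F c z =
     (\<chi> i j. chart_partial c i (F \<circ> param c) z \<bullet> chart_partial c j (F \<circ> param c) z)"

definition partition_of_unity :: "'a topology \<Rightarrow> 'a chart set \<Rightarrow> ('a chart \<times> ('a \<Rightarrow> real)) list \<Rightarrow> bool" where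
  "partition_of_unity X A P \<longleftrightarrow>
     (\<forall>(c, \<rho>)\<in>set P. c \<in> A \<and> smooth_map A \<rho> \<and> (\<forall>p\<in>topspace X. 0 \<le> \<rho> p) \<and>
        X closure_of {p \<in> topspace X. \<rho> p \<noteq> 0} \<subseteq> fst c) \<and>
     (\<forall>p\<in>topspace X. (\<Sum>(c, \<rho>)\<leftarrow>P. \<rho> p) = 1)"

text \<open>The length of the boundary of a compact surface in a (possibly degenerate) metric \<open>g\<close>, as the
  sum over a finite partition of unity of the integrals of the length element
  \<open>sqrt (g c (t, 0) $ 1 $ 1) dt\<close>. By the change of variables formula the value does not depend on
  the partition of unity, so it is immaterial which one is chosen.\<close>

definition boundary_length :: "'a topology \<Rightarrow> 'a chart set \<Rightarrow> 'a tensor2 \<Rightarrow> real" where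
  "boundary_length X A g =
     (\<Sum>(c, \<rho>)\<leftarrow>(SOME P. partition_of_unity X A P).
        LBINT t:{t. vector [t, 0] \<in> coord_image c}.
          \<rho> (param c (vector [t, 0])) * sqrt (g c (vector [t, 0]) $ 1 $ 1))"

section \<open>Minimal surfaces in the ball with orthogonal boundary\<close>

definition isometric_immersion :: "'a chart set \<Rightarrow> 'a tensor2 \<Rightarrow> ('a \<Rightarrow> real^'n) \<Rightarrow> bool" where
  "isometric_immersion A g F \<longleftrightarrow>
     smooth_map A F \<and>
     (\<forall>c\<in>A. \<forall>z\<in>coord_image c. inj (chart_deriv c (F \<circ> param c) z) \<and> pullback_metric F c z = g c z)"

text \<open>The second fundamental form on coordinate vectors: the component of the second derivative
  normal to the tangent plane. The closest point of a subspace is the orthogonal projection.\<close>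

definition second_fundamental_form ::
    "('a \<Rightarrow> real^'n) \<Rightarrow> 'a chart \<Rightarrow> real^2 \<Rightarrow> 2 \<Rightarrow> 2 \<Rightarrow> real^'n" where
  "second_fundamental_form F c z i j =
     (let w = chart_partial c i (chart_partial c j (F \<circ> param c)) z
      in w - closest_point (range (chart_deriv c (F \<circ> param c) z)) w)"

definition mean_curvature ::
    "'a tensor2 \<Rightarrow> ('a \<Rightarrow> real^'n) \<Rightarrow> 'a chart \<Rightarrow> real^2 \<Rightarrow> real^'n" where
  "mean_curvature g F c z =
     (\<Sum>i\<in>UNIV. \<Sum>j\<in>UNIV. (matrix_inv (g c z) $ i $ j) *\<^sub>R second_fundamental_form F c z i j)"

definition minimal_immersion :: "'a chart set \<Rightarrow> 'a tensor2 \<Rightarrow> ('a \<Rightarrow> real^'n) \<Rightarrow> bool" where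
  "minimal_immersion A g F \<longleftrightarrow> (\<forall>c\<in>A. \<forall>z\<in>coord_image c. mean_curvature g F c z = 0)"

text \<open>At a boundary point of the half plane the vectors with negative second coordinate point
  out of the surface.\<close>

definition outward_unit_conormal :: "'a tensor2 \<Rightarrow> 'a chart \<Rightarrow> real^2 \<Rightarrow> real^2 \<Rightarrow> bool" where
  "outward_unit_conormal g c z \<eta> \<longleftrightarrow>
     \<eta> \<bullet> (g c z *v \<eta>) = 1 \<and> \<eta> \<bullet> (g c z *v axis 1 1) = 0 \<and> \<eta> $ 2 < 0"

definition meets_sphere_orthogonally :: "'a chart set \<Rightarrow> 'a tensor2 \<Rightarrow> ('a \<Rightarrow> real^'n) \<Rightarrow> bool" where
  "meets_sphere_orthogonally A g F \<longleftrightarrow>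
     (\<forall>c\<in>A. \<forall>z\<in>coord_image c. z $ 2 = 0 \<longrightarrow>
        (\<exists>\<eta>. outward_unit_conormal g c z \<eta> \<and> chart_deriv c (F \<circ> param c) z \<eta> = F (param c z)))"

section \<open>Boundary conformal volume\<close>

text \<open>The conformal diffeomorphisms of the closed unit ball, smooth up to the boundary. Maps are
  identified with their restriction to the ball: the values outside are arbitrary.\<close>

definition conformal_ball_diffeos :: "(real^'n \<Rightarrow> real^'n) set" where
  "conformal_ball_diffeos =
     {f. bij_betw f (cball 0 1) (cball 0 1) \<and>
         smooth_on (cball 0 1) f \<and> smooth_on (cball 0 1) (inv_into (cball 0 1) f) \<and>
         (\<forall>x\<in>cball 0 1. \<exists>r>0. \<forall>u v.
            frechet_derivative f (at x within cball 0 1) u \<bullet> frechet_derivative f (at x within cball 0 1) v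
              = r\<^sup>2 * (u \<bullet> v))}"

definition boundary_conformal_volume :: "'a topology \<Rightarrow> 'a chart set \<Rightarrow> ('a \<Rightarrow> real^'n) \<Rightarrow> ereal" where
  "boundary_conformal_volume X A F =
     (SUP f\<in>conformal_ball_diffeos. ereal (boundary_length X A (pullback_metric (f \<circ> F))))"

end

theory Submission
  imports Defs
begin

text \<open>For a conformal diffeomorphism \<open>f\<close> of the ball with conformal factor \<open>\<sigma> = |Df|\<^sup>2\<close>, the image of
  the boundary has length element \<open>\<surd>\<sigma> ds\<close>. Since \<open>f\<close> preserves the unit sphere, comparing second
  derivatives along great circles gives \<open>\<partial> ln \<sigma> / \<partial>x = 2 (\<surd>\<sigma> - 1)\<close> for \<open>|x| = 1\<close>, and \<open>x\<close> is the
  conormal of \<open>\<Sigma>\<close>. As \<open>\<sigma> |dx|\<^sup>2\<close> is flat, the Gauss equation shows that the trace of the Hessian of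
  \<open>ln \<sigma>\<close> over every plane is nonpositive, so \<open>ln \<sigma>\<close> is superharmonic on the minimal surface \<open>\<Sigma>\<close>.
  By the divergence theorem the length of the boundary does not increase under \<open>f\<close>, with equality for
  the identity. No classification of the conformal maps is needed.\<close>

section \<open>Calculus of iterated directional derivatives\<close>

text \<open>The function put into the divergence theorem is ln \<sigma> because its conormal
  derivative is exactly twice the excess of the new length element over the old one. The loss of
  length is thus minus half the integral of the Laplacian of ln \<sigma> over \<Sigma>. Minimality
  kills the term of that Laplacian that pairs the gradient with the mean curvature, leaving the
  trace of the ambient Hessian over the tangent plane. Two features of the definitions shape the
  work. Derivatives up to third order are taken at boundary points, where they are one-sided; they
  are identified with the derivatives of local smooth extensions. And the length is a sum over an
  unspecified partition of unity, each term living in its own chart. The divergence theorem is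
  therefore applied to one cut-off function at a time, which leaves integrals pairing the gradient
  of the cut-off with that of ln \<sigma>. They cancel in total because the cut-offs add up to 1,
  but only after a change of variables has brought them into common charts. One partition serves all
  metrics, so two lengths can be compared term by term.\<close>

lemma frechet_derivative_cong_open:
  assumes "open U" "x \<in> U" "\<And>y. y \<in> U \<Longrightarrow> f y = g y"
  shows "frechet_derivative f (at x) = frechet_derivative g (at x)"
proof -
  have "(f has_derivative D) (at x) \<longleftrightarrow> (g has_derivative D) (at x)" for D
    using has_derivative_transform_within_open[OF _ assms(1,2)] assms(3) by metis
  then show ?thesis unfolding frechet_derivative_def by simp
qed

lemma Ck_on_Suc_imp: "Ck_on (Suc k) U f \<Longrightarrow> Ck_on k U f"
proof (induction k arbitrary: f)
  case 0
  then show ?case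
    by (auto intro!: continuous_at_imp_continuous_on differentiable_imp_continuous_within)
next
  case (Suc k)
  then have "Ck_on (Suc k) U (\<lambda>x. frechet_derivative f (at x) v)" for v by simp
  then have "Ck_on k U (\<lambda>x. frechet_derivative f (at x) v)" for v using Suc.IH by blast
  then show ?case using Suc.prems by simp
qed

lemma Ck_on_imp_continuous_on: "Ck_on k U f \<Longrightarrow> continuous_on U f"
proof (induction k)
  case (Suc k)
  then show ?case using Ck_on_Suc_imp by blast
qed simp

lemma Ck_on_subset: "Ck_on k U f \<Longrightarrow> V \<subseteq> U \<Longrightarrow> Ck_on k V f"
  by (induction k arbitrary: f) (auto intro: continuous_on_subset)

lemma Ck_on_cong:
  assumes "open U" "Ck_on k U f" "\<And>x. x \<in> U \<Longrightarrow> f x = g x"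
  shows "Ck_on k U g"
  using assms(2,3)
proof (induction k arbitrary: f g)
  case 0
  then show ?case by (simp cong: continuous_on_cong)
next
  case (Suc k)
  have fd: "frechet_derivative g (at x) = frechet_derivative f (at x)" if "x \<in> U" for x
    using frechet_derivative_cong_open[OF assms(1) that] Suc.prems(2) by metis
  have "g differentiable (at x)" if x: "x \<in> U" for x
  proof -
    obtain D where "(f has_derivative D) (at x)"
      using Suc.prems(1) x by (auto simp: differentiable_def)
    then have "(g has_derivative D) (at x)"
      using has_derivative_transform_within_open[OF _ assms(1) x] Suc.prems(2) by metis
    then show ?thesis by (auto simp: differentiable_def)
  qed
  moreover have "Ck_on k U (\<lambda>x. frechet_derivative g (at x) v)" for v
  proof (rule Suc.IH)
    show "Ck_on k U (\<lambda>x. frechet_derivative f (at x) v)" using Suc.prems(1) by simp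
  qed (simp add: fd)
  ultimately show ?case by simp
qed

lemma Ck_on_SucI:
  assumes "open U" "\<And>x. x \<in> U \<Longrightarrow> (f has_derivative f' x) (at x)"
    and "\<And>v. Ck_on k U (\<lambda>x. f' x v)"
  shows "Ck_on (Suc k) U f"
proof -
  have "Ck_on k U (\<lambda>x. frechet_derivative f (at x) v)" for v
  proof (rule Ck_on_cong[OF assms(1,3)])
    fix x assume "x \<in> U"
    from frechet_derivative_at[OF assms(2)[OF this]]
    show "f' x v = frechet_derivative f (at x) v" by simp
  qed
  then show ?thesis using assms(2) by (auto simp: differentiable_def)
qed

lemma Ck_on_const [simp]: "Ck_on k U (\<lambda>x. c)"
proof (induction k arbitrary: c)
  case (Suc k)
  then show ?case by (simp add: frechet_derivative_const)
qed simp

lemma Ck_on_bounded_linear: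
  assumes "bounded_linear f" "open U"
  shows "Ck_on k U f"
proof -
  have "Ck_on (Suc k) U f"
    by (rule Ck_on_SucI[OF assms(2) bounded_linear_imp_has_derivative[OF assms(1)]]) simp
  then show ?thesis by (rule Ck_on_Suc_imp)
qed

lemma Ck_on_has_derivative:
  "Ck_on (Suc k) U f \<Longrightarrow> x \<in> U \<Longrightarrow> (f has_derivative frechet_derivative f (at x)) (at x)"
  by (simp add: frechet_derivative_works)

lemma Ck_on_add:
  assumes "open U" "Ck_on k U f" "Ck_on k U g"
  shows "Ck_on k U (\<lambda>x. f x + g x)"
  using assms(2,3)
proof (induction k arbitrary: f g)
  case 0
  then show ?case by (auto intro: continuous_intros)
next
  case (Suc k)
  have *: "Ck_on k U (\<lambda>x. frechet_derivative f (at x) v)" "Ck_on k U (\<lambda>x. frechet_derivative g (at x) v)" for v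
    using Suc.prems by simp_all
  show ?case
    by (rule Ck_on_SucI[OF assms(1) has_derivative_add])
       (rule Ck_on_has_derivative[OF Suc.prems(1)] Ck_on_has_derivative[OF Suc.prems(2)] Suc.IH * | assumption)+
qed

lemma Ck_on_bilinear:
  assumes p: "bounded_bilinear p" and "open U" "Ck_on k U f" "Ck_on k U g"
  shows "Ck_on k U (\<lambda>x. p (f x) (g x))"
  using assms(3,4)
proof (induction k arbitrary: f g)
  case 0
  then show ?case by (auto intro: bounded_bilinear.continuous_on[OF p])
next
  case (Suc k)
  have IH: "Ck_on k U (\<lambda>x. p (f x) (g x))" if "Ck_on k U f" "Ck_on k U g" for f g
    using Suc.IH that by blast
  have *: "Ck_on k U f" "Ck_on k U g"
    by (rule Ck_on_Suc_imp[OF Suc.prems(1)], rule Ck_on_Suc_imp[OF Suc.prems(2)])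
  have **: "Ck_on k U (\<lambda>x. frechet_derivative f (at x) v)" "Ck_on k U (\<lambda>x. frechet_derivative g (at x) v)" for v
    using Suc.prems by simp_all
  show ?case
    by (rule Ck_on_SucI[OF assms(2) bounded_bilinear.FDERIV[OF p]])
       (rule Ck_on_has_derivative[OF Suc.prems(1)] Ck_on_has_derivative[OF Suc.prems(2)]
         Ck_on_add[OF assms(2)] Suc.IH * ** | assumption)+
qed

lemma Ck_on_sum:
  assumes "open U" "\<And>i. i \<in> I \<Longrightarrow> Ck_on k U (f i)"
  shows "Ck_on k U (\<lambda>x. \<Sum>i\<in>I. f i x)"
  using assms(2)
  by (induction I rule: infinite_finite_induct) (auto intro: Ck_on_add[OF assms(1)])

text \<open>In the chain rule the direction fed to the derivative of \<open>g\<close> moves with the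
  point, whereas \<open>Ck_on\<close> speaks of fixed directions only. Expanding that direction in
  \<open>Basis\<close> turns the derivative into a finite sum of products to which the induction
  hypothesis applies.\<close>

lemma Ck_on_compose:
  fixes f :: "'a::euclidean_space \<Rightarrow> 'b::euclidean_space" and g :: "'b \<Rightarrow> 'c::euclidean_space"
  assumes "open U" "open V" "f ` U \<subseteq> V" "Ck_on k U f" "Ck_on k V g"
  shows "Ck_on k U (\<lambda>x. g (f x))"
  using assms(4,5)
proof (induction k arbitrary: g)
  case 0
  then show ?case using assms(3) by (auto intro: continuous_on_compose2)
next
  case (Suc k)
  let ?f' = "\<lambda>x. frechet_derivative f (at x)" and ?g' = "\<lambda>y. frechet_derivative g (at y)"
  have der: "((\<lambda>x. g (f x)) has_derivative (\<lambda>v. ?g' (f x) (?f' x v))) (at x)" if "x \<in> U" for x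
    by (rule has_derivative_compose[OF Ck_on_has_derivative[OF Suc.prems(1) that] Ck_on_has_derivative[OF Suc.prems(2)]])
       (use assms(3) that in auto)
  have eq: "?g' (f x) (?f' x v) = (\<Sum>b\<in>Basis. (?f' x v \<bullet> b) *\<^sub>R ?g' (f x) b)" if "x \<in> U" for x v
  proof -
    have "f x \<in> V" using that assms(3) by auto
    then have lin: "linear (?g' (f x))"
      using Ck_on_has_derivative[OF Suc.prems(2)] has_derivative_linear by blast
    have "?g' (f x) (?f' x v) = ?g' (f x) (\<Sum>b\<in>Basis. (?f' x v \<bullet> b) *\<^sub>R b)"
      by (simp add: euclidean_representation)
    then show ?thesis by (simp add: linear_sum[OF lin] linear_scale[OF lin])
  qed
  have "Ck_on k U (\<lambda>x. \<Sum>b\<in>Basis. (?f' x v \<bullet> b) *\<^sub>R ?g' (f x) b)" for v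
  proof (intro Ck_on_sum[OF assms(1)] Ck_on_bilinear[OF bounded_bilinear_scaleR assms(1)]
      Ck_on_bilinear[OF bounded_bilinear_inner assms(1)] Ck_on_const)
    show "Ck_on k U (\<lambda>x. ?f' x v)" using Suc.prems(1) by simp
    show "Ck_on k U (\<lambda>x. ?g' (f x) b)" for b
      by (rule Suc.IH) (use Suc.prems(2) Ck_on_Suc_imp[OF Suc.prems(1)] in simp_all)
  qed
  then have "Ck_on k U (\<lambda>x. ?g' (f x) (?f' x v))" for v
    by (rule Ck_on_cong[OF assms(1)]) (simp add: eq)
  from Ck_on_SucI[OF assms(1) der this] show ?case .
qed

section \<open>Inverse, logarithm and square root are smooth where they are used\<close>

lemma Ck_on_real_deriv:
  fixes f f' :: "real \<Rightarrow> real"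
  assumes "open U" "\<And>x. x \<in> U \<Longrightarrow> (f has_real_derivative f' x) (at x)" "Ck_on k U f'"
  shows "Ck_on (Suc k) U f"
proof (rule Ck_on_SucI[OF assms(1), where f' = "\<lambda>x v. f' x * v"])
  show "Ck_on k U (\<lambda>x. f' x * v)" for v
    by (intro Ck_on_bilinear[OF bounded_bilinear_mult assms(1)] assms(3) Ck_on_const)
qed (use assms(2) in \<open>auto simp: has_field_derivative_def\<close>)

lemma Ck_on_mult:
  fixes f g :: "'a::euclidean_space \<Rightarrow> real"
  assumes "open U" "Ck_on k U f" "Ck_on k U g"
  shows "Ck_on k U (\<lambda>x. f x * g x)"
  using Ck_on_bilinear[OF bounded_bilinear_mult] assms by blast

text \<open>The derivative is a polynomial in the function itself, so one order of smoothness yields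
  the next. \<open>Ck_on_sqrt\<close> runs the same way, its derivative being half the reciprocal of
  the function.\<close>

lemma Ck_on_inverse: "Ck_on k (- {0::real}) inverse"
proof (induction k)
  case 0
  then show ?case by (auto intro: continuous_intros)
next
  case (Suc k)
  show ?case
  proof (rule Ck_on_real_deriv)
    show "Ck_on k (- {0::real}) (\<lambda>x. (-1) * (inverse x * inverse x))"
      by (intro Ck_on_mult Suc.IH Ck_on_const) auto
    show "(inverse has_real_derivative - 1 * (inverse x * inverse x)) (at x)" if "x \<in> - {0}" for x
      using that DERIV_inverse[of x] by (simp add: power2_eq_square)
  qed auto
qed

lemma Ck_on_ln: "Ck_on k {0::real<..} ln"
proof (cases k)
  case 0
  then show ?thesis by (auto intro!: continuous_intros)
next
  case (Suc j)
  have "Ck_on (Suc j) {0::real<..} ln"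
  proof (rule Ck_on_real_deriv)
    show "Ck_on j {0::real<..} inverse" by (rule Ck_on_subset[OF Ck_on_inverse]) auto
    show "(ln has_real_derivative inverse x) (at x)" if "x \<in> {0<..}" for x
      using that DERIV_ln by auto
  qed auto
  then show ?thesis using Suc by simp
qed

lemma Ck_on_sqrt: "Ck_on k {0::real<..} sqrt"
proof (induction k)
  case 0
  then show ?case by (auto intro: continuous_intros)
next
  case (Suc k)
  have "Ck_on k {0::real<..} (\<lambda>x. inverse (sqrt x))"
    by (rule Ck_on_compose[where V = "- {0}" and g = inverse]) (auto intro: Suc.IH Ck_on_inverse)
  then have *: "Ck_on k {0::real<..} (\<lambda>x. inverse (sqrt x) * (1/2))"
    by (intro Ck_on_mult Ck_on_const) auto
  have "(sqrt has_real_derivative inverse (sqrt x) * (1/2)) (at x)" if "x \<in> {0<..}" for x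
    using that DERIV_real_sqrt[of x] by simp
  from Ck_on_real_deriv[OF _ this *] show ?case by auto
qed

text \<open>Two applications of the mean value theorem, along \<open>v\<close> and then along
  \<open>w\<close>, turn the second difference into the mixed derivative at a nearby point. The
  quotient is symmetric in \<open>v\<close> and \<open>w\<close> while its limit is one ordered
  derivative; this forces the two orders to agree. Positive \<open>s\<close> is enough for
  that.\<close>

lemma Ck2_symmetric_real:
  fixes h :: "'a::euclidean_space \<Rightarrow> real"
  assumes U: "open U" "x \<in> U" and h: "Ck_on 2 U h"
  shows "((\<lambda>s. (h (x + s *\<^sub>R v + s *\<^sub>R w) - h (x + s *\<^sub>R v) - h (x + s *\<^sub>R w) + h x) / s\<^sup>2)
     \<longlongrightarrow> frechet_derivative (\<lambda>y. frechet_derivative h (at y) v) (at x) w) (at_right 0)"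
proof -
  let ?d = "\<lambda>y. frechet_derivative h (at y) v"
  let ?dd = "\<lambda>y. frechet_derivative ?d (at y) w"
  have h2: "Ck_on (Suc (Suc 0)) U h" using h by (simp add: numeral_2_eq_2)
  have hd: "(h has_derivative frechet_derivative h (at y)) (at y)" if "y \<in> U" for y
    by (rule Ck_on_has_derivative[OF h2 that])
  have d1: "Ck_on (Suc 0) U ?d" using h2 by simp
  have dd: "(?d has_derivative frechet_derivative ?d (at y)) (at y)" if "y \<in> U" for y
    by (rule Ck_on_has_derivative[OF d1 that])
  have chain: "((\<lambda>a. k (c a)) has_derivative (\<lambda>t. D (t *\<^sub>R u))) (at a)"
    if "(k has_derivative D) (at (c a))" "(c has_derivative (\<lambda>t. t *\<^sub>R u)) (at a)"
    for k :: "'a \<Rightarrow> real" and c :: "real \<Rightarrow> 'a" and D a u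
    using has_derivative_compose[OF that(2,1)] .
  have cont: "isCont ?dd x"
    using d1 U by (auto simp: continuous_on_eq_continuous_at)
  show ?thesis
  proof (rule tendstoI)
    fix e :: real assume "e > 0"
    obtain r1 where r1: "r1 > 0" "ball x r1 \<subseteq> U" using U open_contains_ball by blast
    obtain r2 where r2: "r2 > 0" "\<And>y. dist y x < r2 \<Longrightarrow> dist (?dd y) (?dd x) < e"
      using cont \<open>e > 0\<close> unfolding continuous_at_eps_delta by metis
    \<comment> \<open>Chosen so that the whole parallelogram spanned by \<open>s *\<^sub>R v\<close>
      and \<open>s *\<^sub>R w\<close> stays in the neighbourhood; the summand 1 keeps the
      denominator positive when both vectors vanish.\<close>
    define r where "r = min r1 r2 / (1 + norm v + norm w)"
    have nz: "1 + norm v + norm w > 0" using norm_ge_zero[of v] norm_ge_zero[of w] by linarith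
    have "r > 0" unfolding r_def using r1 r2 nz by simp
    have small: "norm (a *\<^sub>R v + b *\<^sub>R w) < min r1 r2" if "0 \<le> a" "a \<le> s" "0 \<le> b" "b \<le> s" "0 < s" "s < r" for a b s
    proof -
      have "norm (a *\<^sub>R v + b *\<^sub>R w) \<le> a * norm v + b * norm w"
        using norm_triangle_ineq[of "a *\<^sub>R v" "b *\<^sub>R w"] that by simp
      also have "\<dots> \<le> s * norm v + s * norm w" using that by (intro add_mono mult_right_mono) auto
      also have "\<dots> < s * (1 + norm v + norm w)" using that by (simp add: algebra_simps)
      also have "\<dots> < r * (1 + norm v + norm w)" using that nz by simp
      also have "\<dots> = min r1 r2" unfolding r_def using nz by simp
      finally show ?thesis .
    qed
    have inU: "x + a *\<^sub>R v + b *\<^sub>R w \<in> U" "dist (x + a *\<^sub>R v + b *\<^sub>R w) x < r2"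
      if "0 \<le> a" "a \<le> s" "0 \<le> b" "b \<le> s" "0 < s" "s < r" for a b s
    proof -
      have "dist (x + a *\<^sub>R v + b *\<^sub>R w) x < min r1 r2"
        using small[OF that] by (simp add: dist_norm add.assoc)
      then show "x + a *\<^sub>R v + b *\<^sub>R w \<in> U" "dist (x + a *\<^sub>R v + b *\<^sub>R w) x < r2"
        using r1(2) by (auto simp: dist_commute subset_iff)
    qed
    have "dist ((h (x + s *\<^sub>R v + s *\<^sub>R w) - h (x + s *\<^sub>R v) - h (x + s *\<^sub>R w) + h x) / s\<^sup>2) (?dd x) < e"
      if s: "0 < s" "s < r" for s
    proof -
      \<comment> \<open>The second difference is the increment of \<open>q\<close> over
        \<open>[0, s]\<close>, and \<open>q\<close> itself is a first difference in direction
        \<open>w\<close>.\<close>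
      define q where "q a = h (x + a *\<^sub>R v + s *\<^sub>R w) - h (x + a *\<^sub>R v)" for a
      have "(q has_real_derivative ?d (x + a *\<^sub>R v + s *\<^sub>R w) - ?d (x + a *\<^sub>R v)) (at a)"
        if a: "0 \<le> a" "a \<le> s" for a
      proof -
        have U1: "x + a *\<^sub>R v + s *\<^sub>R w \<in> U" "x + a *\<^sub>R v \<in> U"
          using inU[OF a(1,2), of s] inU[OF a(1,2), of 0] s by auto
        have l: "linear (frechet_derivative h (at (x + a *\<^sub>R v + s *\<^sub>R w)))" "linear (frechet_derivative h (at (x + a *\<^sub>R v)))"
          using hd[OF U1(1)] hd[OF U1(2)] has_derivative_linear by auto
        have "((\<lambda>a. h (x + a *\<^sub>R v + s *\<^sub>R w)) has_derivative (\<lambda>t. frechet_derivative h (at (x + a *\<^sub>R v + s *\<^sub>R w)) (t *\<^sub>R v))) (at a)"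
          by (rule chain[OF hd, where c = "\<lambda>a. x + a *\<^sub>R v + s *\<^sub>R w"]) (use U1 in \<open>auto intro!: derivative_eq_intros\<close>)
        moreover have "((\<lambda>a. h (x + a *\<^sub>R v)) has_derivative (\<lambda>t. frechet_derivative h (at (x + a *\<^sub>R v)) (t *\<^sub>R v))) (at a)"
          by (rule chain[OF hd, where c = "\<lambda>a. x + a *\<^sub>R v"]) (use U1 in \<open>auto intro!: derivative_eq_intros\<close>)
        ultimately show ?thesis unfolding q_def has_field_derivative_def
          by (rule has_derivative_eq_rhs[OF has_derivative_diff])
             (rule ext, simp only: l[THEN linear_scale] real_scaleR_def right_diff_distrib[symmetric], rule mult.commute)
      qed
      from MVT2[OF s(1) this] obtain a where a: "0 < a" "a < s" "q s - q 0 = (s - 0) * (?d (x + a *\<^sub>R v + s *\<^sub>R w) - ?d (x + a *\<^sub>R v))"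
        by blast
      define p where "p b = ?d (x + a *\<^sub>R v + b *\<^sub>R w)" for b
      have "(p has_real_derivative ?dd (x + a *\<^sub>R v + b *\<^sub>R w)) (at b)" if b: "0 \<le> b" "b \<le> s" for b
      proof -
        have U1: "x + a *\<^sub>R v + b *\<^sub>R w \<in> U" using inU[of a s b] a b s by auto
        have l: "linear (frechet_derivative ?d (at (x + a *\<^sub>R v + b *\<^sub>R w)))"
          using dd[OF U1] has_derivative_linear by auto
        have "((\<lambda>b. ?d (x + a *\<^sub>R v + b *\<^sub>R w)) has_derivative (\<lambda>t. frechet_derivative ?d (at (x + a *\<^sub>R v + b *\<^sub>R w)) (t *\<^sub>R w))) (at b)"
          by (rule chain[OF dd, where c = "\<lambda>b. x + a *\<^sub>R v + b *\<^sub>R w"]) (use U1 in \<open>auto intro!: derivative_eq_intros\<close>)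
        then show ?thesis unfolding p_def has_field_derivative_def
          by (rule has_derivative_eq_rhs) (simp add: linear_scale[OF l] fun_eq_iff)
      qed
      from MVT2[OF s(1) this] obtain b where b: "0 < b" "b < s" "p s - p 0 = (s - 0) * ?dd (x + a *\<^sub>R v + b *\<^sub>R w)"
        by blast
      have "h (x + s *\<^sub>R v + s *\<^sub>R w) - h (x + s *\<^sub>R v) - h (x + s *\<^sub>R w) + h x = q s - q 0"
        by (simp add: q_def)
      also have "\<dots> = s * (s * ?dd (x + a *\<^sub>R v + b *\<^sub>R w))" using a b by (simp add: p_def)
      finally have "(h (x + s *\<^sub>R v + s *\<^sub>R w) - h (x + s *\<^sub>R v) - h (x + s *\<^sub>R w) + h x) / s\<^sup>2
          = ?dd (x + a *\<^sub>R v + b *\<^sub>R w)" using s by (simp add: power2_eq_square)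
      moreover have "dist (?dd (x + a *\<^sub>R v + b *\<^sub>R w)) (?dd x) < e"
        by (rule r2(2)) (use inU[of a s b] a b s in auto)
      ultimately show ?thesis by simp
    qed
    then show "\<forall>\<^sub>F s in at_right 0. dist ((h (x + s *\<^sub>R v + s *\<^sub>R w) - h (x + s *\<^sub>R v) - h (x + s *\<^sub>R w) + h x) / s\<^sup>2) (?dd x) < e"
      unfolding eventually_at_right_field using \<open>r > 0\<close> by (intro exI[of _ r]) auto
  qed
qed

lemma frechet_derivative_inner_left:
  assumes "(h has_derivative D) (at x)"
  shows "frechet_derivative (\<lambda>y. h y \<bullet> b) (at x) = (\<lambda>v. frechet_derivative h (at x) v \<bullet> b)"
  using frechet_derivative_at[OF has_derivative_inner_left[OF assms, of b]] frechet_derivative_at[OF assms] by simp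

text \<open>Tested against basis vectors, because the mean value theorem behind the real case has no
  vector-valued form.\<close>

lemma Ck2_symmetric:
  fixes h :: "'a::euclidean_space \<Rightarrow> 'b::euclidean_space"
  assumes U: "open U" "x \<in> U" and h: "Ck_on 2 U h"
  shows "frechet_derivative (\<lambda>y. frechet_derivative h (at y) v) (at x) w =
         frechet_derivative (\<lambda>y. frechet_derivative h (at y) w) (at x) v"
proof (rule euclidean_eqI)
  fix b :: 'b assume "b \<in> Basis"
  let ?h = "\<lambda>y. h y \<bullet> b"
  have h2: "Ck_on (Suc (Suc 0)) U h" using h by (simp add: numeral_2_eq_2)
  have C: "Ck_on 2 U ?h"
    by (intro Ck_on_bilinear[OF bounded_bilinear_inner U(1)] h Ck_on_const)
  have 1: "frechet_derivative ?h (at y) v = frechet_derivative h (at y) v \<bullet> b" if "y \<in> U" for y v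
    using frechet_derivative_inner_left[OF Ck_on_has_derivative[OF h2 that]] by metis
  have 2: "frechet_derivative (\<lambda>y. frechet_derivative ?h (at y) v) (at x) w =
        frechet_derivative (\<lambda>y. frechet_derivative h (at y) v) (at x) w \<bullet> b" for v w
  proof -
    have "frechet_derivative (\<lambda>y. frechet_derivative ?h (at y) v) (at x) =
       frechet_derivative (\<lambda>y. frechet_derivative h (at y) v \<bullet> b) (at x)"
      by (rule frechet_derivative_cong_open[OF U]) (simp add: 1)
    moreover have "Ck_on (Suc 0) U (\<lambda>y. frechet_derivative h (at y) v)" using h2 by simp
    ultimately show ?thesis
      using frechet_derivative_inner_left[OF Ck_on_has_derivative[OF _ U(2)]] by metis
  qed
  have "frechet_derivative (\<lambda>y. frechet_derivative ?h (at y) v) (at x) w =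
         frechet_derivative (\<lambda>y. frechet_derivative ?h (at y) w) (at x) v"
  proof (rule tendsto_unique[OF _ Ck2_symmetric_real[OF U C]])
    have "(\<lambda>s. (h (x + s *\<^sub>R v + s *\<^sub>R w) \<bullet> b - h (x + s *\<^sub>R v) \<bullet> b - h (x + s *\<^sub>R w) \<bullet> b + h x \<bullet> b) / s\<^sup>2)
      = (\<lambda>s. (h (x + s *\<^sub>R w + s *\<^sub>R v) \<bullet> b - h (x + s *\<^sub>R w) \<bullet> b - h (x + s *\<^sub>R v) \<bullet> b + h x \<bullet> b) / s\<^sup>2)"
      by (auto simp: algebra_simps)
    then show "((\<lambda>s. (h (x + s *\<^sub>R v + s *\<^sub>R w) \<bullet> b - h (x + s *\<^sub>R v) \<bullet> b - h (x + s *\<^sub>R w) \<bullet> b + h x \<bullet> b) / s\<^sup>2)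
      \<longlongrightarrow> frechet_derivative (\<lambda>y. frechet_derivative ?h (at y) w) (at x) v) (at_right 0)"
      using Ck2_symmetric_real[OF U C, of w v] by simp
  qed simp
  then show "frechet_derivative (\<lambda>y. frechet_derivative h (at y) v) (at x) w \<bullet> b =
         frechet_derivative (\<lambda>y. frechet_derivative h (at y) w) (at x) v \<bullet> b"
    by (simp add: 2)
qed

section \<open>Smooth functions on regular domains\<close>

text \<open>Derivatives within such a set are unique; half planes, balls and their relatively open subsets
  are of this form.\<close>

definition regular_domain :: "'a::euclidean_space set \<Rightarrow> bool" where
  "regular_domain S \<longleftrightarrow>
     (\<exists>K. convex K \<and> interior K \<noteq> {} \<and> openin (top_of_set K) S)"

text \<open>With the direction placed before the function, \<open>dir_deriv S v f\<close> is again a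
  function on the domain, so derivatives can be iterated and \<open>smooth_on\<close> can be asked
  of them.\<close>

definition dir_deriv :: "'a::real_normed_vector set \<Rightarrow> 'a \<Rightarrow> ('a \<Rightarrow> 'b::real_normed_vector) \<Rightarrow> 'a \<Rightarrow> 'b" where
  "dir_deriv S v f x = frechet_derivative f (at x within S) v"

lemma regular_domain_convex: "convex K \<Longrightarrow> interior K \<noteq> {} \<Longrightarrow> regular_domain K"
  unfolding regular_domain_def by (intro exI[of _ K]) auto

lemma regular_domain_openin: "regular_domain S \<Longrightarrow> openin (top_of_set S) T \<Longrightarrow> regular_domain T"
  unfolding regular_domain_def using openin_trans by blast

lemma at_within_openin:
  assumes "openin (top_of_set S) T" "x \<in> T"
  shows "at x within T = at x within S"
proof -
  obtain U where U: "open U" "T = S \<inter> U" using assms(1) by (auto simp: openin_open)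
  show ?thesis
    by (rule at_within_nhd[of x U]) (use U assms(2) in auto)
qed

text \<open>The difference of two derivatives is a derivative of the zero function. It kills every
  direction \<open>y - x\<close> with \<open>y\<close> in the convex set, since the segment from
  \<open>x\<close> towards \<open>y\<close> starts inside \<open>S\<close>; these directions span
  because the convex set has interior points.\<close>

lemma has_derivative_unique_regular:
  fixes f :: "'a::euclidean_space \<Rightarrow> 'b::euclidean_space"
  assumes S: "regular_domain S" "x \<in> S"
    and D: "(f has_derivative D1) (at x within S)" "(f has_derivative D2) (at x within S)"
  shows "D1 = D2"
proof -
  obtain K U where K: "convex K" "interior K \<noteq> {}" "open U" "S = K \<inter> U"
    using S(1) unfolding regular_domain_def openin_open by blast
  obtain y0 where y0: "y0 \<in> interior K" using K(2) by blast
  then obtain e where e: "e > 0" "ball y0 e \<subseteq> K" using mem_interior by blast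
  let ?D = "\<lambda>v. D1 v - D2 v"
  have D0: "((\<lambda>_. 0) has_derivative ?D) (at x within S)"
    using has_derivative_diff[OF D] by simp
  have lin: "linear ?D" using D0 has_derivative_linear by blast
  have zero: "?D (y - x) = 0" if y: "y \<in> K" for y
  proof -
    let ?c = "\<lambda>t::real. x + t *\<^sub>R (y - x)"
    have "open (?c -` U)" using K(3) by (intro continuous_open_vimage) (auto intro!: continuous_intros)
    moreover have "0 \<in> ?c -` U" using S(2) K(4) by auto
    ultimately obtain d where d: "d > 0" "ball 0 d \<subseteq> ?c -` U" by (meson open_contains_ball)
    \<comment> \<open>The bound \<open>d/2\<close> keeps the segment in the open set
      \<open>U\<close>, the bound 1 keeps it between \<open>x\<close> and \<open>y\<close> and hence
      in \<open>K\<close>.\<close>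
    define m where "m = min (d/2) 1"
    have m: "m > 0" "m < d" "m \<le> 1" using d by (auto simp: m_def)
    have im: "?c ` {0..m} \<subseteq> S"
    proof (safe)
      fix t assume t: "t \<in> {0..m}"
      have "?c t \<in> U" using d(2) t m by (auto simp: subset_iff dist_norm)
      moreover have "?c t = (1 - t) *\<^sub>R x + t *\<^sub>R y" by (simp add: algebra_simps)
      then have "?c t \<in> K" using K(1) y S(2) K(4) t m by (auto intro!: convexD)
      ultimately show "?c t \<in> S" using K(4) by blast
    qed
    have "(?c has_derivative (\<lambda>t. t *\<^sub>R (y - x))) (at 0 within {0..m})"
      by (auto intro!: derivative_eq_intros)
    moreover have "((\<lambda>_. 0) has_derivative ?D) (at (?c 0) within ?c ` {0..m})"
      using has_derivative_subset[OF D0 im] by simp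
    ultimately have "((\<lambda>_::real. 0) has_derivative (\<lambda>t. ?D (t *\<^sub>R (y - x)))) (at 0 within {0..m})"
      by (rule has_derivative_in_compose)
    then have v: "((\<lambda>_::real. 0) has_vector_derivative ?D (y - x)) (at 0 within cbox 0 m)"
      unfolding has_vector_derivative_def linear_scale[OF lin] cbox_interval .
    show ?thesis
      by (rule vector_derivative_unique_within_closed_interval[OF m(1) _ v has_vector_derivative_const])
         (use m in auto)
  qed
  \<comment> \<open>Up to scaling, \<open>b\<close> is the difference of two points of a ball inside
    \<open>K\<close>, hence of two directions already known to be killed.\<close>
  have "?D b = 0" for b
  proof (cases "b = 0")
    case True
    then show ?thesis using linear_0[OF lin] by simp
  next
    case False
    define s where "s = e / (2 * norm b)"
    have s: "s > 0" using e False by (simp add: s_def)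
    have "y0 + s *\<^sub>R b \<in> K" using e False by (intro subsetD[OF e(2)]) (auto simp: dist_norm s_def)
    moreover have "y0 \<in> K" using e by auto
    ultimately have "?D (y0 + s *\<^sub>R b - x) - ?D (y0 - x) = 0" using zero by simp
    then have "?D ((y0 + s *\<^sub>R b - x) - (y0 - x)) = 0" by (simp only: linear_diff[OF lin])
    then have "s *\<^sub>R ?D b = 0" by (simp add: linear_scale[OF lin])
    then show ?thesis using s by simp
  qed
  then show ?thesis by (intro ext) (simp only: right_minus_eq)
qed

lemma dir_deriv_eq:
  fixes f :: "'a::euclidean_space \<Rightarrow> 'b::euclidean_space"
  assumes "regular_domain S" "x \<in> S" "(f has_derivative D) (at x within S)"
  shows "dir_deriv S v f x = D v"
proof -
  have "(f has_derivative frechet_derivative f (at x within S)) (at x within S)"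
    using assms(3) frechet_derivative_works differentiableI by blast
  from has_derivative_unique_regular[OF assms(1,2) this assms(3)]
  show ?thesis by (simp add: dir_deriv_def)
qed

lemma dir_deriv_cong:
  assumes "x \<in> S" "\<And>y. y \<in> S \<Longrightarrow> f y = g y"
  shows "dir_deriv S v f x = dir_deriv S v g x"
proof -
  have "(f has_derivative D) (at x within S) \<longleftrightarrow> (g has_derivative D) (at x within S)" for D
    by (rule iffI; rule has_derivative_transform[OF assms(1)]; simp add: assms(2))
  then show ?thesis unfolding dir_deriv_def frechet_derivative_def by simp
qed

lemma dir_deriv_openin:
  "openin (top_of_set S) T \<Longrightarrow> x \<in> T \<Longrightarrow> dir_deriv T v f x = dir_deriv S v f x"
  by (simp add: dir_deriv_def at_within_openin)

lemma smooth_onE: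
  assumes "smooth_on S f" "x \<in> S"
  obtains U h where "open U" "x \<in> U" "\<And>k. Ck_on k U h" "\<And>y. y \<in> S \<Longrightarrow> y \<in> U \<Longrightarrow> h y = f y"
proof -
  have "\<exists>U h. open U \<and> x \<in> U \<and> (\<forall>k. Ck_on k U h) \<and> (\<forall>y\<in>S \<inter> U. h y = f y)"
    using assms unfolding smooth_on_def by (rule bspec)
  then obtain U h where "open U" "x \<in> U" "\<forall>k. Ck_on k U h" "\<forall>y\<in>S \<inter> U. h y = f y"
    by (elim exE conjE)
  then show ?thesis by (intro that[of U h]) simp_all
qed

lemma extension_has_derivative:
  assumes "open U" "x \<in> U" "x \<in> S" "Ck_on (Suc 0) U h" "\<And>y. y \<in> S \<Longrightarrow> y \<in> U \<Longrightarrow> h y = f y"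
  shows "(f has_derivative frechet_derivative h (at x)) (at x within S)"
proof -
  have "(h has_derivative frechet_derivative h (at x)) (at x within S)"
    using Ck_on_has_derivative[OF assms(4,2)] by (rule has_derivative_at_withinI)
  moreover obtain d where "d > 0" "ball x d \<subseteq> U" using assms(1,2) open_contains_ball by blast
  ultimately show ?thesis
    using assms(3,5) by (intro has_derivative_transform_within[of h _ x S d f]) (auto simp: subset_iff dist_commute)
qed

lemma smooth_on_has_derivative:
  assumes "smooth_on S f" "x \<in> S"
  shows "(f has_derivative (\<lambda>v. dir_deriv S v f x)) (at x within S)"
proof -
  obtain U h where h: "open U" "x \<in> U" "\<And>k. Ck_on k U h" "\<And>y. y \<in> S \<Longrightarrow> y \<in> U \<Longrightarrow> h y = f y"
    by (rule smooth_onE[OF assms]) (rule that)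
  from extension_has_derivative[OF h(1,2) assms(2) h(3,4)]
  show ?thesis unfolding dir_deriv_def using frechet_derivative_works differentiableI by (metis (no_types, lifting) eta_contract_eq)
qed

lemma linear_dir_deriv:
  assumes "smooth_on S f" "x \<in> S"
  shows "linear (\<lambda>v. dir_deriv S v f x)"
  by (rule has_derivative_linear[OF smooth_on_has_derivative[OF assms]])

lemma smooth_on_imp_continuous_on:
  assumes "smooth_on S f" shows "continuous_on S f"
  by (rule has_derivative_continuous_on[OF smooth_on_has_derivative[OF assms]])

lemma dir_deriv_extension:
  fixes f :: "'a::euclidean_space \<Rightarrow> 'b::euclidean_space"
  assumes "regular_domain S" "open U" "x \<in> U" "x \<in> S" "Ck_on (Suc 0) U h"
    "\<And>y. y \<in> S \<Longrightarrow> y \<in> U \<Longrightarrow> h y = f y"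
  shows "dir_deriv S v f x = frechet_derivative h (at x) v"
  by (rule dir_deriv_eq[OF assms(1,4) extension_has_derivative[OF assms(2-6)]])

text \<open>By uniqueness, the derivative within \<open>S\<close> is that of any local extension, so
  a derivative of the extension is the required extension of the derivative.\<close>

lemma smooth_on_dir_deriv:
  assumes S: "regular_domain S" and f: "smooth_on S f"
  shows "smooth_on S (dir_deriv S v f)"
  unfolding smooth_on_def
proof
  fix x assume x: "x \<in> S"
  obtain U h where h: "open U" "x \<in> U" "\<And>k. Ck_on k U h" "\<And>y. y \<in> S \<Longrightarrow> y \<in> U \<Longrightarrow> h y = f y"
    by (rule smooth_onE[OF f x]) (rule that)
  have "Ck_on k U (\<lambda>y. frechet_derivative h (at y) v)" for k using h(3)[of "Suc k"] by simp
  moreover have "frechet_derivative h (at y) v = dir_deriv S v f y" if "y \<in> S \<inter> U" for y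
    using dir_deriv_extension[OF S h(1) _ _ h(3,4)] that by auto
  ultimately show "\<exists>U h. open U \<and> x \<in> U \<and> (\<forall>k. Ck_on k U h) \<and> (\<forall>y\<in>S \<inter> U. h y = dir_deriv S v f y)"
    using h(1,2) by blast
qed

text \<open>Both orders are computed on one local extension, which carries the symmetry of second
  derivatives to boundary points.\<close>

lemma dir_deriv_commute:
  assumes S: "regular_domain S" and f: "smooth_on S f" and x: "x \<in> S"
  shows "dir_deriv S v (dir_deriv S w f) x = dir_deriv S w (dir_deriv S v f) x"
proof -
  obtain U h where h: "open U" "x \<in> U" "\<And>k. Ck_on k U h" "\<And>y. y \<in> S \<Longrightarrow> y \<in> U \<Longrightarrow> h y = f y"
    by (rule smooth_onE[OF f x]) (rule that)
  have "dir_deriv S v (dir_deriv S w f) x = frechet_derivative (\<lambda>y. frechet_derivative h (at y) w) (at x) v" for v w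
  proof (rule dir_deriv_extension[OF S h(1,2) x])
    show "Ck_on (Suc 0) U (\<lambda>y. frechet_derivative h (at y) w)" using h(3)[of "Suc (Suc 0)"] by simp
    show "frechet_derivative h (at y) w = dir_deriv S w f y" if "y \<in> S" "y \<in> U" for y
      using dir_deriv_extension[OF S h(1) that(2,1) h(3,4)] by simp
  qed
  then show ?thesis using Ck2_symmetric[OF h(1,2,3)] by simp
qed

section \<open>Closure properties of smooth functions\<close>

lemma smooth_on_cong:
  assumes "smooth_on S f" "\<And>x. x \<in> S \<Longrightarrow> f x = g x" shows "smooth_on S g"
  unfolding smooth_on_def
proof
  fix x assume "x \<in> S"
  then obtain U h where
    "open U" "x \<in> U" "\<And>k. Ck_on k U h" "\<And>y. y \<in> S \<Longrightarrow> y \<in> U \<Longrightarrow> h y = f y"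
    by (rule smooth_onE[OF assms(1)]) (rule that)
  then show "\<exists>U h. open U \<and> x \<in> U \<and> (\<forall>k. Ck_on k U h) \<and> (\<forall>y\<in>S \<inter> U. h y = g y)"
    using assms(2) by (intro exI[of _ U] exI[of _ h]) simp
qed

lemma smooth_on_subset:
  assumes "smooth_on S f" "T \<subseteq> S" shows "smooth_on T f"
  unfolding smooth_on_def
proof
  fix x assume "x \<in> T"
  then have "x \<in> S" using assms(2) by auto
  then obtain U h where
    "open U" "x \<in> U" "\<And>k. Ck_on k U h" "\<And>y. y \<in> S \<Longrightarrow> y \<in> U \<Longrightarrow> h y = f y"
    by (rule smooth_onE[OF assms(1)]) (rule that)
  then show "\<exists>U h. open U \<and> x \<in> U \<and> (\<forall>k. Ck_on k U h) \<and> (\<forall>y\<in>T \<inter> U. h y = f y)"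
    using assms(2) by (intro exI[of _ U] exI[of _ h]) (simp add: subset_iff)
qed

lemma smooth_on_open: "open S \<Longrightarrow> (\<And>k. Ck_on k S f) \<Longrightarrow> smooth_on S f"
  unfolding smooth_on_def by (intro ballI exI[of _ S] exI[of _ f]) simp

lemma smooth_on_local:
  assumes "\<And>x. x \<in> S \<Longrightarrow> \<exists>T. openin (top_of_set S) T \<and> x \<in> T \<and> smooth_on T f"
  shows "smooth_on S f"
  unfolding smooth_on_def
proof
  fix x assume x: "x \<in> S"
  obtain T where T: "openin (top_of_set S) T" "x \<in> T" "smooth_on T f" using assms[OF x] by blast
  obtain V where V: "open V" "T = S \<inter> V" using T(1) by (auto simp: openin_open)
  obtain U h where h: "open U" "x \<in> U" "\<And>k. Ck_on k U h" "\<And>y. y \<in> T \<Longrightarrow> y \<in> U \<Longrightarrow> h y = f y"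
    by (rule smooth_onE[OF T(3,2)]) (rule that)
  show "\<exists>U h. open U \<and> x \<in> U \<and> (\<forall>k. Ck_on k U h) \<and> (\<forall>y\<in>S \<inter> U. h y = f y)"
    using h V T(2) Ck_on_subset[OF h(3), of "U \<inter> V"] by (intro exI[of _ "U \<inter> V"] exI[of _ h]) auto
qed

lemma smooth_on_const [simp]: "smooth_on S (\<lambda>x. c)"
  unfolding smooth_on_def by (intro ballI exI[of _ UNIV] exI[of _ "\<lambda>x. c"]) simp

lemma smooth_on_bounded_linear: "bounded_linear f \<Longrightarrow> smooth_on S f"
  by (rule smooth_on_subset[OF smooth_on_open[OF open_UNIV]]) (auto intro: Ck_on_bounded_linear)

lemma smooth_on_id: "smooth_on S (\<lambda>x. x)"
  by (rule smooth_on_bounded_linear) (rule bounded_linear_ident)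

lemma smooth_on_bilinear:
  assumes p: "bounded_bilinear p" and f: "smooth_on S f" and g: "smooth_on S g"
  shows "smooth_on S (\<lambda>x. p (f x) (g x))"
  unfolding smooth_on_def
proof
  fix x assume x: "x \<in> S"
  obtain U h where h: "open U" "x \<in> U" "\<And>k. Ck_on k U h" "\<And>y. y \<in> S \<Longrightarrow> y \<in> U \<Longrightarrow> h y = f y"
    by (rule smooth_onE[OF f x]) (rule that)
  obtain V i where i: "open V" "x \<in> V" "\<And>k. Ck_on k V i" "\<And>y. y \<in> S \<Longrightarrow> y \<in> V \<Longrightarrow> i y = g y"
    by (rule smooth_onE[OF g x]) (rule that)
  have "Ck_on k (U \<inter> V) (\<lambda>x. p (h x) (i x))" for k
    by (rule Ck_on_bilinear[OF p]) (use h i in \<open>auto intro: Ck_on_subset\<close>)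
  then show "\<exists>U h. open U \<and> x \<in> U \<and> (\<forall>k. Ck_on k U h) \<and> (\<forall>y\<in>S \<inter> U. h y = p (f y) (g y))"
    using h i by (intro exI[of _ "U \<inter> V"] exI[of _ "\<lambda>x. p (h x) (i x)"]) auto
qed

lemmas smooth_on_mult = smooth_on_bilinear[OF bounded_bilinear_mult]
lemmas smooth_on_inner = smooth_on_bilinear[OF bounded_bilinear_inner]
lemmas smooth_on_scaleR = smooth_on_bilinear[OF bounded_bilinear_scaleR]

lemma smooth_on_add:
  assumes f: "smooth_on S f" and g: "smooth_on S g"
  shows "smooth_on S (\<lambda>x. f x + g x)"
  unfolding smooth_on_def
proof
  fix x assume x: "x \<in> S"
  obtain U h where h: "open U" "x \<in> U" "\<And>k. Ck_on k U h" "\<And>y. y \<in> S \<Longrightarrow> y \<in> U \<Longrightarrow> h y = f y"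
    by (rule smooth_onE[OF f x]) (rule that)
  obtain V i where i: "open V" "x \<in> V" "\<And>k. Ck_on k V i" "\<And>y. y \<in> S \<Longrightarrow> y \<in> V \<Longrightarrow> i y = g y"
    by (rule smooth_onE[OF g x]) (rule that)
  have "Ck_on k (U \<inter> V) (\<lambda>x. h x + i x)" for k
    by (rule Ck_on_add) (use h i in \<open>auto intro: Ck_on_subset\<close>)
  then show "\<exists>U h. open U \<and> x \<in> U \<and> (\<forall>k. Ck_on k U h) \<and> (\<forall>y\<in>S \<inter> U. h y = f y + g y)"
    using h i by (intro exI[of _ "U \<inter> V"] exI[of _ "\<lambda>x. h x + i x"]) auto
qed

lemma smooth_on_minus: "smooth_on S f \<Longrightarrow> smooth_on S (\<lambda>x. - f x)"
  using smooth_on_scaleR[OF smooth_on_const[of S "-1::real"], of f] by simp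

lemma smooth_on_diff: "smooth_on S f \<Longrightarrow> smooth_on S g \<Longrightarrow> smooth_on S (\<lambda>x. f x - g x)"
  using smooth_on_add[OF _ smooth_on_minus, of S f g] by simp

lemma smooth_on_sum: "(\<And>i. i \<in> I \<Longrightarrow> smooth_on S (f i)) \<Longrightarrow> smooth_on S (\<lambda>x. \<Sum>i\<in>I. f i x)"
  by (induction I rule: infinite_finite_induct) (auto intro: smooth_on_add)

lemma smooth_on_compose:
  fixes f :: "'a::euclidean_space \<Rightarrow> 'b::euclidean_space" and g :: "'b \<Rightarrow> 'c::euclidean_space"
  assumes f: "smooth_on S f" and g: "smooth_on T g" and fS: "f ` S \<subseteq> T"
  shows "smooth_on S (\<lambda>x. g (f x))"
  unfolding smooth_on_def
proof
  fix x assume x: "x \<in> S"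
  obtain U h where h: "open U" "x \<in> U" "\<And>k. Ck_on k U h" "\<And>y. y \<in> S \<Longrightarrow> y \<in> U \<Longrightarrow> h y = f y"
    by (rule smooth_onE[OF f x]) (rule that)
  have "f x \<in> T" using x fS by auto
  then obtain V i where i: "open V" "f x \<in> V" "\<And>k. Ck_on k V i" "\<And>y. y \<in> T \<Longrightarrow> y \<in> V \<Longrightarrow> i y = g y"
    by (rule smooth_onE[OF g]) (rule that)
  let ?U = "U \<inter> h -` V"
  have oU: "open ?U"
    by (rule continuous_open_preimage[OF Ck_on_imp_continuous_on[OF h(3)[of 0]] h(1) i(1)])
  have "Ck_on k ?U (\<lambda>x. i (h x))" for k
    by (rule Ck_on_compose[OF oU i(1) _ _ i(3)]) (use h in \<open>auto intro: Ck_on_subset\<close>)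
  moreover have "i (h y) = g (f y)" if "y \<in> S \<inter> ?U" for y
    using that h(4)[of y] i(4)[of "f y"] fS by auto
  moreover have "x \<in> ?U" using h(2) h(4)[OF x h(2)] i(2) by simp
  ultimately show "\<exists>U h. open U \<and> x \<in> U \<and> (\<forall>k. Ck_on k U h) \<and> (\<forall>y\<in>S \<inter> U. h y = g (f y))"
    using oU by (intro exI[of _ ?U] exI[of _ "\<lambda>x. i (h x)"]) auto
qed

lemma smooth_on_inverse:
  fixes f :: "'a::euclidean_space \<Rightarrow> real"
  assumes "smooth_on S f" "\<And>x. x \<in> S \<Longrightarrow> f x \<noteq> 0"
  shows "smooth_on S (\<lambda>x. inverse (f x))"
  by (rule smooth_on_compose[OF assms(1) smooth_on_open[OF _ Ck_on_inverse]]) (use assms(2) in auto)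

lemma smooth_on_divide:
  fixes f g :: "'a::euclidean_space \<Rightarrow> real"
  assumes "smooth_on S f" "smooth_on S g" "\<And>x. x \<in> S \<Longrightarrow> g x \<noteq> 0"
  shows "smooth_on S (\<lambda>x. f x / g x)"
  unfolding divide_inverse by (intro smooth_on_mult smooth_on_inverse assms)

lemma smooth_on_sqrt:
  fixes f :: "'a::euclidean_space \<Rightarrow> real"
  assumes "smooth_on S f" "\<And>x. x \<in> S \<Longrightarrow> f x > 0"
  shows "smooth_on S (\<lambda>x. sqrt (f x))"
  by (rule smooth_on_compose[OF assms(1) smooth_on_open[OF _ Ck_on_sqrt]]) (use assms(2) in auto)

lemma smooth_on_ln:
  fixes f :: "'a::euclidean_space \<Rightarrow> real"
  assumes "smooth_on S f" "\<And>x. x \<in> S \<Longrightarrow> f x > 0"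
  shows "smooth_on S (\<lambda>x. ln (f x))"
  by (rule smooth_on_compose[OF assms(1) smooth_on_open[OF _ Ck_on_ln]]) (use assms(2) in auto)

section \<open>Differentiation rules within a regular domain\<close>

context
  fixes S :: "'a::euclidean_space set" and x :: 'a
  assumes S: "regular_domain S" and x: "x \<in> S"
begin

lemma dir_deriv_const: "dir_deriv S v (\<lambda>_. c :: 'b::euclidean_space) x = 0"
  by (rule dir_deriv_eq[OF S x has_derivative_const])

lemma dir_deriv_add:
  "smooth_on S f \<Longrightarrow> smooth_on S g \<Longrightarrow>
    dir_deriv S v (\<lambda>y. f y + g y) x = dir_deriv S v f x + dir_deriv S v g x"
  by (rule dir_deriv_eq[OF S x has_derivative_add]) (rule smooth_on_has_derivative[OF _ x], assumption)+

lemma dir_deriv_diff: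
  "smooth_on S f \<Longrightarrow> smooth_on S g \<Longrightarrow>
    dir_deriv S v (\<lambda>y. f y - g y) x = dir_deriv S v f x - dir_deriv S v g x"
  by (rule dir_deriv_eq[OF S x has_derivative_diff]) (rule smooth_on_has_derivative[OF _ x], assumption)+

lemma dir_deriv_bilinear:
  fixes f :: "'a \<Rightarrow> 'b::euclidean_space" and g :: "'a \<Rightarrow> 'c::euclidean_space"
    and p :: "'b \<Rightarrow> 'c \<Rightarrow> 'd::euclidean_space"
  assumes p: "bounded_bilinear p" and fg: "smooth_on S f" "smooth_on S g"
  shows "dir_deriv S v (\<lambda>y. p (f y) (g y)) x = p (f x) (dir_deriv S v g x) + p (dir_deriv S v f x) (g x)"
  by (rule dir_deriv_eq[OF S x bounded_bilinear.FDERIV[OF p]]) (rule smooth_on_has_derivative[OF _ x], fact)+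

lemmas dir_deriv_mult = dir_deriv_bilinear[OF bounded_bilinear_mult]
lemmas dir_deriv_inner = dir_deriv_bilinear[OF bounded_bilinear_inner]
lemmas dir_deriv_scaleR = dir_deriv_bilinear[OF bounded_bilinear_scaleR]

lemma dir_deriv_compose:
  fixes f :: "'a \<Rightarrow> 'b::euclidean_space" and g :: "'b \<Rightarrow> 'c::euclidean_space"
  assumes f: "smooth_on S f" and g: "smooth_on T g" and fS: "f ` S \<subseteq> T"
  shows "dir_deriv S v (\<lambda>y. g (f y)) x = dir_deriv T (dir_deriv S v f x) g (f x)"
proof (rule dir_deriv_eq[OF S x])
  have "f x \<in> T" using x fS by auto
  then have "(g has_derivative (\<lambda>v. dir_deriv T v g (f x))) (at (f x) within f ` S)"
    using smooth_on_has_derivative[OF g] has_derivative_subset fS by blast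
  from has_derivative_in_compose[OF smooth_on_has_derivative[OF f x] this]
  show "((\<lambda>y. g (f y)) has_derivative (\<lambda>v. dir_deriv T (dir_deriv S v f x) g (f x))) (at x within S)" .
qed

lemma dir_deriv_real:
  fixes f :: "'a \<Rightarrow> real"
  assumes "smooth_on S f" "(h has_real_derivative h') (at (f x))"
  shows "dir_deriv S v (\<lambda>y. h (f y)) x = h' * dir_deriv S v f x"
proof (rule dir_deriv_eq[OF S x])
  show "((\<lambda>y. h (f y)) has_derivative (\<lambda>v. h' * dir_deriv S v f x)) (at x within S)"
    by (rule has_derivative_compose[OF smooth_on_has_derivative[OF assms(1) x]
          assms(2)[unfolded has_field_derivative_def]])
qed

lemma dir_deriv_sum:
  assumes "\<And>i. i \<in> I \<Longrightarrow> smooth_on S (f i)"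
  shows "dir_deriv S v (\<lambda>y. \<Sum>i\<in>I. f i y) x = (\<Sum>i\<in>I. dir_deriv S v (f i) x)"
  by (rule dir_deriv_eq[OF S x has_derivative_sum]) (rule smooth_on_has_derivative[OF assms x])

end

section \<open>Conformal maps of the ball\<close>

locale conformal_map =
  fixes S :: "'a::euclidean_space set" and f :: "'a \<Rightarrow> 'a" and \<sigma> :: "'a \<Rightarrow> real"
  assumes S: "regular_domain S" and smooth_f: "smooth_on S f" and smooth_\<sigma>: "smooth_on S \<sigma>"
    and \<sigma>_pos: "x \<in> S \<Longrightarrow> \<sigma> x > 0"
    and conf: "x \<in> S \<Longrightarrow> dir_deriv S u f x \<bullet> dir_deriv S v f x = \<sigma> x * (u \<bullet> v)"
begin

abbreviation D where "D a \<equiv> dir_deriv S a f"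
abbreviation D2 where "D2 a b \<equiv> dir_deriv S b (D a)"
abbreviation D\<sigma> where "D\<sigma> a \<equiv> dir_deriv S a \<sigma>"

lemma smooth_D: "smooth_on S (D a)" and smooth_D2: "smooth_on S (D2 a b)"
  and smooth_D\<sigma>: "smooth_on S (D\<sigma> a)"
  by (intro smooth_on_dir_deriv S smooth_f smooth_\<sigma>)+

lemma D2_commute: "x \<in> S \<Longrightarrow> D2 a b x = D2 b a x"
  by (rule dir_deriv_commute[OF S smooth_f])

lemma deriv_conf:
  assumes x: "x \<in> S"
  shows "D a x \<bullet> D2 b e x + D2 a e x \<bullet> D b x = D\<sigma> e x * (a \<bullet> b)"
proof -
  have "dir_deriv S e (\<lambda>y. D a y \<bullet> D b y) x = dir_deriv S e (\<lambda>y. \<sigma> y * (a \<bullet> b)) x"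
    by (rule dir_deriv_cong[OF x]) (rule conf)
  then show ?thesis
    by (simp add: dir_deriv_inner[OF S x smooth_D smooth_D] dir_deriv_mult[OF S x smooth_\<sigma> smooth_on_const]
        dir_deriv_const[OF S x])
qed

text \<open>This is the Koszul formula for the metric \<open>\<sigma> |dx|\<^sup>2\<close>: three
  permutations of \<open>deriv_conf\<close> are combined using the symmetry of
  \<open>D2\<close>.\<close>

lemma christoffel:
  assumes x: "x \<in> S"
  shows "2 * (D2 a b x \<bullet> D e x) = D\<sigma> b x * (a \<bullet> e) + D\<sigma> a x * (b \<bullet> e) - D\<sigma> e x * (a \<bullet> b)"
proof -
  have "D a x \<bullet> D2 e b x = D a x \<bullet> D2 b e x" "D b x \<bullet> D2 e a x = D2 a e x \<bullet> D b x"
    "D2 b a x \<bullet> D e x = D2 a b x \<bullet> D e x"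
    using D2_commute[OF x, where a = e and b = b] D2_commute[OF x, where a = e and b = a] D2_commute[OF x, where a = b and b = a]
    by (simp_all only: inner_commute)
  then show ?thesis
    using deriv_conf[OF x, where a = a and b = e and e = b] deriv_conf[OF x, where a = b and b = e and e = a] deriv_conf[OF x, where a = a and b = b and e = e] by linarith
qed

text \<open>Conformality makes the derivative injective, and source and target have equal dimension,
  so the vectors \<open>D e x\<close> exhaust the space. A vector is therefore known once its
  products with them are, and \<open>christoffel\<close> supplies those products for
  \<open>D2\<close>.\<close>

lemma D_span:
  assumes x: "x \<in> S" and eq: "\<And>e. u \<bullet> D e x = w \<bullet> D e x"
  shows "u = w"
proof -
  have lin: "linear (\<lambda>e. D e x)" by (rule linear_dir_deriv[OF smooth_f x])
  have "inj (\<lambda>e. D e x)"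
    unfolding linear_injective_0[OF lin]
  proof (intro allI impI)
    fix e assume "D e x = 0"
    then have "\<sigma> x * (e \<bullet> e) = 0" using conf[OF x, of e e] by simp
    then show "e = 0" using \<sigma>_pos[OF x] by simp
  qed
  then have "surj (\<lambda>e. D e x)" by (rule linear_injective_imp_surjective[OF lin]) simp_all
  then obtain e where "D e x = u - w" by (metis surjD)
  then have "(u - w) \<bullet> (u - w) = 0" using eq[of e] by (simp add: inner_diff_left)
  then show ?thesis by simp
qed

text \<open>By the Gauss equation the image of a plane has nonnegative curvature, because \<open>D2 a c\<close> has no
  normal component and those of \<open>D2 a a\<close> and \<open>D2 c c\<close> agree.\<close>

lemma laplacian_le:
  assumes x: "x \<in> S" and ac: "a \<bullet> a = 1" "c \<bullet> c = 1" "a \<bullet> c = 0"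
  shows "dir_deriv S a (D\<sigma> a) x + dir_deriv S c (D\<sigma> c) x \<le> ((D\<sigma> a x)\<^sup>2 + (D\<sigma> c x)\<^sup>2) / \<sigma> x"
proof -
  let ?T = "\<lambda>a b c. dir_deriv S c (D2 a b)"
  let ?T2 = "(D\<sigma> a x)\<^sup>2 + (D\<sigma> c x)\<^sup>2"
  have pos: "\<sigma> x > 0" by (rule \<sigma>_pos[OF x])
  have first: "D\<sigma> e y = 2 * (D2 u e y \<bullet> D u y)" if "y \<in> S" "u \<bullet> u = 1" for u e y
    using deriv_conf[OF that(1), where a = u and b = u and e = e] that(2) by (simp add: inner_commute)
  \<comment> \<open>Any unit vector \<open>u\<close> recovers \<sigma>. In \<open>key\<close> it is
    taken orthogonal to \<open>e\<close>, so that the third derivatives appearing here are those of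
    \<open>mixed\<close>.\<close>
  have second: "dir_deriv S e (D\<sigma> e) x = 2 * (?T u e e x \<bullet> D u x + D2 u e x \<bullet> D2 u e x)"
    if "u \<bullet> u = 1" for u e
  proof -
    have "dir_deriv S e (D\<sigma> e) x = dir_deriv S e (\<lambda>y. 2 * (D2 u e y \<bullet> D u y)) x"
      by (rule dir_deriv_cong[OF x]) (rule first[OF _ that])
    then show ?thesis
      by (simp add: dir_deriv_inner[OF S x smooth_D2 smooth_D] dir_deriv_const[OF S x]
          dir_deriv_mult[OF S x smooth_on_const smooth_on_inner[OF smooth_D2 smooth_D]])
  qed
  \<comment> \<open>The relation \<open>D a \<bullet> D c = 0\<close>, already differentiated along
    \<open>a\<close>, is differentiated along \<open>c\<close>. The outcome eliminates all third
    derivatives of \<open>f\<close> from the Laplacian of \<sigma>.\<close>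
  have "dir_deriv S c (\<lambda>y. D a y \<bullet> D2 c a y + D2 a a y \<bullet> D c y) x = dir_deriv S c (\<lambda>y. 0) x"
    by (rule dir_deriv_cong[OF x]) (use deriv_conf[where a = a and b = c and e = a] ac(3) in simp)
  then have mixed: "D a x \<bullet> ?T c a c x + D2 a c x \<bullet> D2 c a x + D2 a a x \<bullet> D2 c c x + ?T a a c x \<bullet> D c x = 0"
    by (simp add: dir_deriv_const[OF S x] dir_deriv_inner[OF S x] smooth_D smooth_D2
        dir_deriv_add[OF S x smooth_on_inner smooth_on_inner])
  have T1: "?T c a c x = ?T a c c x"
    by (rule dir_deriv_cong[OF x]) (rule D2_commute)
  have "?T c a a x = ?T a c a x"
    by (rule dir_deriv_cong[OF x]) (rule D2_commute)
  also have "\<dots> = ?T a a c x"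
    by (rule dir_deriv_commute[OF S smooth_D x])
  finally have T2: "?T c a a x = ?T a a c x" .
  have key: "dir_deriv S a (D\<sigma> a) x + dir_deriv S c (D\<sigma> c) x
      = 2 * (D2 a c x \<bullet> D2 a c x) - 2 * (D2 a a x \<bullet> D2 c c x)"
    using second[OF ac(2), of a] second[OF ac(1), of c] mixed T1 T2 D2_commute[OF x, where a = a and b = c]
    by (simp add: inner_commute)
  have "D2 a c x = (1 / (2 * \<sigma> x)) *\<^sub>R (D\<sigma> c x *\<^sub>R D a x + D\<sigma> a x *\<^sub>R D c x)"
    by (rule D_span[OF x])
       (use christoffel[OF x, where a = a and b = c] pos ac in \<open>simp add: inner_add_left conf[OF x] field_simps\<close>)
  then have ac2: "D2 a c x \<bullet> D2 a c x = ?T2 / (4 * \<sigma> x)"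
    using pos ac by (simp add: inner_add_left inner_add_right conf[OF x] inner_commute[of c a] power2_eq_square field_simps)
  \<comment> \<open>In the difference the gradient terms \<open>D\<sigma> e\<close> of the two
    Koszul formulas cancel because \<open>a\<close> and \<open>c\<close> have equal length; only
    components along \<open>D a\<close> and \<open>D c\<close> survive.\<close>
  have "D2 a a x - D2 c c x = (1 / \<sigma> x) *\<^sub>R (D\<sigma> a x *\<^sub>R D a x - D\<sigma> c x *\<^sub>R D c x)"
  proof (rule D_span[OF x])
    fix e
    have "2 * ((D2 a a x - D2 c c x) \<bullet> D e x) = 2 * (D\<sigma> a x * (a \<bullet> e) - D\<sigma> c x * (c \<bullet> e))"
      using christoffel[OF x, where a = a and b = a and e = e] christoffel[OF x, where a = c and b = c and e = e] ac
      by (simp add: inner_diff_left)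
    then show "(D2 a a x - D2 c c x) \<bullet> D e x = (1 / \<sigma> x) *\<^sub>R (D\<sigma> a x *\<^sub>R D a x - D\<sigma> c x *\<^sub>R D c x) \<bullet> D e x"
      using pos by (simp add: inner_diff_left conf[OF x] field_simps)
  qed
  then have diff2: "(D2 a a x - D2 c c x) \<bullet> (D2 a a x - D2 c c x) = ?T2 / \<sigma> x"
    unfolding \<open>D2 a a x - D2 c c x = _\<close>
    using pos ac by (simp add: inner_diff_left inner_diff_right conf[OF x] inner_commute[of c a] power2_eq_square field_simps)
  \<comment> \<open>Polarization; dropping the square of \<open>D2 a a x + D2 c c x\<close>
    afterwards is the only loss in the estimate.\<close>
  have "4 * (D2 a a x \<bullet> D2 c c x) = (D2 a a x + D2 c c x) \<bullet> (D2 a a x + D2 c c x)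
      - (D2 a a x - D2 c c x) \<bullet> (D2 a a x - D2 c c x)"
    by (simp add: inner_add_left inner_add_right inner_diff_left inner_diff_right inner_commute)
  then have "4 * (D2 a a x \<bullet> D2 c c x) \<ge> - (?T2 / \<sigma> x)"
    using diff2 inner_ge_zero[of "D2 a a x + D2 c c x"] by linarith
  then have "2 * (D2 a a x \<bullet> D2 c c x) \<ge> - (?T2 / \<sigma> x / 2)" by simp
  moreover have "2 * (D2 a c x \<bullet> D2 a c x) = ?T2 / \<sigma> x / 2" using ac2 pos by (simp add: field_simps)
  moreover define R where "R = ?T2 / \<sigma> x"
  ultimately show ?thesis using key unfolding R_def[symmetric] by linarith
qed

lemma smooth_ln: "smooth_on S (\<lambda>y. ln (\<sigma> y))"
  by (rule smooth_on_ln[OF smooth_\<sigma> \<sigma>_pos])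

lemma dir_deriv_ln: "x \<in> S \<Longrightarrow> dir_deriv S a (\<lambda>y. ln (\<sigma> y)) x = inverse (\<sigma> x) * D\<sigma> a x"
  by (rule dir_deriv_real[OF S _ smooth_\<sigma>]) (auto intro: DERIV_ln \<sigma>_pos)

text \<open>Differentiating the logarithm twice subtracts
  \<open>(D\<sigma> e / \<sigma>)\<^sup>2\<close> in each direction \<open>e\<close>, which is
  exactly the amount allowed by \<open>laplacian_le\<close> after division by \<sigma>.\<close>

lemma ln_laplacian_nonpos:
  assumes x: "x \<in> S" and ac: "a \<bullet> a = 1" "c \<bullet> c = 1" "a \<bullet> c = 0"
  shows "dir_deriv S a (dir_deriv S a (\<lambda>y. ln (\<sigma> y))) x
       + dir_deriv S c (dir_deriv S c (\<lambda>y. ln (\<sigma> y))) x \<le> 0"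
proof -
  have pos: "\<sigma> x > 0" by (rule \<sigma>_pos[OF x])
  have inv: "smooth_on S (\<lambda>y. inverse (\<sigma> y))"
    using \<sigma>_pos by (intro smooth_on_inverse smooth_\<sigma>) force
  have *: "dir_deriv S e (dir_deriv S e (\<lambda>y. ln (\<sigma> y))) x
      = inverse (\<sigma> x) * dir_deriv S e (D\<sigma> e) x - (inverse (\<sigma> x))\<^sup>2 * (D\<sigma> e x)\<^sup>2" for e
  proof -
    have "dir_deriv S e (dir_deriv S e (\<lambda>y. ln (\<sigma> y))) x = dir_deriv S e (\<lambda>y. inverse (\<sigma> y) * D\<sigma> e y) x"
      by (rule dir_deriv_cong[OF x]) (rule dir_deriv_ln)
    also have "\<dots> = inverse (\<sigma> x) * dir_deriv S e (D\<sigma> e) x + dir_deriv S e (\<lambda>y. inverse (\<sigma> y)) x * D\<sigma> e x"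
      by (rule dir_deriv_mult[OF S x inv smooth_D\<sigma>])
    also have "dir_deriv S e (\<lambda>y. inverse (\<sigma> y)) x = - (inverse (\<sigma> x) ^ Suc (Suc 0)) * D\<sigma> e x"
      by (rule dir_deriv_real[OF S x smooth_\<sigma>]) (use pos DERIV_inverse[of "\<sigma> x"] in simp)
    finally show ?thesis by (simp add: power2_eq_square)
  qed
  have "inverse (\<sigma> x) * (dir_deriv S a (D\<sigma> a) x + dir_deriv S c (D\<sigma> c) x)
      \<le> inverse (\<sigma> x) * (((D\<sigma> a x)\<^sup>2 + (D\<sigma> c x)\<^sup>2) / \<sigma> x)"
    using pos by (intro mult_left_mono laplacian_le[OF x ac]) auto
  then show ?thesis unfolding * by (simp add: field_simps power2_eq_square add_divide_distrib)
qed

end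

text \<open>The number \<open>r\<^sup>2\<close> of the conformality condition, read off from one
  coordinate vector; \<open>undefined\<close> names an arbitrary index, all unit vectors being
  stretched equally. As an inner product of derivatives it is visibly smooth.\<close>

definition conformal_factor :: "(real^'n \<Rightarrow> real^'n) \<Rightarrow> real^'n \<Rightarrow> real" where
  "conformal_factor f x =
     dir_deriv (cball 0 1) (axis undefined 1) f x \<bullet> dir_deriv (cball 0 1) (axis undefined 1) f x"

lemma regular_domain_cball: "regular_domain (cball 0 1 :: 'a::euclidean_space set)"
  by (rule regular_domain_convex) auto

text \<open>Up to sign each function is the derivative of the other, hence the joint induction. It
  makes great circles smooth curves.\<close>

lemma Ck_on_sin_cos: "Ck_on k UNIV (sin :: real \<Rightarrow> real) \<and> Ck_on k UNIV (cos :: real \<Rightarrow> real)"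
proof (induction k)
  case 0
  then show ?case by (auto intro: continuous_intros)
next
  case (Suc k)
  then have m: "Ck_on k UNIV (\<lambda>x::real. (-1) * sin x)"
    by (intro Ck_on_mult Ck_on_const) auto
  show ?case
  proof
    show "Ck_on (Suc k) UNIV (sin :: real \<Rightarrow> real)"
      by (rule Ck_on_real_deriv[where f' = cos]) (use Suc in auto)
    show "Ck_on (Suc k) UNIV (cos :: real \<Rightarrow> real)"
      by (rule Ck_on_real_deriv[OF _ _ m]) (auto intro!: derivative_eq_intros)
  qed
qed

section \<open>Diffeomorphisms of the ball at the unit sphere\<close>

locale conformal_ball_diffeo =
  fixes f :: "real^'n \<Rightarrow> real^'n"
  assumes f: "f \<in> conformal_ball_diffeos"
begin

abbreviation "B \<equiv> cball (0::real^'n) 1"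

lemma f_props:
  "bij_betw f B B" "smooth_on B f" "smooth_on B (inv_into B f)"
  using f by (auto simp: conformal_ball_diffeos_def)

lemma f_conf:
  assumes x: "x \<in> B"
  shows "conformal_factor f x > 0"
    and "dir_deriv B u f x \<bullet> dir_deriv B v f x = conformal_factor f x * (u \<bullet> v)"
proof -
  obtain r where r: "r > 0" "\<And>u v. dir_deriv B u f x \<bullet> dir_deriv B v f x = r\<^sup>2 * (u \<bullet> v)"
  proof -
    have "\<forall>x\<in>B. \<exists>r>0. \<forall>u v. dir_deriv B u f x \<bullet> dir_deriv B v f x = r\<^sup>2 * (u \<bullet> v)"
      using f unfolding conformal_ball_diffeos_def dir_deriv_def by simp
    from bspec[OF this x] that show ?thesis by (elim exE conjE) simp
  qed
  have "conformal_factor f x = r\<^sup>2" unfolding conformal_factor_def r(2) by (simp add: inner_axis_axis)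
  then show "conformal_factor f x > 0"
    "dir_deriv B u f x \<bullet> dir_deriv B v f x = conformal_factor f x * (u \<bullet> v)" using r by auto
qed

sublocale conformal_map B f "conformal_factor f"
proof
  show "smooth_on B (conformal_factor f)"
    unfolding conformal_factor_def
    by (intro smooth_on_inner smooth_on_dir_deriv regular_domain_cball f_props)
qed (rule regular_domain_cball f_props f_conf; assumption?)+

text \<open>By invariance of domain the image is open, so it lies in the interior of the closed
  ball. The map \<open>h\<close> is kept general because the application is to the inverse of
  \<open>f\<close>.\<close>

lemma open_image_ball:
  assumes "bij_betw h B B" "smooth_on B h" shows "h ` ball 0 1 \<subseteq> ball 0 1"
proof -
  have "open (h ` ball 0 1)"
  proof (rule invariance_of_domain)
    show "continuous_on (ball 0 1) h"
      using continuous_on_subset[OF smooth_on_imp_continuous_on[OF assms(2)]] by simp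
    show "inj_on h (ball 0 1)"
      using assms(1) inj_on_subset[of h B "ball 0 1"] by (auto simp: bij_betw_def)
  qed simp
  moreover have "h ` ball 0 1 \<subseteq> B" using assms(1) ball_subset_cball by (auto simp: bij_betw_def)
  ultimately have "h ` ball 0 1 \<subseteq> interior B" by (rule interior_maximal[rotated])
  then show ?thesis by simp
qed

text \<open>Otherwise the inverse would carry an interior point to a point of the sphere.\<close>

lemma sphere_to_sphere:
  assumes "norm x = 1" shows "norm (f x) = 1"
proof (rule ccontr)
  assume "norm (f x) \<noteq> 1"
  have x: "x \<in> B" using assms by simp
  then have "f x \<in> B" using f_props(1) by (auto simp: bij_betw_def)
  then have "f x \<in> ball 0 1" using \<open>norm (f x) \<noteq> 1\<close> by simp
  then have "inv_into B f (f x) \<in> ball 0 1"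
    using open_image_ball[OF bij_betw_inv_into[OF f_props(1)] f_props(3)] by blast
  then show False
    using x f_props(1) assms by (auto simp: bij_betw_def)
qed

text \<open>Along the great circle \<open>c\<close> the image has constant norm 1. Differentiating
  once at every \<open>t\<close>, and a second time at 0, gives the two identities; the radial term
  comes from the acceleration of the circle, which is \<open>- x\<close> at the start.\<close>

lemma great_circle:
  assumes x: "norm x = 1" and v: "norm v = 1" "x \<bullet> v = 0"
  shows "f x \<bullet> D v x = 0" and "D v x \<bullet> D v x + f x \<bullet> D2 v v x = f x \<bullet> D x x"
proof -
  define c where "c t = cos t *\<^sub>R x + sin t *\<^sub>R v" for t :: real
  have U: "regular_domain (UNIV :: real set)" by (rule regular_domain_convex) auto
  note [intro] = smooth_on_open[OF open_UNIV conjunct1[OF Ck_on_sin_cos]]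
    smooth_on_open[OF open_UNIV conjunct2[OF Ck_on_sin_cos]]
  have sc: "smooth_on UNIV c"
    unfolding c_def by (intro smooth_on_add smooth_on_scaleR smooth_on_const) auto
  have "norm (c t) ^ 2 = 1" for t
    using x v unfolding c_def power2_norm_eq_inner
    by (simp add: inner_add_left inner_add_right inner_commute norm_eq_1 flip: power2_eq_square)
  then have nc: "norm (c t) = 1" for t using power2_eq_1_iff[of "norm (c t)"] norm_ge_zero[of "c t"] by fastforce
  then have cB: "c ` UNIV \<subseteq> B" and cB': "c t \<in> B" for t by auto
  have dc: "dir_deriv UNIV 1 c t = - sin t *\<^sub>R x + cos t *\<^sub>R v" for t
  proof -
    have "(c has_derivative (\<lambda>h. h *\<^sub>R (- sin t *\<^sub>R x + cos t *\<^sub>R v))) (at t)"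
      unfolding c_def by (auto simp: algebra_simps intro!: derivative_eq_intros)
    from dir_deriv_eq[OF U UNIV_I this, of 1] show ?thesis by simp
  qed
  have Dc: "D (dir_deriv UNIV 1 c t) (c t) = (- sin t) *\<^sub>R D x (c t) + cos t *\<^sub>R D v (c t)" for t
    unfolding dc linear_add[OF linear_dir_deriv[OF smooth_f cB']] linear_scale[OF linear_dir_deriv[OF smooth_f cB']] ..
  have sf: "smooth_on UNIV (\<lambda>t. f (c t))" by (rule smooth_on_compose[OF sc smooth_f cB])
  have dirf: "dir_deriv UNIV 1 (\<lambda>t. f (c t)) t = (- sin t) *\<^sub>R D x (c t) + cos t *\<^sub>R D v (c t)" for t
    unfolding Dc[symmetric] by (rule dir_deriv_compose[OF U _ sc smooth_f cB]) simp
  have zero: "f (c t) \<bullet> ((- sin t) *\<^sub>R D x (c t) + cos t *\<^sub>R D v (c t)) = 0" for t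
  proof -
    have "dir_deriv UNIV 1 (\<lambda>t. f (c t) \<bullet> f (c t)) t = dir_deriv UNIV 1 (\<lambda>t. 1) t"
      using sphere_to_sphere[OF nc] by (intro dir_deriv_cong) (auto simp: dot_square_norm)
    then show ?thesis
      by (simp add: dir_deriv_const[OF U] dir_deriv_inner[OF U _ sf sf] dirf inner_commute)
  qed
  have c0: "c 0 = x" by (simp add: c_def)
  show "f x \<bullet> D v x = 0" using zero[of 0] by (simp add: c0)
  have sD: "smooth_on UNIV (\<lambda>t. D a (c t))" for a by (rule smooth_on_compose[OF sc smooth_D cB])
  have dirD: "dir_deriv UNIV 1 (\<lambda>t. D a (c t)) 0 = D2 a v x" for a
    using dir_deriv_compose[OF U _ sc smooth_D cB, of 0 1 a] dc[of 0] c0 by simp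
  have ssin: "smooth_on UNIV (\<lambda>t::real. - sin t)" by (intro smooth_on_minus) auto
  have scos: "smooth_on UNIV (\<lambda>t::real. cos t)" by auto
  have dsin: "dir_deriv UNIV 1 (\<lambda>t::real. - sin t) 0 = -1"
  proof -
    have "((\<lambda>t::real. - sin t) has_derivative (\<lambda>h. - h)) (at 0)" by (auto intro!: derivative_eq_intros)
    from dir_deriv_eq[OF U UNIV_I this] show ?thesis .
  qed
  have dcos: "dir_deriv UNIV 1 (\<lambda>t::real. cos t) 0 = 0"
  proof -
    have "((\<lambda>t::real. cos t) has_derivative (\<lambda>h. 0)) (at 0)" by (auto intro!: derivative_eq_intros)
    from dir_deriv_eq[OF U UNIV_I this] show ?thesis .
  qed
  have "dir_deriv UNIV 1 (\<lambda>t. f (c t) \<bullet> ((- sin t) *\<^sub>R D x (c t) + cos t *\<^sub>R D v (c t))) 0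
      = dir_deriv UNIV 1 (\<lambda>t. 0) (0::real)"
    by (intro dir_deriv_cong zero) auto
  then have "f x \<bullet> dir_deriv UNIV 1 (\<lambda>t. (- sin t) *\<^sub>R D x (c t) + cos t *\<^sub>R D v (c t)) 0 + D v x \<bullet> D v x = 0"
    by (simp only: dir_deriv_inner[OF U UNIV_I sf smooth_on_add[OF smooth_on_scaleR[OF ssin sD] smooth_on_scaleR[OF scos sD]]]
       dir_deriv_const[OF U UNIV_I] dirf) (simp add: c0)
  moreover have "dir_deriv UNIV 1 (\<lambda>t. (- sin t) *\<^sub>R D x (c t) + cos t *\<^sub>R D v (c t)) 0 = - D x x + D2 v v x"
    unfolding dir_deriv_add[OF U UNIV_I smooth_on_scaleR[OF ssin sD] smooth_on_scaleR[OF scos sD]]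
      dir_deriv_scaleR[OF U UNIV_I ssin sD] dir_deriv_scaleR[OF U UNIV_I scos sD] dsin dcos dirD
    by (simp add: c0)
  ultimately show "D v x \<bullet> D v x + f x \<bullet> D2 v v x = f x \<bullet> D x x"
    by (simp add: inner_add_right inner_diff_right)
qed

text \<open>On the radius the squared norm of the image reaches its maximum 1 at the end, so it
  cannot decrease there. This fixes the sign of the square root in
  \<open>dir_deriv_ln_sphere\<close>.\<close>

lemma radial_deriv_nonneg:
  assumes x: "norm x = 1" shows "f x \<bullet> D x x \<ge> 0"
proof (rule ccontr)
  assume neg: "\<not> f x \<bullet> D x x \<ge> 0"
  define q where "q t = f (t *\<^sub>R x) \<bullet> f (t *\<^sub>R x)" for t :: real
  have I: "regular_domain {0..1::real}" by (rule regular_domain_convex) auto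
  have sm: "smooth_on {0..1} (\<lambda>t. t *\<^sub>R x)" by (intro smooth_on_scaleR smooth_on_id smooth_on_const)
  have im: "(\<lambda>t. t *\<^sub>R x) ` {0..1} \<subseteq> B" using x by auto
  have sf: "smooth_on {0..1} (\<lambda>t. f (t *\<^sub>R x))" by (rule smooth_on_compose[OF sm smooth_f im])
  have one: "(1::real) \<in> {0..1}" by simp
  have d: "dir_deriv {0..1} h (\<lambda>t. t *\<^sub>R x) 1 = h *\<^sub>R x" for h
    by (rule dir_deriv_eq[OF I one]) (auto intro!: derivative_eq_intros)
  have "dir_deriv {0..1} h q 1 = (2 * (f x \<bullet> D x x)) * h" for h
    unfolding q_def dir_deriv_inner[OF I one sf sf] dir_deriv_compose[OF I one sm smooth_f im] d
    using linear_scale[OF linear_dir_deriv[OF smooth_f], of x h x] x by (simp add: inner_commute)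
  moreover have "smooth_on {0..1} q" unfolding q_def by (intro smooth_on_inner sf)
  ultimately have "(q has_real_derivative 2 * (f x \<bullet> D x x)) (at 1 within {0..1})"
    using smooth_on_has_derivative[of "{0..1}" q 1] unfolding has_field_derivative_def by simp
  from has_real_derivative_neg_dec_left[OF this] neg
  have "\<exists>d>0. \<forall>h>0. 1 - h \<in> {0..1} \<longrightarrow> h < d \<longrightarrow> q 1 < q (1 - h)" by simp
  then obtain d where d: "d > 0" "\<forall>h>0. 1 - h \<in> {0..1} \<longrightarrow> h < d \<longrightarrow> q 1 < q (1 - h)"
    by (elim exE conjE)
  define h where "h = min (d/2) 1"
  have h: "0 < h" "h < d" "1 - h \<in> {0..1}" using d(1) by (auto simp: h_def min_def field_simps)
  then have "q 1 < q (1 - h)" using d(2) by blast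
  moreover have "q 1 = 1" using sphere_to_sphere[OF x] by (simp add: q_def dot_square_norm)
  moreover have "(1 - h) *\<^sub>R x \<in> B" using im h(3) by blast
  then have "f ((1 - h) *\<^sub>R x) \<in> B" using f_props(1) by (auto simp: bij_betw_def)
  then have "q (1 - h) \<le> 1" by (simp add: q_def dot_square_norm power_le_one)
  ultimately show False by simp
qed

text \<open>The image of the normal \<open>x\<close> is parallel to \<open>f x\<close> and has
  length \<open>sqrt \<sigma>\<close>. The Koszul formula expresses the normal part of
  \<open>D2 v v\<close> through the radial derivative of \<sigma>, and the second identity of
  \<open>great_circle\<close> evaluates it. The vector \<open>v\<close> only carries the great
  circle; it requires dimension at least two and later is the unit tangent of the boundary
  curve.\<close>

lemma dir_deriv_ln_sphere:
  assumes x: "norm x = 1" and v: "norm v = 1" "x \<bullet> v = 0"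
  shows "dir_deriv B x (\<lambda>y. ln (conformal_factor f y)) x = 2 * (sqrt (conformal_factor f x) - 1)"
proof -
  let ?s = "conformal_factor f x" and ?m = "f x \<bullet> D x x"
  have xB: "x \<in> B" using x by simp
  have pos: "?s > 0" by (rule \<sigma>_pos[OF xB])
  have xx: "x \<bullet> x = 1" using x by (simp add: norm_eq_1)
  have tang: "f x \<bullet> D w x = 0" if w: "x \<bullet> w = 0" for w
  proof (cases "w = 0")
    case True
    then show ?thesis using linear_0[OF linear_dir_deriv[OF smooth_f xB]] by simp
  next
    case False
    have "D w x = norm w *\<^sub>R D ((1 / norm w) *\<^sub>R w) x"
      unfolding linear_scale[OF linear_dir_deriv[OF smooth_f xB]] using False by simp
    moreover have "f x \<bullet> D ((1 / norm w) *\<^sub>R w) x = 0"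
      by (rule great_circle(1)[OF x]) (use False w in auto)
    ultimately show ?thesis by simp
  qed
  have fx: "f x = (?m / ?s) *\<^sub>R D x x"
  proof (rule D_span[OF xB])
    fix e
    have "D e x = (x \<bullet> e) *\<^sub>R D x x + D (e - (x \<bullet> e) *\<^sub>R x) x"
      unfolding linear_diff[OF linear_dir_deriv[OF smooth_f xB]] linear_scale[OF linear_dir_deriv[OF smooth_f xB]] by simp
    moreover have "f x \<bullet> D (e - (x \<bullet> e) *\<^sub>R x) x = 0" by (rule tang) (simp add: inner_diff_right xx)
    ultimately have "f x \<bullet> D e x = (x \<bullet> e) * ?m" by (simp add: inner_add_right)
    then show "f x \<bullet> D e x = (?m / ?s) *\<^sub>R D x x \<bullet> D e x" using pos by (simp add: conf[OF xB])
  qed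
  have "1 = f x \<bullet> f x" using sphere_to_sphere[OF x] by (simp add: dot_square_norm)
  also have "\<dots> = (?m / ?s) * ?m" by (subst (1) fx) (simp add: inner_commute)
  finally have "?m\<^sup>2 = ?s" using pos by (simp add: field_simps power2_eq_square)
  \<comment> \<open>Of the two roots of \<open>?m\<^sup>2 = ?s\<close>, the nonnegative radial
    derivative selects this one.\<close>
  then have m: "?m = sqrt ?s" using radial_deriv_nonneg[OF x] by (metis real_sqrt_unique)
  have "2 * (D2 v v x \<bullet> D x x) = - D\<sigma> x x"
    using christoffel[OF xB, where a = v and b = v and e = x] v by (simp add: inner_commute dot_square_norm)
  then have "2 * (f x \<bullet> D2 v v x) = (?m / ?s) * (- D\<sigma> x x)"
  proof -
    have "f x \<bullet> D2 v v x = (?m / ?s) * (D2 v v x \<bullet> D x x)"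
      by (subst fx) (simp add: inner_commute)
    then have "2 * (f x \<bullet> D2 v v x) = (?m / ?s) * (2 * (D2 v v x \<bullet> D x x))" by simp
    then show ?thesis unfolding \<open>2 * (D2 v v x \<bullet> D x x) = _\<close> .
  qed
  moreover have "?s + f x \<bullet> D2 v v x = ?m"
    using great_circle(2)[OF assms] conf[OF xB, of v v] v by (simp add: dot_square_norm)
  ultimately have "2 * (?m - ?s) = - ((?m / ?s) * D\<sigma> x x)" by simp
  moreover have s2: "?s = ?m * ?m" using \<open>?m\<^sup>2 = ?s\<close> by (simp add: power2_eq_square)
  moreover have mpos: "?m > 0" using m pos by simp
  ultimately have "2 * (?m - ?s) * ?m = - D\<sigma> x x" by (simp add: field_simps)
  then have "D\<sigma> x x = ?s * (2 * (?m - 1))" using s2 by (simp add: algebra_simps)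
  then show ?thesis unfolding dir_deriv_ln[OF xB] m[symmetric] using pos by simp
qed

end

lemma id_conformal_ball_diffeo: "id \<in> (conformal_ball_diffeos :: (real^'n \<Rightarrow> real^'n) set)"
proof -
  let ?B = "cball 0 1 :: (real^'n) set"
  have sid: "smooth_on ?B id" using smooth_on_id[of ?B] by (simp add: id_def)
  have "smooth_on ?B (inv_into ?B id)" by (rule smooth_on_cong[OF sid]) (simp add: inv_into_f_f[of id, simplified])
  moreover have "frechet_derivative id (at x within ?B) u = u" if "x \<in> ?B" for x u
    using dir_deriv_eq[OF regular_domain_cball that has_derivative_ident, of u]
    by (simp add: dir_deriv_def id_def)
  ultimately show ?thesis
    unfolding conformal_ball_diffeos_def using sid by (auto intro!: exI[of _ 1])
qed

section \<open>Immersed surface patches\<close>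

lemma dir_deriv_expand_basis:
  fixes Y :: "'b::euclidean_space"
  assumes "smooth_on T L" "y \<in> T"
  shows "dir_deriv T Y L y = (\<Sum>b\<in>Basis. (Y \<bullet> b) *\<^sub>R dir_deriv T b L y)"
proof -
  note lin = linear_dir_deriv[OF assms]
  have "dir_deriv T Y L y = dir_deriv T (\<Sum>b\<in>Basis. (Y \<bullet> b) *\<^sub>R b) L y"
    by (simp add: euclidean_representation)
  then show ?thesis by (simp add: linear_sum[OF lin] linear_scale[OF lin])
qed

context
  fixes S :: "'a::euclidean_space set" and T :: "'b::euclidean_space set"
    and \<Phi> Y :: "'a \<Rightarrow> 'b" and L :: "'b \<Rightarrow> real"
  assumes S: "regular_domain S" and T: "regular_domain T" and \<Phi>: "smooth_on S \<Phi>" and \<Phi>T: "\<Phi> ` S \<subseteq> T"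
    and Y: "smooth_on S Y" and L: "smooth_on T L"
begin

text \<open>A product rule: the derivative of dL(Y) along \<open>\<Phi>\<close> is dL applied to the
  derivative of \<open>Y\<close>, plus the Hessian of \<open>L\<close> on the velocity of
  \<open>\<Phi>\<close> and \<open>Y\<close>. As the direction \<open>Y z\<close> varies, dL(Y) is
  first expanded in fixed basis directions.\<close>

lemma dir_deriv_along:
  assumes z: "z \<in> S"
  shows "dir_deriv S e (\<lambda>z. dir_deriv T (Y z) L (\<Phi> z)) z =
    dir_deriv T (dir_deriv S e Y z) L (\<Phi> z) + dir_deriv T (dir_deriv S e \<Phi> z) (dir_deriv T (Y z) L) (\<Phi> z)"
proof -
  let ?d = "\<lambda>b. dir_deriv T b L"
  have \<Phi>z: "\<Phi> z \<in> T" using z \<Phi>T by auto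
  have sm: "smooth_on S (\<lambda>z. ?d b (\<Phi> z))" for b
    by (rule smooth_on_compose[OF \<Phi> smooth_on_dir_deriv[OF T L] \<Phi>T])
  have sY: "smooth_on S (\<lambda>z. Y z \<bullet> b)" for b by (rule smooth_on_inner[OF Y smooth_on_const])
  have "dir_deriv S e (\<lambda>z. dir_deriv T (Y z) L (\<Phi> z)) z
      = dir_deriv S e (\<lambda>z. \<Sum>b\<in>Basis. (Y z \<bullet> b) *\<^sub>R ?d b (\<Phi> z)) z"
    by (rule dir_deriv_cong[OF z], rule dir_deriv_expand_basis[OF L]) (use \<Phi>T in blast)
  also have "\<dots> = (\<Sum>b\<in>Basis. (Y z \<bullet> b) *\<^sub>R dir_deriv T (dir_deriv S e \<Phi> z) (?d b) (\<Phi> z)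
       + (dir_deriv S e Y z \<bullet> b) *\<^sub>R ?d b (\<Phi> z))"
    by (simp only: dir_deriv_sum[OF S z smooth_on_scaleR[OF sY sm]] dir_deriv_scaleR[OF S z sY sm]
        dir_deriv_inner[OF S z Y smooth_on_const] dir_deriv_const[OF S z] inner_zero_right add_0_left
        dir_deriv_compose[OF S z \<Phi> smooth_on_dir_deriv[OF T L] \<Phi>T])
  also have "(\<Sum>b\<in>Basis. (Y z \<bullet> b) *\<^sub>R dir_deriv T (dir_deriv S e \<Phi> z) (?d b) (\<Phi> z)
       + (dir_deriv S e Y z \<bullet> b) *\<^sub>R ?d b (\<Phi> z))
      = dir_deriv T (dir_deriv S e Y z) L (\<Phi> z)
      + (\<Sum>b\<in>Basis. (Y z \<bullet> b) *\<^sub>R dir_deriv T (dir_deriv S e \<Phi> z) (?d b) (\<Phi> z))"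
    by (simp only: sum.distrib dir_deriv_expand_basis[OF L \<Phi>z, of "dir_deriv S e Y z"] add.commute)
  \<comment> \<open>The coefficients are frozen at the point \<open>z\<close>, which makes the sum a
    derivative of \<open>L\<close> in one fixed direction.\<close>
  also have "(\<Sum>b\<in>Basis. (Y z \<bullet> b) *\<^sub>R dir_deriv T (dir_deriv S e \<Phi> z) (?d b) (\<Phi> z))
      = dir_deriv T (dir_deriv S e \<Phi> z) (\<lambda>y. \<Sum>b\<in>Basis. (Y z \<bullet> b) *\<^sub>R ?d b y) (\<Phi> z)"
    by (simp only: dir_deriv_sum[OF T \<Phi>z smooth_on_scaleR[OF smooth_on_const smooth_on_dir_deriv[OF T L]]]
        dir_deriv_scaleR[OF T \<Phi>z smooth_on_const smooth_on_dir_deriv[OF T L]] dir_deriv_const[OF T \<Phi>z]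
        scaleR_zero_left add_0_right)
  also have "\<dots> = dir_deriv T (dir_deriv S e \<Phi> z) (dir_deriv T (Y z) L) (\<Phi> z)"
    by (rule dir_deriv_cong[OF \<Phi>z]) (rule dir_deriv_expand_basis[OF L, symmetric])
  finally show ?thesis .
qed

end

text \<open>Symmetry moves \<open>w\<close> to the outer derivative, where linearity is that of a
  single derivative.\<close>

lemma linear_dir_deriv_dir_deriv:
  assumes "regular_domain T" "smooth_on T L" "y \<in> T"
  shows "linear (\<lambda>w. dir_deriv T u (dir_deriv T w L) y)"
  unfolding dir_deriv_commute[OF assms(1,2,3), of u]
  by (rule linear_dir_deriv[OF smooth_on_dir_deriv[OF assms(1,2)] assms(3)])

text \<open>The expression in the conclusion is \<open>E * G - F\<^sup>2\<close> times the trace of \<open>H\<close> over the plane spanned by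
  \<open>p1\<close> and \<open>p2\<close>.\<close>

lemma plane_trace_nonpos:
  fixes H :: "'b::euclidean_space \<Rightarrow> 'b \<Rightarrow> real" and p1 p2 :: 'b
  defines "E \<equiv> p1 \<bullet> p1" and "F \<equiv> p1 \<bullet> p2" and "G \<equiv> p2 \<bullet> p2"
  assumes lin: "\<And>u. linear (\<lambda>w. H u w)" and sym: "\<And>u w. H u w = H w u"
    and pos: "E * G - F\<^sup>2 > 0"
    and tr: "\<And>a c. a \<bullet> a = 1 \<Longrightarrow> c \<bullet> c = 1 \<Longrightarrow> a \<bullet> c = 0 \<Longrightarrow> H a a + H c c \<le> 0"
  shows "G * H p1 p1 - 2 * F * H p1 p2 + E * H p2 p2 \<le> 0"
proof -
  let ?w = "E * G - F\<^sup>2"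
  have "E \<noteq> 0"
  proof
    assume "E = 0"
    then have "p1 = 0" by (simp add: E_def)
    then show False using pos by (simp add: E_def F_def)
  qed
  then have E: "E > 0" using inner_ge_zero[of p1] by (auto simp: E_def less_le)
  \<comment> \<open>The Gram-Schmidt vector multiplied by \<open>E\<close>, so that no division
    enters before the normalization.\<close>
  define q where "q = E *\<^sub>R p2 - F *\<^sub>R p1"
  have q: "q \<bullet> q = E * ?w" "p1 \<bullet> q = 0"
    by (simp_all add: q_def E_def F_def G_def inner_diff_left inner_diff_right inner_commute power2_eq_square algebra_simps)
  define a c where "a = (1 / sqrt E) *\<^sub>R p1" and "c = (1 / sqrt (E * ?w)) *\<^sub>R q"
  have Ew: "E * ?w > 0" using E pos by simp
  have HS: "H (r *\<^sub>R u) (r *\<^sub>R u) = r\<^sup>2 * H u u" for r u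
    using linear_scale[OF lin, of "r *\<^sub>R u" r u] linear_scale[OF lin, of u r u] sym[of "r *\<^sub>R u" u]
    by (simp add: power2_eq_square)
  have "H a a + H c c \<le> 0"
    by (rule tr) (use E Ew q pos in \<open>simp_all add: a_def c_def flip: E_def\<close>)
  then have "(1 / sqrt E)\<^sup>2 * H p1 p1 + (1 / sqrt (E * ?w))\<^sup>2 * H q q \<le> 0" by (simp add: a_def c_def HS)
  then have "H p1 p1 / E + H q q / (E * ?w) \<le> 0" using E Ew by (simp add: power_divide)
  then have "(H p1 p1 / E + H q q / (E * ?w)) * (E * ?w) \<le> 0" using Ew by (intro mult_nonpos_nonneg) auto
  moreover have "(x / E + y / (E * w)) * (E * w) = w * x + y" if "w > 0" for x y w :: real
    using that E by (simp add: field_simps)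
  ultimately have *: "?w * H p1 p1 + H q q \<le> 0" using pos by metis
  have "H q q = E * H q p2 - F * H q p1"
    using linear_diff[OF lin, of q "E *\<^sub>R p2" "F *\<^sub>R p1"] linear_scale[OF lin, of q] by (simp add: q_def)
  also have "\<dots> = E * H p2 q - F * H p1 q" by (simp add: sym)
  also have "\<dots> = E * (E * H p2 p2 - F * H p2 p1) - F * (E * H p1 p2 - F * H p1 p1)"
    by (simp add: q_def linear_diff[OF lin] linear_scale[OF lin])
  also have "\<dots> = E * (E * H p2 p2 - 2 * F * H p1 p2) + F\<^sup>2 * H p1 p1"
    by (simp add: sym[of p2 p1] algebra_simps power2_eq_square)
  finally have "E * (G * H p1 p1 - 2 * F * H p1 p2 + E * H p2 p2) \<le> 0"
    using * by (simp add: algebra_simps)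
  then show ?thesis using E by (simp add: mult_le_0_iff)
qed

section \<open>Coordinate frame, area density and fluxes of an immersed patch\<close>

abbreviation "e1 \<equiv> axis 1 1 :: real^2"
abbreviation "e2 \<equiv> axis 2 1 :: real^2"

locale immersed_patch =
  fixes S :: "(real^2) set" and \<Phi> :: "real^2 \<Rightarrow> 'b::euclidean_space"
  assumes S: "regular_domain S" and \<Phi>: "smooth_on S \<Phi>"
    and det_pos: "z \<in> S \<Longrightarrow> (dir_deriv S e1 \<Phi> z \<bullet> dir_deriv S e1 \<Phi> z) * (dir_deriv S e2 \<Phi> z \<bullet> dir_deriv S e2 \<Phi> z)
        - (dir_deriv S e1 \<Phi> z \<bullet> dir_deriv S e2 \<Phi> z)\<^sup>2 > 0"
begin

abbreviation "p1 \<equiv> dir_deriv S e1 \<Phi>"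
abbreviation "p2 \<equiv> dir_deriv S e2 \<Phi>"
definition "E z = p1 z \<bullet> p1 z"
definition "F z = p1 z \<bullet> p2 z"
definition "G z = p2 z \<bullet> p2 z"
definition "W z = sqrt (E z * G z - (F z)\<^sup>2)"
text \<open>Here \<open>W\<close> is the area density. In index notation these fields are W times
  the sum over j of g^{ij} times the j-th coordinate vector, that is, \<open>W\<close> times the
  dual frame of \<open>p1\<close>, \<open>p2\<close> in the tangent plane; \<open>Y_dot\<close>
  records the duality.\<close>

definition "Y1 z = (G z / W z) *\<^sub>R p1 z - (F z / W z) *\<^sub>R p2 z"
definition "Y2 z = (E z / W z) *\<^sub>R p2 z - (F z / W z) *\<^sub>R p1 z"

lemma smooth_p: "smooth_on S p1" "smooth_on S p2"
  by (intro smooth_on_dir_deriv S \<Phi>)+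

lemma smooth_EFG: "smooth_on S E" "smooth_on S F" "smooth_on S G"
  unfolding E_def F_def G_def by (intro smooth_on_inner smooth_p)+

lemma W_pos: "z \<in> S \<Longrightarrow> E z * G z - (F z)\<^sup>2 > 0" "z \<in> S \<Longrightarrow> W z > 0"
  using det_pos[of z] by (simp_all add: W_def E_def F_def G_def)

lemma W_square: "z \<in> S \<Longrightarrow> W z * W z = E z * G z - F z * F z"
  using W_pos(1)[of z] by (simp add: W_def power2_eq_square)

lemma E_pos: assumes "z \<in> S" shows "E z > 0"
proof -
  have "E z \<noteq> 0"
  proof
    assume "E z = 0"
    then have "p1 z = 0" by (simp add: E_def)
    then show False using W_pos(1)[OF assms] by (simp add: E_def F_def)
  qed
  then show ?thesis using inner_ge_zero[of "p1 z"] by (auto simp: E_def less_le)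
qed

lemma smooth_W: "smooth_on S W"
  unfolding W_def power2_eq_square
  using W_pos(1)[unfolded power2_eq_square] by (intro smooth_on_sqrt smooth_on_diff smooth_on_mult smooth_EFG)

lemma smooth_quotients:
  "smooth_on S (\<lambda>z. E z / W z)" "smooth_on S (\<lambda>z. F z / W z)" "smooth_on S (\<lambda>z. G z / W z)"
proof -
  have "W z \<noteq> 0" if "z \<in> S" for z using W_pos(2)[OF that] by simp
  then show "smooth_on S (\<lambda>z. E z / W z)" "smooth_on S (\<lambda>z. F z / W z)" "smooth_on S (\<lambda>z. G z / W z)"
    by (intro smooth_on_divide smooth_EFG smooth_W; assumption)+
qed

lemma smooth_Y: "smooth_on S Y1" "smooth_on S Y2"
  unfolding Y1_def Y2_def by (intro smooth_on_diff smooth_on_scaleR smooth_quotients smooth_p)+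

lemma Y_dot:
  assumes "z \<in> S"
  shows "Y1 z \<bullet> p1 z = W z" "Y1 z \<bullet> p2 z = 0" "Y2 z \<bullet> p1 z = 0" "Y2 z \<bullet> p2 z = W z"
  using W_pos(2)[OF assms] W_square[OF assms]
  by (simp_all add: Y1_def Y2_def inner_diff_left inner_commute[of "p2 z" "p1 z"] field_simps
      flip: E_def F_def G_def)

lemma dir_deriv_W:
  assumes z: "z \<in> S"
  shows "2 * W z * dir_deriv S e W z = dir_deriv S e E z * G z + E z * dir_deriv S e G z - 2 * F z * dir_deriv S e F z"
proof -
  have "dir_deriv S e (\<lambda>z. W z * W z) z = dir_deriv S e (\<lambda>z. E z * G z - F z * F z) z"
    by (rule dir_deriv_cong[OF z W_square])
  then show ?thesis
    by (simp add: dir_deriv_mult[OF S z] dir_deriv_diff[OF S z] smooth_on_mult smooth_EFG smooth_W algebra_simps)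
qed

lemma dir_deriv_EFG:
  assumes z: "z \<in> S"
  shows "dir_deriv S e E z = 2 * (dir_deriv S e p1 z \<bullet> p1 z)"
    "dir_deriv S e F z = dir_deriv S e p1 z \<bullet> p2 z + dir_deriv S e p2 z \<bullet> p1 z"
    "dir_deriv S e G z = 2 * (dir_deriv S e p2 z \<bullet> p2 z)"
  unfolding E_def F_def G_def
  by (simp_all add: dir_deriv_inner[OF S z smooth_p(1) smooth_p(1)] dir_deriv_inner[OF S z smooth_p(1) smooth_p(2)]
      dir_deriv_inner[OF S z smooth_p(2) smooth_p(2)] inner_commute)

definition "divY z = dir_deriv S e1 Y1 z + dir_deriv S e2 Y2 z"

text \<open>\<open>divY\<close> is \<open>W\<close> times the Laplacian of \<open>\<Phi>\<close>, which is always normal to the surface.\<close>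

lemma divY_normal:
  assumes z: "z \<in> S"
  shows "divY z \<bullet> p1 z = 0" "divY z \<bullet> p2 z = 0"
proof -
  have W: "W z > 0" by (rule W_pos(2)[OF z])
  have comm: "dir_deriv S e2 p1 z = dir_deriv S e1 p2 z" by (rule dir_deriv_commute[OF S \<Phi> z])
  \<comment> \<open>Moving the derivative from \<open>Y\<close> onto \<open>p\<close> leaves only
    derivatives of \<open>W\<close> and second derivatives of \<open>\<Phi>\<close>, so the
    quotients inside \<open>Y1\<close> and \<open>Y2\<close> need not be differentiated.\<close>
  have prod: "dir_deriv S e Y z \<bullet> p z = dir_deriv S e (\<lambda>z. Y z \<bullet> p z) z - Y z \<bullet> dir_deriv S e p z"
    if "smooth_on S Y" "smooth_on S p" for e and Y p :: "real^2 \<Rightarrow> 'b"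
    using dir_deriv_inner[OF S z that] by simp
  have d: "dir_deriv S e (\<lambda>z. Y1 z \<bullet> p1 z) z = dir_deriv S e W z"
    "dir_deriv S e (\<lambda>z. Y2 z \<bullet> p2 z) z = dir_deriv S e W z"
    "dir_deriv S e (\<lambda>z. Y1 z \<bullet> p2 z) z = 0" "dir_deriv S e (\<lambda>z. Y2 z \<bullet> p1 z) z = 0" for e
    using dir_deriv_cong[OF z Y_dot(1), where v = e] dir_deriv_cong[OF z Y_dot(4), where v = e]
      dir_deriv_cong[OF z Y_dot(2), where v = e] dir_deriv_cong[OF z Y_dot(3), where v = e] dir_deriv_const[OF S z] by simp_all
  have WY: "W z * (Y1 z \<bullet> q) = G z * (q \<bullet> p1 z) - F z * (q \<bullet> p2 z)"
    "W z * (Y2 z \<bullet> q) = E z * (q \<bullet> p2 z) - F z * (q \<bullet> p1 z)" for q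
    using W by (simp_all add: Y1_def Y2_def inner_diff_left inner_commute[of q] right_diff_distrib)
  have dist: "2 * w * (a - x + (b - y)) = 2 * w * (a + b) - 2 * (w * x) - 2 * (w * y)" for w a b x y :: real
    by (simp add: algebra_simps)
  have "2 * W z * (divY z \<bullet> p1 z) = 0"
    using dir_deriv_W[OF z, of e1] W
    unfolding divY_def inner_add_left prod[OF smooth_Y(1) smooth_p(1)] prod[OF smooth_Y(2) smooth_p(1)] d
      dir_deriv_EFG[OF z] comm dist WY
    by (simp add: inner_commute algebra_simps)
  then show "divY z \<bullet> p1 z = 0" using W by simp
  have "2 * W z * (divY z \<bullet> p2 z) = 0"
    using dir_deriv_W[OF z, of e2] W
    unfolding divY_def inner_add_left prod[OF smooth_Y(1) smooth_p(2)] prod[OF smooth_Y(2) smooth_p(2)] d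
      dir_deriv_EFG[OF z] comm dist WY
    by (simp add: inner_commute algebra_simps)
  then show "divY z \<bullet> p2 z = 0" using W by simp
qed

text \<open>The combination in \<open>min\<close> is \<open>(W z)\<^sup>2\<close> times the trace of
  the second derivatives of \<open>\<Phi>\<close> in the induced metric. If it is tangential, so is
  \<open>divY\<close>, since the product rule adds only multiples of \<open>p1\<close> and
  \<open>p2\<close>; being normal as well, \<open>divY\<close> vanishes.\<close>

lemma divY_zero:
  assumes z: "z \<in> S"
    and min: "G z *\<^sub>R dir_deriv S e1 p1 z - (2 * F z) *\<^sub>R dir_deriv S e1 p2 z + E z *\<^sub>R dir_deriv S e2 p2 z
        = a *\<^sub>R p1 z + b *\<^sub>R p2 z"
  shows "divY z = 0"
proof -
  have W: "W z > 0" by (rule W_pos(2)[OF z])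
  have comm: "dir_deriv S e2 p1 z = dir_deriv S e1 p2 z" by (rule dir_deriv_commute[OF S \<Phi> z])
  have two: "(2 * F z / W z) *\<^sub>R x = (F z / W z) *\<^sub>R x + (F z / W z) *\<^sub>R x" for x :: 'b
    by (simp flip: scaleR_add_left)
  have "divY z = (1 / W z) *\<^sub>R (G z *\<^sub>R dir_deriv S e1 p1 z - (2 * F z) *\<^sub>R dir_deriv S e1 p2 z + E z *\<^sub>R dir_deriv S e2 p2 z)
     + (dir_deriv S e1 (\<lambda>z. G z / W z) z - dir_deriv S e2 (\<lambda>z. F z / W z) z) *\<^sub>R p1 z
     + (dir_deriv S e2 (\<lambda>z. E z / W z) z - dir_deriv S e1 (\<lambda>z. F z / W z) z) *\<^sub>R p2 z"
    unfolding divY_def Y1_def Y2_def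
      dir_deriv_diff[OF S z smooth_on_scaleR[OF smooth_quotients(3) smooth_p(1)] smooth_on_scaleR[OF smooth_quotients(2) smooth_p(2)]]
      dir_deriv_diff[OF S z smooth_on_scaleR[OF smooth_quotients(1) smooth_p(2)] smooth_on_scaleR[OF smooth_quotients(2) smooth_p(1)]]
      dir_deriv_scaleR[OF S z smooth_quotients(3) smooth_p(1)] dir_deriv_scaleR[OF S z smooth_quotients(2) smooth_p(2)]
      dir_deriv_scaleR[OF S z smooth_quotients(1) smooth_p(2)] dir_deriv_scaleR[OF S z smooth_quotients(2) smooth_p(1)] comm
    by (simp add: algebra_simps two)
  then have "\<exists>r s. divY z = r *\<^sub>R p1 z + s *\<^sub>R p2 z"
    unfolding min
    by (intro exI[of _ "a / W z + (dir_deriv S e1 (\<lambda>z. G z / W z) z - dir_deriv S e2 (\<lambda>z. F z / W z) z)"]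
        exI[of _ "b / W z + (dir_deriv S e2 (\<lambda>z. E z / W z) z - dir_deriv S e1 (\<lambda>z. F z / W z) z)"])
       (simp add: algebra_simps)
  then obtain r s where rs: "divY z = r *\<^sub>R p1 z + s *\<^sub>R p2 z" by (elim exE)
  have "divY z \<bullet> divY z = 0"
    by (subst (2) rs) (simp add: inner_add_right divY_normal[OF z])
  then show ?thesis by simp
qed

text \<open>The two components of \<open>W\<close> times the intrinsic gradient of \<open>v\<close>.
  Their coordinate divergence is \<open>W\<close> times the Laplace-Beltrami operator applied to
  \<open>v\<close>.\<close>

definition "flux1 v z = (G z / W z) * dir_deriv S e1 v z - (F z / W z) * dir_deriv S e2 v z"
definition "flux2 v z = (E z / W z) * dir_deriv S e2 v z - (F z / W z) * dir_deriv S e1 v z"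

lemma smooth_flux:
  assumes "smooth_on S v" shows "smooth_on S (flux1 v)" "smooth_on S (flux2 v)"
  unfolding flux1_def flux2_def
  by (intro smooth_on_diff smooth_on_mult smooth_quotients smooth_on_dir_deriv S assms)+

lemma flux_along:
  assumes L: "smooth_on T L" and \<Phi>T: "\<Phi> ` S \<subseteq> T" and z: "z \<in> S"
  shows "flux1 (\<lambda>z. L (\<Phi> z)) z = dir_deriv T (Y1 z) L (\<Phi> z)"
    and "flux2 (\<lambda>z. L (\<Phi> z)) z = dir_deriv T (Y2 z) L (\<Phi> z)"
proof -
  have "\<Phi> z \<in> T" using z \<Phi>T by auto
  note lin = linear_dir_deriv[OF L this]
  show "flux1 (\<lambda>z. L (\<Phi> z)) z = dir_deriv T (Y1 z) L (\<Phi> z)"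
    "flux2 (\<lambda>z. L (\<Phi> z)) z = dir_deriv T (Y2 z) L (\<Phi> z)"
    unfolding flux1_def flux2_def dir_deriv_compose[OF S z \<Phi> L \<Phi>T] Y1_def Y2_def
      linear_diff[OF lin] linear_scale[OF lin] by simp_all
qed

text \<open>By \<open>dir_deriv_along\<close> the divergence splits into dL applied to
  \<open>divY\<close>, which is zero, and the Hessian of \<open>L\<close> on the pairs
  \<open>(p1, Y1)\<close> and \<open>(p2, Y2)\<close>. The latter is \<open>1 / W\<close> times the
  expression in \<open>plane_trace_nonpos\<close>.\<close>

lemma divergence_nonpos:
  assumes T: "regular_domain T" and L: "smooth_on T L" and \<Phi>T: "\<Phi> ` S \<subseteq> T" and z: "z \<in> S"
    and tr: "\<And>a c. a \<bullet> a = 1 \<Longrightarrow> c \<bullet> c = 1 \<Longrightarrow> a \<bullet> c = 0 \<Longrightarrow>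
      dir_deriv T a (dir_deriv T a L) (\<Phi> z) + dir_deriv T c (dir_deriv T c L) (\<Phi> z) \<le> 0"
    and min: "divY z = 0"
  shows "dir_deriv S e1 (flux1 (\<lambda>z. L (\<Phi> z))) z + dir_deriv S e2 (flux2 (\<lambda>z. L (\<Phi> z))) z \<le> 0"
proof -
  let ?H = "\<lambda>u w. dir_deriv T u (dir_deriv T w L) (\<Phi> z)"
  have y: "\<Phi> z \<in> T" using z \<Phi>T by auto
  have W: "W z > 0" by (rule W_pos(2)[OF z])
  note lin = linear_dir_deriv[OF L y]
  have linH: "linear (\<lambda>w. ?H u w)" for u by (rule linear_dir_deriv_dir_deriv[OF T L y])
  have "dir_deriv S e1 (flux1 (\<lambda>z. L (\<Phi> z))) z = dir_deriv S e1 (\<lambda>z. dir_deriv T (Y1 z) L (\<Phi> z)) z"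
    by (rule dir_deriv_cong[OF z flux_along(1)[OF L \<Phi>T]])
  moreover have "dir_deriv S e2 (flux2 (\<lambda>z. L (\<Phi> z))) z = dir_deriv S e2 (\<lambda>z. dir_deriv T (Y2 z) L (\<Phi> z)) z"
    by (rule dir_deriv_cong[OF z flux_along(2)[OF L \<Phi>T]])
  moreover have "dir_deriv T (dir_deriv S e1 Y1 z) L (\<Phi> z) + dir_deriv T (dir_deriv S e2 Y2 z) L (\<Phi> z) = 0"
    using min linear_add[OF lin, of "dir_deriv S e1 Y1 z" "dir_deriv S e2 Y2 z"] linear_0[OF lin] by (simp add: divY_def)
  ultimately have "dir_deriv S e1 (flux1 (\<lambda>z. L (\<Phi> z))) z + dir_deriv S e2 (flux2 (\<lambda>z. L (\<Phi> z))) z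
      = ?H (p1 z) (Y1 z) + ?H (p2 z) (Y2 z)"
    using dir_deriv_along[OF S T \<Phi> \<Phi>T smooth_Y(1) L z, of e1] dir_deriv_along[OF S T \<Phi> \<Phi>T smooth_Y(2) L z, of e2]
    by simp
  also have "\<dots> = (G z * ?H (p1 z) (p1 z) - 2 * F z * ?H (p1 z) (p2 z) + E z * ?H (p2 z) (p2 z)) / W z"
    unfolding Y1_def Y2_def linear_diff[OF linH] linear_scale[OF linH]
    using W dir_deriv_commute[OF T L y, of "p2 z" "p1 z"] by (simp add: field_simps)
  also have "\<dots> \<le> 0"
  proof -
    have "(p2 z \<bullet> p2 z) * ?H (p1 z) (p1 z) - 2 * (p1 z \<bullet> p2 z) * ?H (p1 z) (p2 z) + (p1 z \<bullet> p1 z) * ?H (p2 z) (p2 z) \<le> 0"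
      by (rule plane_trace_nonpos[OF linH dir_deriv_commute[OF T L y] det_pos[OF z] tr])
    then show ?thesis using W by (simp add: E_def F_def G_def divide_nonpos_pos)
  qed
  finally show ?thesis .
qed

text \<open>Both vectors are tangent and orthogonal to \<open>p1\<close>, hence parallel. Since
  \<open>Y2 z\<close> has squared length \<open>E z\<close>, only the sign remains, and
  \<open>b < 0\<close> decides it.\<close>

lemma conormal:
  assumes z: "z \<in> S" and x: "x = a *\<^sub>R p1 z + b *\<^sub>R p2 z" "x \<bullet> x = 1" "x \<bullet> p1 z = 0" "b < 0"
  shows "Y2 z = - sqrt (E z) *\<^sub>R x"
proof -
  have W: "W z > 0" and E: "E z > 0" by (rule W_pos(2)[OF z], rule E_pos[OF z])
  have aE: "a * E z = - b * F z"
    using x(3) by (simp add: x(1) inner_add_left inner_commute[of "p2 z"] E_def F_def)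
  have "E z *\<^sub>R x = (a * E z) *\<^sub>R p1 z + (b * E z) *\<^sub>R p2 z" by (simp add: x(1) algebra_simps)
  also have "\<dots> = (b * W z) *\<^sub>R Y2 z" unfolding aE using W by (simp add: Y2_def algebra_simps)
  finally have xY: "E z *\<^sub>R x = (b * W z) *\<^sub>R Y2 z" .
  have "Y2 z \<bullet> Y2 z = E z"
  proof -
    have "Y2 z \<bullet> Y2 z = (E z / W z) * (Y2 z \<bullet> p2 z) - (F z / W z) * (Y2 z \<bullet> p1 z)"
      by (subst (2) Y2_def) (simp add: inner_diff_right)
    then show ?thesis using W by (simp add: Y_dot[OF z])
  qed
  then have "(b * W z)\<^sup>2 * E z = (E z *\<^sub>R x) \<bullet> (E z *\<^sub>R x)" unfolding xY by (simp add: power2_eq_square)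
  also have "\<dots> = (E z)\<^sup>2" by (simp add: x(2) power2_eq_square)
  finally have "(- (b * W z))\<^sup>2 = E z" using E by (simp add: power2_eq_square)
  moreover have "- (b * W z) \<ge> 0" using x(4) W by (simp add: mult_nonpos_nonneg)
  ultimately have bW: "b * W z = - sqrt (E z)" using real_sqrt_unique by fastforce
  have "sqrt (E z) *\<^sub>R (sqrt (E z) *\<^sub>R x) = sqrt (E z) *\<^sub>R (- Y2 z)" using xY E unfolding bW by simp
  then have "sqrt (E z) *\<^sub>R x = - Y2 z" using E by (simp only: scaleR_cancel_left) simp
  then show ?thesis by simp
qed

end

section \<open>Integration in the half plane\<close>

abbreviation vec2 :: "real \<Rightarrow> real \<Rightarrow> real^2" where "vec2 x y \<equiv> vector [x, y]"

lemma vec2_eq: "vec2 x y = x *\<^sub>R e1 + y *\<^sub>R e2"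
  by (simp add: vec_eq_iff forall_2 axis_def)

lemma vec2_components: "vec2 (z $ 1) (z $ 2) = z"
  by (simp add: vec_eq_iff forall_2)

lemma continuous_on_vec2 [continuous_intros]:
  "continuous_on A f \<Longrightarrow> continuous_on A g \<Longrightarrow> continuous_on A (\<lambda>x. vec2 (f x) (g x))"
  unfolding vec2_eq by (intro continuous_intros)

lemma cbox_vec2: "cbox (vec2 a c) (vec2 b d) = {z. a \<le> z $ 1 \<and> z $ 1 \<le> b \<and> c \<le> z $ 2 \<and> z $ 2 \<le> d}"
  by (auto simp: mem_box_cart forall_2)

text \<open>Fubini on \<open>real \<times> real\<close>, transported along a coordinate map that
  sends boxes to boxes of equal content; this is the factor 1 in the transport.\<close>

lemma integral_cbox_vec2:
  fixes f :: "real^2 \<Rightarrow> real"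
  assumes f: "continuous_on (cbox (vec2 a c) (vec2 b d)) f"
  shows "integral (cbox (vec2 a c) (vec2 b d)) f = integral {a..b} (\<lambda>x. integral {c..d} (\<lambda>y. f (vec2 x y)))"
    and "integral (cbox (vec2 a c) (vec2 b d)) f = integral {c..d} (\<lambda>y. integral {a..b} (\<lambda>x. f (vec2 x y)))"
proof -
  let ?g = "\<lambda>p::real\<times>real. vec2 (fst p) (snd p)" and ?h = "\<lambda>z::real^2. (z $ 1, z $ 2)"
  have g: "?g ` cbox u v = cbox (?g u) (?g v)" for u v
  proof -
    have "?g p \<in> cbox (?g u) (?g v) \<longleftrightarrow> p \<in> cbox u v" for p
      by (cases p; cases u; cases v) (auto simp: cbox_vec2)
    moreover have "z = ?g (?h z)" for z by (simp add: vec2_components)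
    ultimately show ?thesis by (metis (no_types, lifting) image_iff subsetI subset_antisym image_subsetI)
  qed
  have h: "?h ` cbox u v = cbox (?h u) (?h v)" for u v :: "real^2"
  proof -
    have "?h z \<in> cbox (?h u) (?h v) \<longleftrightarrow> z \<in> cbox u v" for z by (auto simp: mem_box_cart forall_2)
    moreover have "p = ?h (?g p)" for p by simp
    ultimately show ?thesis by (metis (no_types, lifting) image_iff subsetI subset_antisym image_subsetI)
  qed
  have con: "measure lborel (?g ` cbox u v) = 1 * measure lborel (cbox u v)" for u v
  proof -
    obtain u1 u2 v1 v2 where uv: "u = (u1, u2)" "v = (v1, v2)" by (cases u; cases v)
    have "measure lborel (cbox (vec2 u1 u2) (vec2 v1 v2)) = measure lborel (cbox u1 v1) * measure lborel (cbox u2 v2)"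
    proof (cases "u1 \<le> v1 \<and> u2 \<le> v2")
      case True
      then have "vec2 u1 u2 \<in> cbox (vec2 u1 u2) (vec2 v1 v2)" by (simp add: cbox_vec2)
      then have "cbox (vec2 u1 u2) (vec2 v1 v2) \<noteq> {}" by blast
      then show ?thesis using True by (simp add: content_cbox_cart UNIV_2 content_real)
    next
      case False
      then have "cbox (vec2 u1 u2) (vec2 v1 v2) = {}" unfolding cbox_vec2 by auto
      then show ?thesis using False by (auto simp: not_le)
    qed
    then show ?thesis unfolding g uv by (simp add: content_Pair)
  qed
  have "((\<lambda>p. f (?g p)) has_integral (1 / 1) *\<^sub>R integral (cbox (vec2 a c) (vec2 b d)) f) (?h ` cbox (vec2 a c) (vec2 b d))"
  proof (rule has_integral_twiddle[OF zero_less_one])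
    show "(f has_integral integral (cbox (vec2 a c) (vec2 b d)) f) (cbox (vec2 a c) (vec2 b d))"
      using integrable_continuous[OF f] by (rule integrable_integral)
    show "continuous (at p) ?g" for p unfolding vec2_eq by (intro continuous_intros)
    show "\<exists>w z. ?g ` cbox u v = cbox w z" for u v using g by blast
    show "\<exists>w z. ?h ` cbox u v = cbox w z" for u v using h by blast
  qed (simp_all only: con vec2_components fst_conv snd_conv vector_2 prod.collapse)
  then have eq: "integral (cbox (a, c) (b, d)) (\<lambda>p. f (?g p)) = integral (cbox (vec2 a c) (vec2 b d)) f"
    unfolding h by (simp add: integral_unique)
  have cont: "continuous_on (cbox (a, c) (b, d)) (\<lambda>p. f (?g p))"
    by (rule continuous_on_compose2[OF f]) (auto intro!: continuous_intros simp: cbox_vec2)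
  have cont': "continuous_on (cbox (a, c) (b, d)) (\<lambda>(x, y). f (vec2 x y))"
    using cont by (simp add: case_prod_unfold)
  show one: "integral (cbox (vec2 a c) (vec2 b d)) f = integral {a..b} (\<lambda>x. integral {c..d} (\<lambda>y. f (vec2 x y)))"
    using integral_prod_continuous[OF cont] unfolding eq by simp
  show "integral (cbox (vec2 a c) (vec2 b d)) f = integral {c..d} (\<lambda>y. integral {a..b} (\<lambda>x. f (vec2 x y)))"
    using integral_swap_continuous[OF cont'] unfolding one by simp
qed

lemma convex_half_plane: "convex half_plane"
  unfolding half_plane_def by (auto simp: convex_def)

lemma closed_half_plane: "closed half_plane"
  unfolding half_plane_def by (intro closed_Collect_le continuous_intros)

lemma regular_half_plane: "regular_domain half_plane"
proof (rule regular_domain_convex[OF convex_half_plane])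
  have "open {z::real^2. 0 < z $ 2}" by (intro open_Collect_less continuous_intros)
  then have "{z::real^2. 0 < z $ 2} \<subseteq> interior half_plane" by (auto simp: half_plane_def intro!: interior_maximal[THEN subsetD])
  moreover have "e2 \<in> {z::real^2. 0 < z $ 2}" by simp
  ultimately show "interior half_plane \<noteq> {}" by blast
qed

lemma regular_openin_half_plane: "openin (top_of_set half_plane) S \<Longrightarrow> regular_domain S"
  by (rule regular_domain_openin[OF regular_half_plane])

lemma borel_openin_half_plane: "openin (top_of_set half_plane) S \<Longrightarrow> S \<in> sets borel"
  using closed_half_plane by (auto simp: openin_open)

text \<open>Chart images may be unbounded and are in general not compact, so integrability comes
  from a compact set carrying the function. Both kinds of integral are covered: the Lebesgue one
  defines lengths, the gauge integral serves in the change of variables.\<close>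

lemma integrable_compact_support:
  fixes f :: "'a::euclidean_space \<Rightarrow> real"
  assumes C: "compact C" "C \<subseteq> S" and f: "continuous_on S f" and zero: "\<And>z. z \<in> S \<Longrightarrow> z \<notin> C \<Longrightarrow> f z = 0"
  shows "set_integrable lborel S f" "f absolutely_integrable_on S" "integral S f = integral C f"
    "(LBINT z:S. f z) = integral C f"
proof -
  have eq: "(\<lambda>z. indicator S z *\<^sub>R f z) = (\<lambda>z. indicator C z *\<^sub>R f z)"
    using C(2) zero by (auto simp: indicator_def fun_eq_iff)
  have int: "integrable lborel (\<lambda>z. indicator C z *\<^sub>R f z)"
    by (rule borel_integrable_compact[OF C(1) continuous_on_subset[OF f C(2)]])
  then show 1: "set_integrable lborel S f" unfolding set_integrable_def eq .
  have "integrable (completion lborel) (\<lambda>z. indicator C z *\<^sub>R f z)"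
    using int by (subst integrable_completion) auto
  then show "f absolutely_integrable_on S" unfolding set_integrable_def eq .
  have "integral S f = integral UNIV (\<lambda>z. if z \<in> S then f z else 0)" by (rule integral_restrict_UNIV[symmetric])
  also have "(\<lambda>z. if z \<in> S then f z else 0) = (\<lambda>z. if z \<in> C then f z else 0)"
    by (rule ext) (use C(2) in \<open>auto simp: zero\<close>)
  also have "integral UNIV \<dots> = integral C f" by (rule integral_restrict_UNIV)
  finally show "integral S f = integral C f" .
  then show "(LBINT z:S. f z) = integral C f" using set_borel_integral_eq_integral(2)[OF 1] by simp
qed

lemma has_vector_derivative_line:
  assumes D: "smooth_on K P" and im: "\<And>t. t \<in> I \<Longrightarrow> x + t *\<^sub>R e \<in> K" and t: "t \<in> I"
  shows "((\<lambda>t. P (x + t *\<^sub>R e)) has_vector_derivative dir_deriv K e P (x + t *\<^sub>R e)) (at t within I)"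
proof -
  have "((\<lambda>t. x + t *\<^sub>R e) has_derivative (\<lambda>h. h *\<^sub>R e)) (at t within I)"
    by (auto intro!: derivative_eq_intros)
  moreover have "(P has_derivative (\<lambda>v. dir_deriv K v P (x + t *\<^sub>R e))) (at (x + t *\<^sub>R e) within (\<lambda>t. x + t *\<^sub>R e) ` I)"
    by (rule has_derivative_subset[OF smooth_on_has_derivative[OF D im[OF t]]]) (use im in blast)
  ultimately have "((\<lambda>t. P (x + t *\<^sub>R e)) has_derivative (\<lambda>h. dir_deriv K (h *\<^sub>R e) P (x + t *\<^sub>R e))) (at t within I)"
    by (rule has_derivative_in_compose)
  then show ?thesis
    unfolding has_vector_derivative_def linear_scale[OF linear_dir_deriv[OF D im[OF t]]] .
qed

lemma compact_vec2_line:
  assumes "compact C" shows "compact {t. vec2 t 0 \<in> C}"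
proof -
  have eq: "{t. vec2 t 0 \<in> C} = (\<lambda>t. vec2 t 0) -` C" by auto
  have "closed {t. vec2 t 0 \<in> C}" unfolding eq
    by (intro continuous_closed_vimage compact_imp_closed assms) (auto simp: vec2_eq intro!: continuous_intros)
  moreover have "{t. vec2 t 0 \<in> C} \<subseteq> (\<lambda>z. z $ 1) ` C" by (force simp: image_iff)
  then have "bounded {t. vec2 t 0 \<in> C}"
    by (rule bounded_subset[rotated]) (intro compact_imp_bounded compact_continuous_image assms continuous_intros)
  ultimately show ?thesis by (simp add: compact_eq_bounded_closed)
qed

lemma set_integrable_line:
  fixes f :: "real^2 \<Rightarrow> real"
  assumes C: "compact C" "C \<subseteq> S" and f: "continuous_on S f" and zero: "\<And>z. z \<in> S \<Longrightarrow> z \<notin> C \<Longrightarrow> f z = 0"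
  shows "set_integrable lborel {t. vec2 t 0 \<in> S} (\<lambda>t. f (vec2 t 0))"
    and "(LBINT t:{t. vec2 t 0 \<in> S}. f (vec2 t 0)) = integral {t. vec2 t 0 \<in> C} (\<lambda>t. f (vec2 t 0))"
proof -
  have "continuous_on {t. vec2 t 0 \<in> S} (\<lambda>t. f (vec2 t 0))"
    by (rule continuous_on_compose2[OF f]) (auto intro!: continuous_intros)
  note * = compact_vec2_line[OF C(1)] _ this
  show "set_integrable lborel {t. vec2 t 0 \<in> S} (\<lambda>t. f (vec2 t 0))"
    by (rule integrable_compact_support(1)[OF *]) (use C zero in auto)
  show "(LBINT t:{t. vec2 t 0 \<in> S}. f (vec2 t 0)) = integral {t. vec2 t 0 \<in> C} (\<lambda>t. f (vec2 t 0))"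
    by (rule integrable_compact_support(4)[OF *]) (use C zero in auto)
qed

lemma compact_in_box:
  assumes "compact (C :: (real^2) set)"
  obtains R where "R > 0" "\<And>z. z \<in> C \<Longrightarrow> \<bar>z $ 1\<bar> < R \<and> \<bar>z $ 2\<bar> < R"
proof -
  obtain B where B: "B > 0" "\<And>z. z \<in> C \<Longrightarrow> norm z \<le> B"
    using compact_imp_bounded[OF assms] by (auto simp: bounded_pos)
  show ?thesis
  proof (rule that[of "B + 1"])
    show "B + 1 > 0" using B(1) by simp
    fix z assume "z \<in> C"
    then show "\<bar>z $ 1\<bar> < B + 1 \<and> \<bar>z $ 2\<bar> < B + 1"
      using B(2)[of z] component_le_norm_cart[of z 1] component_le_norm_cart[of z 2] by simp
  qed
qed

text \<open>The carrier fits in a box whose bottom edge lies on the boundary line. The fundamental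
  theorem of calculus on each line leaves values on the four edges, and all but those on the bottom
  vanish; the minus sign comes from the outward normal \<open>- e2\<close>.\<close>

lemma divergence_half_plane:
  assumes P: "smooth_on half_plane P" and Q: "smooth_on half_plane Q"
    and C: "compact C" "C \<subseteq> half_plane"
    and zero: "\<And>z. z \<in> half_plane \<Longrightarrow> z \<notin> C \<Longrightarrow> P z = (0::real)" "\<And>z. z \<in> half_plane \<Longrightarrow> z \<notin> C \<Longrightarrow> Q z = (0::real)"
    and zero': "\<And>z. z \<in> half_plane \<Longrightarrow> z \<notin> C \<Longrightarrow> dir_deriv half_plane e1 P z = 0"
       "\<And>z. z \<in> half_plane \<Longrightarrow> z \<notin> C \<Longrightarrow> dir_deriv half_plane e2 Q z = 0"
  shows "integral C (\<lambda>z. dir_deriv half_plane e1 P z + dir_deriv half_plane e2 Q z)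
      = - integral {t. vec2 t 0 \<in> C} (\<lambda>t. Q (vec2 t 0))"
proof -
  let ?K = "half_plane" and ?D1 = "dir_deriv half_plane e1 P" and ?D2 = "dir_deriv half_plane e2 Q"
  obtain R where R: "R > 0" "\<And>z. z \<in> C \<Longrightarrow> \<bar>z $ 1\<bar> < R \<and> \<bar>z $ 2\<bar> < R"
    using compact_in_box[OF C(1)] by metis
  let ?B = "cbox (vec2 (-R) 0) (vec2 R R)"
  have BK: "?B \<subseteq> ?K" by (auto simp: cbox_vec2 half_plane_def)
  have CB: "C \<subseteq> ?B" using R C(2) by (fastforce simp: cbox_vec2 half_plane_def)
  have cD: "continuous_on ?B ?D1" "continuous_on ?B ?D2"
    by (intro continuous_on_subset[OF smooth_on_imp_continuous_on[OF smooth_on_dir_deriv[OF regular_half_plane]] BK] P Q)+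
  have inK: "vec2 x y \<in> ?K" if "y \<ge> 0" for x y using that by (simp add: half_plane_def)
  \<comment> \<open>The bounds defining \<open>R\<close> are strict, so the sides and the top of the
    box miss \<open>C\<close>.\<close>
  have nC: "vec2 R y \<notin> C" "vec2 (-R) y \<notin> C" "vec2 x R \<notin> C" for x y
    using R(2)[of "vec2 R y"] R(2)[of "vec2 (-R) y"] R(2)[of "vec2 x R"] by auto
  have "integral C (\<lambda>z. ?D1 z + ?D2 z) = integral ?B (\<lambda>z. ?D1 z + ?D2 z)"
    by (rule integrable_compact_support(3)[OF C(1) CB, symmetric])
       (use zero' BK in \<open>auto intro!: continuous_intros cD\<close>)
  also have "\<dots> = integral ?B ?D1 + integral ?B ?D2"
    by (rule Henstock_Kurzweil_Integration.integral_add) (intro integrable_continuous cD)+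
  also have "integral ?B ?D1 = integral {0..R} (\<lambda>y. integral {-R..R} (\<lambda>x. ?D1 (vec2 x y)))"
    by (rule integral_cbox_vec2(2)[OF cD(1)])
  also have "\<dots> = integral {0..R} (\<lambda>y. 0)"
  proof (rule integral_cong)
    fix y assume y: "y \<in> {0..R}"
    have "((\<lambda>x. P (vec2 x y)) has_vector_derivative ?D1 (vec2 x y)) (at x within {-R..R})" if "x \<in> {-R..R}" for x
      using has_vector_derivative_line[OF P, of "{-R..R}" "y *\<^sub>R e2" e1 x] that inK[of y] y
      by (simp add: vec2_eq add.commute)
    then have "((\<lambda>x. ?D1 (vec2 x y)) has_integral P (vec2 R y) - P (vec2 (-R) y)) {-R..R}"
      using R(1) by (intro fundamental_theorem_of_calculus) auto
    moreover have "P (vec2 R y) = 0" "P (vec2 (-R) y) = 0" using zero(1) inK nC y by auto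
    ultimately show "integral {-R..R} (\<lambda>x. ?D1 (vec2 x y)) = 0" by (simp add: integral_unique)
  qed
  also have "integral ?B ?D2 = integral {-R..R} (\<lambda>x. integral {0..R} (\<lambda>y. ?D2 (vec2 x y)))"
    by (rule integral_cbox_vec2(1)[OF cD(2)])
  also have "\<dots> = integral {-R..R} (\<lambda>x. - Q (vec2 x 0))"
  proof (rule integral_cong)
    fix x
    have "((\<lambda>y. Q (vec2 x y)) has_vector_derivative ?D2 (vec2 x y)) (at y within {0..R})" if "y \<in> {0..R}" for y
      using has_vector_derivative_line[OF Q, of "{0..R}" "x *\<^sub>R e1" e2 y] that inK[of _ x]
      by (simp add: vec2_eq)
    then have "((\<lambda>y. ?D2 (vec2 x y)) has_integral Q (vec2 x R) - Q (vec2 x 0)) {0..R}"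
      using R(1) by (intro fundamental_theorem_of_calculus) auto
    moreover have "Q (vec2 x R) = 0" using zero(2) inK nC R(1) by auto
    ultimately show "integral {0..R} (\<lambda>y. ?D2 (vec2 x y)) = - Q (vec2 x 0)" by (simp add: integral_unique)
  qed
  also have "\<dots> = - integral {-R..R} (\<lambda>x. Q (vec2 x 0))" by simp
  also have "integral {-R..R} (\<lambda>x. Q (vec2 x 0)) = integral {t. vec2 t 0 \<in> C} (\<lambda>t. Q (vec2 t 0))"
  proof (rule integrable_compact_support(3)[OF compact_vec2_line[OF C(1)]])
    show "{t. vec2 t 0 \<in> C} \<subseteq> {-R..R}" using R(2) by fastforce
    show "continuous_on {-R..R} (\<lambda>t. Q (vec2 t 0))"
      by (rule continuous_on_compose2[OF smooth_on_imp_continuous_on[OF Q]])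
         (auto intro!: continuous_intros inK)
    show "Q (vec2 t 0) = 0" if "t \<notin> {t. vec2 t 0 \<in> C}" for t using zero(2) inK that by auto
  qed
  finally show ?thesis by simp
qed

text \<open>\<open>S\<close> and \<open>K - C\<close> are relatively open and cover
  \<open>K\<close>; the extension is smooth on the first and zero on the second.\<close>

lemma smooth_on_extend_zero:
  fixes f :: "'a::euclidean_space \<Rightarrow> 'b::euclidean_space"
  assumes S: "openin (top_of_set K) S" and C: "closed C" "C \<subseteq> S"
    and f: "smooth_on S f" and zero: "\<And>z. z \<in> S \<Longrightarrow> z \<notin> C \<Longrightarrow> f z = 0"
  shows "smooth_on K (\<lambda>z. if z \<in> S then f z else 0)"
    and "z \<in> S \<Longrightarrow> dir_deriv K v (\<lambda>z. if z \<in> S then f z else 0) z = dir_deriv S v f z"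
    and "regular_domain K \<Longrightarrow> z \<in> K \<Longrightarrow> z \<notin> C \<Longrightarrow> dir_deriv K v (\<lambda>z. if z \<in> S then f z else 0) z = 0"
proof -
  let ?f = "\<lambda>z. if z \<in> S then f z else 0"
  have oC: "openin (top_of_set K) (K - C)" using C(1) by (auto simp: openin_open)
  show "smooth_on K ?f"
  proof (rule smooth_on_local)
    fix x assume x: "x \<in> K"
    show "\<exists>T. openin (top_of_set K) T \<and> x \<in> T \<and> smooth_on T ?f"
    proof (cases "x \<in> S")
      case True
      have "smooth_on S ?f" by (rule smooth_on_cong[OF f]) simp
      then show ?thesis using S True by blast
    next
      case False
      have "smooth_on (K - C) ?f" by (rule smooth_on_cong[OF smooth_on_const[of _ 0]]) (use zero in auto)
      then show ?thesis using oC False x C(2) by blast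
    qed
  qed
  show "dir_deriv K v ?f z = dir_deriv S v f z" if "z \<in> S"
    using dir_deriv_openin[OF S that, of v ?f] dir_deriv_cong[OF that, of ?f f v] by simp
  show "dir_deriv K v ?f z = 0" if K: "regular_domain K" and z: "z \<in> K" "z \<notin> C"
  proof -
    have z': "z \<in> K - C" using z by simp
    have "dir_deriv (K - C) v ?f z = dir_deriv (K - C) v (\<lambda>_. 0) z"
      by (rule dir_deriv_cong[OF z']) (use zero in auto)
    also have "\<dots> = 0" by (rule dir_deriv_const[OF regular_domain_openin[OF K oC] z'])
    finally show ?thesis using dir_deriv_openin[OF oC z', of v ?f] by simp
  qed
qed

text \<open>Extension by zero to the half plane reduces to \<open>divergence_half_plane\<close>: the
  frontier of \<open>S\<close> contributes only where \<open>S\<close> meets the boundary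
  line.\<close>

lemma divergence_theorem_patch:
  fixes P Q :: "real^2 \<Rightarrow> real"
  assumes S: "openin (top_of_set half_plane) S" and C: "compact C" "C \<subseteq> S"
    and P: "smooth_on S P" and Q: "smooth_on S Q"
    and zero: "\<And>z. z \<in> S \<Longrightarrow> z \<notin> C \<Longrightarrow> P z = 0" "\<And>z. z \<in> S \<Longrightarrow> z \<notin> C \<Longrightarrow> Q z = 0"
  shows "integral S (\<lambda>z. dir_deriv S e1 P z + dir_deriv S e2 Q z) = - (LBINT t:{t. vec2 t 0 \<in> S}. Q (vec2 t 0))"
proof -
  let ?P = "\<lambda>z. if z \<in> S then P z else 0" and ?Q = "\<lambda>z. if z \<in> S then Q z else 0"
  have rS: "regular_domain S" by (rule regular_openin_half_plane[OF S])
  note cC = compact_imp_closed[OF C(1)]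
  have sP: "smooth_on half_plane ?P" by (rule smooth_on_extend_zero(1)[OF S cC C(2) P]) (rule zero(1))
  have sQ: "smooth_on half_plane ?Q" by (rule smooth_on_extend_zero(1)[OF S cC C(2) Q]) (rule zero(2))
  have dP: "dir_deriv half_plane v ?P z = dir_deriv S v P z" if "z \<in> S" for v z
    by (rule smooth_on_extend_zero(2)[OF S cC C(2) P _ that]) (rule zero(1))
  have dQ: "dir_deriv half_plane v ?Q z = dir_deriv S v Q z" if "z \<in> S" for v z
    by (rule smooth_on_extend_zero(2)[OF S cC C(2) Q _ that]) (rule zero(2))
  have zP: "dir_deriv half_plane v ?P z = 0" if "z \<in> half_plane" "z \<notin> C" for v z
    by (rule smooth_on_extend_zero(3)[OF S cC C(2) P _ regular_half_plane that]) (rule zero(1))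
  have zQ: "dir_deriv half_plane v ?Q z = 0" if "z \<in> half_plane" "z \<notin> C" for v z
    by (rule smooth_on_extend_zero(3)[OF S cC C(2) Q _ regular_half_plane that]) (rule zero(2))
  have SK: "S \<subseteq> half_plane" using openin_imp_subset[OF S] .
  have "integral S (\<lambda>z. dir_deriv S e1 P z + dir_deriv S e2 Q z) = integral C (\<lambda>z. dir_deriv S e1 P z + dir_deriv S e2 Q z)"
  proof (rule integrable_compact_support(3)[OF C])
    show "continuous_on S (\<lambda>z. dir_deriv S e1 P z + dir_deriv S e2 Q z)"
      by (intro continuous_on_add smooth_on_imp_continuous_on smooth_on_dir_deriv rS P Q)
    show "dir_deriv S e1 P z + dir_deriv S e2 Q z = 0" if "z \<in> S" "z \<notin> C" for z
      unfolding dP[OF that(1), symmetric] dQ[OF that(1), symmetric]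
      using zP zQ SK that by (simp add: subset_iff)
  qed
  also have "\<dots> = integral C (\<lambda>z. dir_deriv half_plane e1 ?P z + dir_deriv half_plane e2 ?Q z)"
    by (rule integral_cong) (use C(2) in \<open>simp add: dP dQ subset_iff\<close>)
  also have "\<dots> = - integral {t. vec2 t 0 \<in> C} (\<lambda>t. ?Q (vec2 t 0))"
  proof (rule divergence_half_plane[OF sP sQ C(1)])
    show "C \<subseteq> half_plane" using C(2) SK by blast
  qed (simp_all add: zero zP zQ)
  also have "integral {t. vec2 t 0 \<in> C} (\<lambda>t. ?Q (vec2 t 0)) = integral {t. vec2 t 0 \<in> C} (\<lambda>t. Q (vec2 t 0))"
    using C(2) by (intro integral_cong) auto
  also have "\<dots> = (LBINT t:{t. vec2 t 0 \<in> S}. Q (vec2 t 0))"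
    by (rule set_integrable_line(2)[OF C smooth_on_imp_continuous_on[OF Q], symmetric]) (rule zero(2))
  finally show ?thesis .
qed

text \<open>Real values are identified with \<open>real^1\<close> to bring the integrand into the
  vector form of \<open>integral_change_of_variables\<close>.\<close>

lemma integral_change_of_variables_real_valued:
  fixes f :: "real^'m::{finite,wellorder} \<Rightarrow> real" and g :: "real^'m::_ \<Rightarrow> real^'m::_"
  assumes S: "S \<in> sets lebesgue" and der: "\<And>x. x \<in> S \<Longrightarrow> (g has_derivative g' x) (at x within S)"
    and inj: "inj_on g S" and f: "f absolutely_integrable_on g ` S"
  shows "integral (g ` S) f = integral S (\<lambda>x. \<bar>det (matrix (g' x))\<bar> * f (g x))"
proof -
  have "(\<lambda>x. vec (f x) :: real^1) absolutely_integrable_on g ` S"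
    using f by (simp add: absolutely_integrable_on_1_iff)
  then have "integral (g ` S) (\<lambda>x. vec (f x) :: real^1) = integral S (\<lambda>x. \<bar>det (matrix (g' x))\<bar> *\<^sub>R (vec (f (g x)) :: real^1))"
    by (intro integral_change_of_variables[OF S der inj]) auto
  then show ?thesis unfolding integral_on_1_eq by (simp add: vec_eq_iff)
qed

section \<open>The Dirichlet form on a compact surface\<close>

locale compact_surface =
  fixes X :: "'a topology" and A :: "'a chart set"
  assumes surface: "smooth_surface X A" and compact_X: "compact_space X"
begin

lemma chart_facts:
  assumes "c \<in> A"
  shows "openin X (fst c)" "fst c \<subseteq> topspace X" "openin (top_of_set half_plane) (coord_image c)"
    "homeomorphic_map (subtopology X (fst c)) (top_of_set (coord_image c)) (snd c)"
    "inj_on (snd c) (fst c)" "regular_domain (coord_image c)"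
proof -
  show 1: "openin X (fst c)" and 3: "openin (top_of_set half_plane) (coord_image c)"
    and 4: "homeomorphic_map (subtopology X (fst c)) (top_of_set (coord_image c)) (snd c)"
    using surface assms unfolding smooth_surface_def by auto
  show 2: "fst c \<subseteq> topspace X" using openin_subset[OF 1] .
  show "inj_on (snd c) (fst c)"
    using homeomorphic_imp_injective_map[OF 4] 2 by (simp add: Int_absorb1)
  show "regular_domain (coord_image c)" by (rule regular_openin_half_plane[OF 3])
qed

lemma param_inverse [simp]:
  assumes "c \<in> A"
  shows "p \<in> fst c \<Longrightarrow> param c (snd c p) = p"
    and "z \<in> coord_image c \<Longrightarrow> snd c (param c z) = z"
    and "z \<in> coord_image c \<Longrightarrow> param c z \<in> fst c"
    and "p \<in> fst c \<Longrightarrow> snd c p \<in> coord_image c"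
  using chart_facts(5)[OF assms]
  by (auto simp: param_def coord_image_def intro: f_inv_into_f inv_into_into)

lemma image_chart_open:
  assumes c: "c \<in> A" and V: "openin X V"
  shows "openin (top_of_set (coord_image c)) (snd c ` (fst c \<inter> V))"
proof -
  have "openin (subtopology X (fst c)) (fst c \<inter> V)" using V by (auto simp: openin_subtopology)
  moreover have "open_map (subtopology X (fst c)) (top_of_set (coord_image c)) (snd c)"
    by (rule homeomorphic_imp_open_map[OF chart_facts(4)[OF c]])
  ultimately show ?thesis by (simp add: open_map_def)
qed

lemma image_chart_compact:
  assumes c: "c \<in> A" and K: "closedin X K" "K \<subseteq> fst c"
  shows "compact (snd c ` K)" "snd c ` K \<subseteq> coord_image c"
proof -
  have "compactin (subtopology X (fst c)) K"
    using closedin_compact_space[OF compact_X K(1)] K(2) by (simp add: compactin_subtopology)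
  moreover have "continuous_map (subtopology X (fst c)) (top_of_set (coord_image c)) (snd c)"
    by (rule homeomorphic_imp_continuous_map[OF chart_facts(4)[OF c]])
  ultimately have "compactin (top_of_set (coord_image c)) (snd c ` K)" by (rule image_compactin)
  then show "compact (snd c ` K)" by (simp add: compactin_subtopology)
  show "snd c ` K \<subseteq> coord_image c" using K(2) by (auto simp: coord_image_def)
qed

section \<open>Change of charts\<close>

definition overlap :: "'a chart \<Rightarrow> 'a chart \<Rightarrow> (real^2) set" where
  "overlap c d = snd c ` (fst c \<inter> fst d)"

definition transition :: "'a chart \<Rightarrow> 'a chart \<Rightarrow> real^2 \<Rightarrow> real^2" where
  "transition c d z = snd d (param c z)"

lemma mem_overlap: "c \<in> A \<Longrightarrow> z \<in> overlap c d \<longleftrightarrow> z \<in> coord_image c \<and> param c z \<in> fst d"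
  unfolding overlap_def using param_inverse[of c]
  by (auto simp: image_iff) (metis IntI param_inverse(2,3))

lemma overlap_facts:
  assumes c: "c \<in> A" and d: "d \<in> A"
  shows "openin (top_of_set (coord_image c)) (overlap c d)"
    "openin (top_of_set half_plane) (overlap c d)" "regular_domain (overlap c d)"
    "smooth_on (overlap c d) (transition c d)" "transition c d ` overlap c d = overlap d c"
    "inj_on (transition c d) (overlap c d)"
    "z \<in> overlap c d \<Longrightarrow> param d (transition c d z) = param c z"
proof -
  show 1: "openin (top_of_set (coord_image c)) (overlap c d)"
    unfolding overlap_def by (rule image_chart_open[OF c chart_facts(1)[OF d]])
  show "openin (top_of_set half_plane) (overlap c d)"
    by (rule openin_trans[OF 1 chart_facts(3)[OF c]])
  then show "regular_domain (overlap c d)" by (rule regular_openin_half_plane)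
  have "smooth_on (overlap c d) (snd d \<circ> param c)"
    using surface c d unfolding smooth_surface_def overlap_def by blast
  then show "smooth_on (overlap c d) (transition c d)"
    by (simp add: comp_def transition_def[abs_def])
  show "param d (transition c d z) = param c z" if "z \<in> overlap c d" for z
    using that c d by (simp add: mem_overlap transition_def)
  show "inj_on (transition c d) (overlap c d)"
    by (rule inj_onI) (metis c d mem_overlap param_inverse(1,2) transition_def)
  have "transition c d (snd c p) = snd d p" if "p \<in> fst c \<inter> fst d" for p
    using that c by (simp add: transition_def)
  then show "transition c d ` overlap c d = overlap d c"
    unfolding overlap_def image_image by (auto simp: Int_commute)
qed

lemma smooth_map_chart: "smooth_map A h \<Longrightarrow> c \<in> A \<Longrightarrow> smooth_on (coord_image c) (\<lambda>z. h (param c z))"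
  unfolding smooth_map_def comp_def by blast

lemma dir_deriv_transition:
  fixes h :: "'a \<Rightarrow> 'b::euclidean_space"
  assumes c: "c \<in> A" and d: "d \<in> A" and h: "smooth_map A h" and z: "z \<in> overlap c d"
  defines "J \<equiv> \<lambda>e. dir_deriv (overlap c d) e (transition c d) z"
  shows "dir_deriv (coord_image c) e (\<lambda>z. h (param c z)) z =
    (J e $ 1) *\<^sub>R dir_deriv (coord_image d) e1 (\<lambda>z. h (param d z)) (transition c d z)
    + (J e $ 2) *\<^sub>R dir_deriv (coord_image d) e2 (\<lambda>z. h (param d z)) (transition c d z)"
proof -
  note ov = overlap_facts[OF c d]
  have im: "transition c d ` overlap c d \<subseteq> coord_image d"
    unfolding ov(5) using mem_overlap[OF d] by blast
  have w: "transition c d z \<in> coord_image d" using im z by blast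
  note sh = smooth_map_chart[OF h d]
  have "dir_deriv (coord_image c) e (\<lambda>z. h (param c z)) z = dir_deriv (overlap c d) e (\<lambda>z. h (param c z)) z"
    by (rule dir_deriv_openin[OF ov(1) z, symmetric])
  also have "\<dots> = dir_deriv (overlap c d) e (\<lambda>z. h (param d (transition c d z))) z"
    by (rule dir_deriv_cong[OF z]) (simp add: ov(7))
  also have "\<dots> = dir_deriv (coord_image d) (J e) (\<lambda>z. h (param d z)) (transition c d z)"
    unfolding J_def by (rule dir_deriv_compose[OF ov(3) z ov(4) sh im])
  also have "\<dots> = dir_deriv (coord_image d) ((J e $ 1) *\<^sub>R e1 + (J e $ 2) *\<^sub>R e2) (\<lambda>z. h (param d z)) (transition c d z)"
    by (simp add: vec2_eq[symmetric] vec2_components)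
  finally show ?thesis
    by (simp only: linear_add[OF linear_dir_deriv[OF sh w]] linear_scale[OF linear_dir_deriv[OF sh w]])
qed

lemma dir_deriv_outside_support:
  fixes h :: "'a \<Rightarrow> 'b::euclidean_space"
  assumes c: "c \<in> A" and K: "closedin X K" and zero: "\<And>p. p \<in> topspace X \<Longrightarrow> p \<notin> K \<Longrightarrow> h p = 0"
    and z: "z \<in> coord_image c" "param c z \<notin> K"
  shows "dir_deriv (coord_image c) e (\<lambda>z. h (param c z)) z = 0"
proof -
  let ?T = "snd c ` (fst c \<inter> (topspace X - K))"
  have T: "openin (top_of_set (coord_image c)) ?T"
    using image_chart_open[OF c] K by blast
  have zT: "z \<in> ?T"
    using z c chart_facts(2)[OF c] by (intro image_eqI[of _ _ "param c z"]) (auto dest: param_inverse(3)[OF c])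
  have "dir_deriv (coord_image c) e (\<lambda>z. h (param c z)) z = dir_deriv ?T e (\<lambda>z. h (param c z)) z"
    by (rule dir_deriv_openin[OF T zT, symmetric])
  also have "\<dots> = dir_deriv ?T e (\<lambda>z. 0) z"
    by (rule dir_deriv_cong[OF zT]) (use c zero in auto)
  also have "\<dots> = 0"
    by (rule dir_deriv_const[OF regular_domain_openin[OF chart_facts(6)[OF c] T] zT])
  finally show ?thesis .
qed

lemma param_topspace: "c \<in> A \<Longrightarrow> z \<in> coord_image c \<Longrightarrow> param c z \<in> topspace X"
  using param_inverse(3) chart_facts(2) by blast

lemma outside_chart_support:
  assumes "c \<in> A" "z \<in> coord_image c" "z \<notin> snd c ` K" shows "param c z \<notin> K"
  using assms param_inverse(2)[OF assms(1,2)] by (metis imageI)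

definition "supp_set P i = X closure_of {p \<in> topspace X. snd (P ! i) p \<noteq> 0}"

lemma partition_facts:
  assumes P: "partition_of_unity X A P" and i: "i < length P"
  shows "fst (P ! i) \<in> A" "smooth_map A (snd (P ! i))" "p \<in> topspace X \<Longrightarrow> 0 \<le> snd (P ! i) p"
    "closedin X (supp_set P i)" "supp_set P i \<subseteq> fst (fst (P ! i))" "p \<in> topspace X \<Longrightarrow> p \<notin> supp_set P i \<Longrightarrow> snd (P ! i) p = 0"
proof -
  have "(fst (P ! i), snd (P ! i)) \<in> set P" using i by simp
  then show "fst (P ! i) \<in> A" "smooth_map A (snd (P ! i))" "p \<in> topspace X \<Longrightarrow> 0 \<le> snd (P ! i) p"
    "supp_set P i \<subseteq> fst (fst (P ! i))"
    using P unfolding partition_of_unity_def supp_set_def by blast+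
  show "closedin X (supp_set P i)" by (simp add: supp_set_def)
  show "snd (P ! i) p = 0" if "p \<in> topspace X" "p \<notin> supp_set P i"
    using that closure_of_subset[of "{p \<in> topspace X. snd (P ! i) p \<noteq> 0}" X] unfolding supp_set_def by blast
qed

lemma sum_partition: "partition_of_unity X A P \<Longrightarrow> p \<in> topspace X \<Longrightarrow> (\<Sum>i<length P. snd (P ! i) p) = 1"
  unfolding partition_of_unity_def
  by (simp add: sum_list_sum_nth case_prod_unfold atLeast0LessThan)

end

locale immersed_compact_surface = compact_surface X A
  for X :: "'a topology" and A :: "'a chart set" +
  fixes \<phi> :: "'a \<Rightarrow> 'b::euclidean_space"
  assumes \<phi>: "smooth_map A \<phi>"
    and immersion: "c \<in> A \<Longrightarrow> z \<in> coord_image c \<Longrightarrow> inj (chart_deriv c (\<phi> \<circ> param c) z)"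
begin

text \<open>Injectivity makes the image of the coordinate vector \<open>(-F, E)\<close> nonzero, and
  its squared length is \<open>E\<close> times the Gram determinant.\<close>

lemma patch:
  assumes c: "c \<in> A" shows "immersed_patch (coord_image c) (\<lambda>z. \<phi> (param c z))"
proof
  show "regular_domain (coord_image c)" by (rule chart_facts(6)[OF c])
  show s: "smooth_on (coord_image c) (\<lambda>z. \<phi> (param c z))" by (rule smooth_map_chart[OF \<phi> c])
  fix z assume z: "z \<in> coord_image c"
  let ?D = "\<lambda>e. dir_deriv (coord_image c) e (\<lambda>z. \<phi> (param c z)) z"
  let ?E = "?D e1 \<bullet> ?D e1" and ?F = "?D e1 \<bullet> ?D e2" and ?G = "?D e2 \<bullet> ?D e2"
  have lin: "linear ?D" by (rule linear_dir_deriv[OF s z])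
  have "inj ?D" using immersion[OF c z] by (simp add: chart_deriv_def dir_deriv_def comp_def)
  then have nz: "?D v \<noteq> 0" if "v \<noteq> 0" for v using that linear_injective_0[OF lin] by blast
  have "?D e1 \<noteq> 0" by (rule nz) simp
  then have E: "?E > 0" by simp
  have "vec2 (- ?F) ?E $ 2 \<noteq> 0" using E by simp
  then have "vec2 (- ?F) ?E \<noteq> 0" by (metis zero_index)
  then have "?D (vec2 (- ?F) ?E) \<noteq> 0" by (rule nz)
  also have "?D (vec2 (- ?F) ?E) = ?E *\<^sub>R ?D e2 - ?F *\<^sub>R ?D e1"
    unfolding vec2_eq linear_add[OF lin] linear_scale[OF lin] by simp
  finally have "(?E *\<^sub>R ?D e2 - ?F *\<^sub>R ?D e1) \<bullet> (?E *\<^sub>R ?D e2 - ?F *\<^sub>R ?D e1) > 0" by simp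
  also have "(?E *\<^sub>R ?D e2 - ?F *\<^sub>R ?D e1) \<bullet> (?E *\<^sub>R ?D e2 - ?F *\<^sub>R ?D e1) = ?E * (?E * ?G - ?F\<^sup>2)"
    by (simp add: inner_diff_left inner_diff_right inner_commute[of "?D e2" "?D e1"] power2_eq_square algebra_simps)
  finally show "?E * ?G - ?F\<^sup>2 > 0" using E by (simp add: zero_less_mult_iff)
qed

abbreviation "gE c \<equiv> immersed_patch.E (coord_image c) (\<lambda>z. \<phi> (param c z))"
abbreviation "gF c \<equiv> immersed_patch.F (coord_image c) (\<lambda>z. \<phi> (param c z))"
abbreviation "gG c \<equiv> immersed_patch.G (coord_image c) (\<lambda>z. \<phi> (param c z))"
abbreviation "gW c \<equiv> immersed_patch.W (coord_image c) (\<lambda>z. \<phi> (param c z))"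
abbreviation "fl1 c v \<equiv> immersed_patch.flux1 (coord_image c) (\<lambda>z. \<phi> (param c z)) (\<lambda>z. v (param c z))"
abbreviation "fl2 c v \<equiv> immersed_patch.flux2 (coord_image c) (\<lambda>z. \<phi> (param c z)) (\<lambda>z. v (param c z))"
abbreviation "pd c e \<rho> \<equiv> dir_deriv (coord_image c) e (\<lambda>z. \<rho> (param c z))"

text \<open>The density of \<open>g(\<nabla>\<rho>, \<nabla>v)\<close> times the area element.\<close>

definition dirichlet :: "'a chart \<Rightarrow> ('a \<Rightarrow> real) \<Rightarrow> ('a \<Rightarrow> real) \<Rightarrow> real^2 \<Rightarrow> real" where
  "dirichlet c \<rho> v z = pd c e1 \<rho> z * fl1 c v z + pd c e2 \<rho> z * fl2 c v z"

text \<open>The numerator is a polynomial symmetric in the two gradients, the form in which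
  \<open>dirichlet_transition\<close> compares charts by algebra.\<close>

lemma dirichlet_eq:
  assumes c: "c \<in> A"
  shows "dirichlet c \<rho> v z = (gG c z * (pd c e1 \<rho> z * pd c e1 v z)
      - gF c z * (pd c e1 \<rho> z * pd c e2 v z + pd c e2 \<rho> z * pd c e1 v z)
      + gE c z * (pd c e2 \<rho> z * pd c e2 v z)) / gW c z"
proof -
  interpret immersed_patch "coord_image c" "\<lambda>z. \<phi> (param c z)" by (rule patch[OF c])
  show ?thesis unfolding dirichlet_def flux1_def flux2_def
    by (simp add: diff_divide_distrib add_divide_distrib algebra_simps)
qed

text \<open>With \<delta> the Jacobian determinant, the numerator of \<open>dirichlet_eq\<close>
  scales by \<delta> squared and the area density by its absolute value, so the quotient changes
  like a density.\<close>

lemma dirichlet_transition: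
  assumes c: "c \<in> A" and d: "d \<in> A" and \<rho>: "smooth_map A \<rho>" and v: "smooth_map A v"
    and z: "z \<in> overlap c d"
  shows "dirichlet c \<rho> v z =
    \<bar>det (matrix (\<lambda>e. dir_deriv (overlap c d) e (transition c d) z))\<bar> * dirichlet d \<rho> v (transition c d z)"
proof -
  interpret pc: immersed_patch "coord_image c" "\<lambda>z. \<phi> (param c z)" by (rule patch[OF c])
  interpret pd: immersed_patch "coord_image d" "\<lambda>z. \<phi> (param d z)" by (rule patch[OF d])
  let ?J = "\<lambda>e. dir_deriv (overlap c d) e (transition c d) z" and ?w = "transition c d z"
  have zc: "z \<in> coord_image c" using z mem_overlap[OF c] by blast
  have wd: "?w \<in> coord_image d" using overlap_facts(5)[OF c d] z mem_overlap[OF d] by blast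
  let ?a = "?J e1 $ 1" and ?b = "?J e1 $ 2" and ?a' = "?J e2 $ 1" and ?b' = "?J e2 $ 2"
  define \<delta> where "\<delta> = ?a * ?b' - ?a' * ?b"
  have det: "det (matrix ?J) = \<delta>" by (simp add: det_2 matrix_def \<delta>_def)
  note t = dir_deriv_transition[OF c d _ z]
  have EFG: "gE c z = ?a * ?a * gE d ?w + 2 * ?a * ?b * gF d ?w + ?b * ?b * gG d ?w"
    "gF c z = ?a * ?a' * gE d ?w + (?a * ?b' + ?a' * ?b) * gF d ?w + ?b * ?b' * gG d ?w"
    "gG c z = ?a' * ?a' * gE d ?w + 2 * ?a' * ?b' * gF d ?w + ?b' * ?b' * gG d ?w"
    unfolding pc.E_def pc.F_def pc.G_def pd.E_def pd.F_def pd.G_def t[OF \<phi>]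
    by (simp_all add: inner_add_left inner_add_right inner_commute algebra_simps)
  have "gE c z * gG c z - gF c z * gF c z = (\<delta> * \<delta>) * (gE d ?w * gG d ?w - gF d ?w * gF d ?w)"
    unfolding EFG \<delta>_def by algebra
  then have "gW c z * gW c z = (\<delta> * \<delta>) * (gW d ?w * gW d ?w)"
    unfolding pc.W_square[OF zc] pd.W_square[OF wd] .
  then have "gW c z * gW c z = (\<bar>\<delta>\<bar> * gW d ?w) * (\<bar>\<delta>\<bar> * gW d ?w)"
    by simp
  then have W: "gW c z = \<bar>\<delta>\<bar> * gW d ?w"
    using pc.W_pos(2)[OF zc] pd.W_pos(2)[OF wd] by (intro power2_eq_imp_eq[of "gW c z"]) (auto simp: power2_eq_square)
  then have \<delta>: "\<delta> \<noteq> 0" using pc.W_pos(2)[OF zc] by auto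
  have num: "gG c z * (pd c e1 \<rho> z * pd c e1 v z)
      - gF c z * (pd c e1 \<rho> z * pd c e2 v z + pd c e2 \<rho> z * pd c e1 v z)
      + gE c z * (pd c e2 \<rho> z * pd c e2 v z)
    = (\<delta> * \<delta>) * (gG d ?w * (pd d e1 \<rho> ?w * pd d e1 v ?w)
      - gF d ?w * (pd d e1 \<rho> ?w * pd d e2 v ?w + pd d e2 \<rho> ?w * pd d e1 v ?w)
      + gE d ?w * (pd d e2 \<rho> ?w * pd d e2 v ?w))"
    unfolding EFG t[OF \<rho>] t[OF v] \<delta>_def real_scaleR_def by algebra
  have "\<delta> * \<delta> = \<bar>\<delta>\<bar> * \<bar>\<delta>\<bar>" by simp
  then show ?thesis
    unfolding dirichlet_eq[OF c] dirichlet_eq[OF d] num det W using \<delta> pd.W_pos(2)[OF wd]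
    by (simp add: field_simps)
qed

lemma smooth_dirichlet:
  assumes c: "c \<in> A" and \<rho>: "smooth_map A \<rho>" and v: "smooth_map A v"
  shows "smooth_on (coord_image c) (dirichlet c \<rho> v)"
proof -
  interpret immersed_patch "coord_image c" "\<lambda>z. \<phi> (param c z)" by (rule patch[OF c])
  note [intro] = smooth_on_dir_deriv[OF S smooth_map_chart[OF \<rho> c]]
  show ?thesis unfolding dirichlet_def
    by (intro smooth_on_add smooth_on_mult smooth_flux smooth_map_chart[OF v c]) auto
qed

text \<open>The support of \<open>\<psi>\<close> confines the first integral to the overlap, that of
  \<open>\<rho>\<close> the second. On the overlap \<open>dirichlet_transition\<close> supplies
  precisely the Jacobian factor of the change of variables.\<close>

lemma integral_dirichlet_chart:
  assumes c: "c \<in> A" and d: "d \<in> A" and \<rho>: "smooth_map A \<rho>" and \<psi>: "smooth_map A \<psi>" and v: "smooth_map A v"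
    and K: "closedin X K" "K \<subseteq> fst c" "\<And>p. p \<in> topspace X \<Longrightarrow> p \<notin> K \<Longrightarrow> \<rho> p = 0"
    and L: "closedin X L" "L \<subseteq> fst d" "\<And>p. p \<in> topspace X \<Longrightarrow> p \<notin> L \<Longrightarrow> \<psi> p = 0"
  shows "integral (coord_image c) (\<lambda>z. \<psi> (param c z) * dirichlet c \<rho> v z)
       = integral (coord_image d) (\<lambda>z. \<psi> (param d z) * dirichlet d \<rho> v z)"
proof -
  let ?f = "\<lambda>z. \<psi> (param d z) * dirichlet d \<rho> v z" and ?h = "\<lambda>z. \<psi> (param c z) * dirichlet c \<rho> v z"
  let ?J = "\<lambda>z e. dir_deriv (overlap c d) e (transition c d) z"
  have top: "param b z \<in> topspace X" if "b \<in> A" "z \<in> coord_image b" for b z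
    using param_inverse(3)[OF that] chart_facts(2)[OF that(1)] by blast
  have sub: "overlap c d \<subseteq> coord_image c" "overlap d c \<subseteq> coord_image d"
    using mem_overlap[OF c] mem_overlap[OF d] by blast+
  have "?f absolutely_integrable_on coord_image d"
  proof (rule integrable_compact_support(2)[OF image_chart_compact[OF d L(1,2)]])
    show "continuous_on (coord_image d) ?f"
      by (rule smooth_on_imp_continuous_on[OF smooth_on_mult[OF smooth_map_chart[OF \<psi> d] smooth_dirichlet[OF d \<rho> v]]])
    fix z assume z: "z \<in> coord_image d" "z \<notin> snd d ` L"
    have "param d z \<notin> L"
    proof
      assume "param d z \<in> L"
      then have "snd d (param d z) \<in> snd d ` L" by blast
      then show False using z param_inverse(2)[OF d] by simp
    qed
    then show "?f z = 0" using L(3) top[OF d z(1)] by simp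
  qed
  then have int: "?f absolutely_integrable_on overlap d c"
    by (rule set_integrable_subset) (use sub borel_openin_half_plane[OF overlap_facts(2)[OF d c]] in auto)
  have "integral (coord_image c) ?h = integral UNIV (\<lambda>z. if z \<in> coord_image c then ?h z else 0)"
    by (rule integral_restrict_UNIV[symmetric])
  also have "(\<lambda>z. if z \<in> coord_image c then ?h z else 0) = (\<lambda>z. if z \<in> overlap c d then ?h z else 0)"
  proof
    fix z show "(if z \<in> coord_image c then ?h z else 0) = (if z \<in> overlap c d then ?h z else 0)"
      using mem_overlap[OF c, of z d] L(2) L(3)[of "param c z"] top[OF c, of z] by auto
  qed
  also have "integral UNIV \<dots> = integral (overlap c d) ?h" by (rule integral_restrict_UNIV)
  also have "\<dots> = integral (overlap c d) (\<lambda>z. \<bar>det (matrix (?J z))\<bar> * ?f (transition c d z))"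
    by (rule integral_cong) (simp add: dirichlet_transition[OF c d \<rho> v] overlap_facts(7)[OF c d])
  also have "\<dots> = integral (transition c d ` overlap c d) ?f"
  proof (rule integral_change_of_variables_real_valued[symmetric])
    show "overlap c d \<in> sets lebesgue"
      using borel_openin_half_plane[OF overlap_facts(2)[OF c d]] by auto
    show "(transition c d has_derivative ?J z) (at z within overlap c d)" if "z \<in> overlap c d" for z
      by (rule smooth_on_has_derivative[OF overlap_facts(4)[OF c d] that])
    show "inj_on (transition c d) (overlap c d)" by (rule overlap_facts(6)[OF c d])
    show "?f absolutely_integrable_on transition c d ` overlap c d"
      unfolding overlap_facts(5)[OF c d] by (rule int)
  qed
  also have "\<dots> = integral (overlap d c) ?f" unfolding overlap_facts(5)[OF c d] ..
  also have "\<dots> = integral UNIV (\<lambda>z. if z \<in> overlap d c then ?f z else 0)"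
    by (rule integral_restrict_UNIV[symmetric])
  also have "(\<lambda>z. if z \<in> overlap d c then ?f z else 0) = (\<lambda>z. if z \<in> coord_image d then ?f z else 0)"
  proof
    fix z
    \<comment> \<open>Outside the overlap \<open>\<psi>\<close> may be nonzero here; the integrand
      vanishes because \<open>\<rho>\<close> is zero near such a point.\<close>
    have "dirichlet d \<rho> v z = 0" if z: "z \<in> coord_image d" "param d z \<notin> fst c"
    proof -
      have "param d z \<notin> K" using z K(2) by blast
      then have "pd d e \<rho> z = 0" for e
        by (intro dir_deriv_outside_support[OF d K(1) _ z(1)]) (rule K(3))
      then show ?thesis unfolding dirichlet_def by simp
    qed
    then show "(if z \<in> overlap d c then ?f z else 0) = (if z \<in> coord_image d then ?f z else 0)"
      using mem_overlap[OF d, of z c] by auto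
  qed
  also have "integral UNIV \<dots> = integral (coord_image d) ?f" by (rule integral_restrict_UNIV)
  finally show ?thesis .
qed

section \<open>Cancellation over a partition of unity\<close>

context
  fixes P :: "('a chart \<times> ('a \<Rightarrow> real)) list" and v :: "'a \<Rightarrow> real"
  assumes P: "partition_of_unity X A P" and v: "smooth_map A v"
begin

lemmas support_facts = partition_facts[OF P]

lemma dirichlet_outside:
  assumes i: "i < length P" and z: "z \<in> coord_image (fst (P ! i))" "z \<notin> snd (fst (P ! i)) ` supp_set P i"
  shows "dirichlet (fst (P ! i)) (snd (P ! i)) v z = 0"
proof -
  note f = support_facts[OF i]
  have "param (fst (P ! i)) z \<notin> supp_set P i" by (rule outside_chart_support[OF f(1) z])
  then have "pd (fst (P ! i)) e (snd (P ! i)) z = 0" for e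
    by (intro dir_deriv_outside_support[OF f(1,4) _ z(1)]) (rule f(6))
  then show ?thesis unfolding dirichlet_def by simp
qed

text \<open>The density is linear in the gradient of the cut-off, and the cut-offs have constant
  sum.\<close>

lemma sum_dirichlet_zero:
  assumes c: "c \<in> A" and z: "z \<in> coord_image c"
  shows "(\<Sum>i<length P. dirichlet c (snd (P ! i)) v z) = 0"
proof -
  note S = chart_facts(6)[OF c]
  have "(\<Sum>i<length P. pd c e (snd (P ! i)) z) = 0" for e
  proof -
    have "(\<Sum>i<length P. pd c e (snd (P ! i)) z) = dir_deriv (coord_image c) e (\<lambda>z. \<Sum>i<length P. snd (P ! i) (param c z)) z"
      by (rule dir_deriv_sum[OF S z, symmetric]) (use smooth_map_chart[OF support_facts(2) c] in auto)
    also have "\<dots> = dir_deriv (coord_image c) e (\<lambda>z. 1) z"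
      by (rule dir_deriv_cong[OF z]) (rule sum_partition[OF P param_topspace[OF c]])
    also have "\<dots> = 0" by (rule dir_deriv_const[OF S z])
    finally show ?thesis .
  qed
  then show ?thesis
    by (simp add: dirichlet_def sum.distrib flip: sum_distrib_right)
qed

text \<open>The summands live in different charts and cannot be added pointwise. Inserting the sum
  of all cut-offs, equal to 1, gives a double sum; its term \<open>(i, j)\<close> is moved from
  chart \<open>i\<close> to chart \<open>j\<close>, where summing over \<open>i\<close> first gives
  zero by \<open>sum_dirichlet_zero\<close>.\<close>

lemma sum_integral_dirichlet:
  "(\<Sum>i<length P. integral (coord_image (fst (P ! i))) (dirichlet (fst (P ! i)) (snd (P ! i)) v)) = 0"
proof -
  let ?n = "length P"
  let ?c = "\<lambda>i. fst (P ! i)" and ?\<rho> = "\<lambda>i. snd (P ! i)"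
  let ?I = "\<lambda>i j k. integral (coord_image (?c i)) (\<lambda>z. ?\<rho> j (param (?c i) z) * dirichlet (?c i) (?\<rho> k) v z)"
  have cont: "continuous_on (coord_image (?c i)) (\<lambda>z. ?\<rho> j (param (?c i) z) * dirichlet (?c i) (?\<rho> k) v z)"
    if "i < ?n" "j < ?n" "k < ?n" for i j k
    by (rule smooth_on_imp_continuous_on[OF smooth_on_mult[OF smooth_map_chart smooth_dirichlet]])
       (use support_facts(1,2) that v in auto)
  have 1: "integral (coord_image (?c i)) (dirichlet (?c i) (?\<rho> i) v) = (\<Sum>j<?n. ?I i j i)" if i: "i < ?n" for i
  proof -
    note f = support_facts[OF i]
    have "integral (coord_image (?c i)) (dirichlet (?c i) (?\<rho> i) v)
        = integral (coord_image (?c i)) (\<lambda>z. \<Sum>j<?n. ?\<rho> j (param (?c i) z) * dirichlet (?c i) (?\<rho> i) v z)"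
      by (rule integral_cong) (simp add: sum_partition[OF P param_topspace[OF f(1)]] flip: sum_distrib_right)
    also have "\<dots> = (\<Sum>j<?n. ?I i j i)"
    proof (rule integral_sum)
      fix j assume j: "j \<in> {..<?n}"
      show "(\<lambda>z. ?\<rho> j (param (?c i) z) * dirichlet (?c i) (?\<rho> i) v z) integrable_on coord_image (?c i)"
        by (rule set_lebesgue_integral_eq_integral(1)[OF integrable_compact_support(2)[OF image_chart_compact[OF f(1,4,5)]]])
           (use i j cont dirichlet_outside[OF i] in auto)
    qed simp
    finally show ?thesis .
  qed
  have 2: "?I i j i = ?I j j i" if "i < ?n" "j < ?n" for i j
    by (rule integral_dirichlet_chart[OF support_facts(1)[OF that(1)] support_facts(1)[OF that(2)]
          support_facts(2)[OF that(1)] support_facts(2)[OF that(2)] v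
          support_facts(4,5)[OF that(1)] support_facts(6)[OF that(1)] support_facts(4,5)[OF that(2)] support_facts(6)[OF that(2)]])
  have 3: "(\<Sum>i<?n. ?I j j i) = 0" if j: "j < ?n" for j
  proof -
    note f = support_facts[OF j]
    have "(\<Sum>i<?n. ?I j j i) = integral (coord_image (?c j)) (\<lambda>z. \<Sum>i<?n. ?\<rho> j (param (?c j) z) * dirichlet (?c j) (?\<rho> i) v z)"
    proof (rule integral_sum[symmetric])
      fix i assume i: "i \<in> {..<?n}"
      show "(\<lambda>z. ?\<rho> j (param (?c j) z) * dirichlet (?c j) (?\<rho> i) v z) integrable_on coord_image (?c j)"
        by (rule set_lebesgue_integral_eq_integral(1)[OF integrable_compact_support(2)[OF image_chart_compact[OF f(1,4,5)]]])
           (use i j cont f(6) param_topspace[OF f(1)] outside_chart_support[OF f(1)] in auto)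
    qed simp
    also have "\<dots> = integral (coord_image (?c j)) (\<lambda>z. 0)"
      by (rule integral_cong) (simp add: sum_dirichlet_zero[OF f(1)] flip: sum_distrib_left)
    finally show ?thesis by simp
  qed
  have "(\<Sum>i<?n. integral (coord_image (?c i)) (dirichlet (?c i) (?\<rho> i) v)) = (\<Sum>i<?n. \<Sum>j<?n. ?I j j i)"
  proof (rule sum.cong[OF refl])
    fix i assume "i \<in> {..<?n}"
    then have i: "i < ?n" by simp
    show "integral (coord_image (?c i)) (dirichlet (?c i) (?\<rho> i) v) = (\<Sum>j<?n. ?I j j i)"
      unfolding 1[OF i] by (rule sum.cong[OF refl]) (use 2[OF i] in simp)
  qed
  also have "\<dots> = (\<Sum>j<?n. \<Sum>i<?n. ?I j j i)" by (rule sum.swap)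
  also have "\<dots> = 0" using 3 by (intro sum.neutral) auto
  finally show ?thesis .
qed

text \<open>The divergence of a cut-off times the flux is the cut-off times the divergence, which is
  nonpositive, plus \<open>dirichlet\<close>; the latter integrals sum to zero. Since
  \<open>fl2\<close> on the edge points into the surface, the conclusion is that the outward flux is
  nonpositive.\<close>

lemma sum_boundary_flux:
  assumes super: "\<And>c z. c \<in> A \<Longrightarrow> z \<in> coord_image c \<Longrightarrow>
    dir_deriv (coord_image c) e1 (fl1 c v) z + dir_deriv (coord_image c) e2 (fl2 c v) z \<le> 0"
  shows "(\<Sum>i<length P. LBINT t:{t. vec2 t 0 \<in> coord_image (fst (P ! i))}.
      snd (P ! i) (param (fst (P ! i)) (vec2 t 0)) * fl2 (fst (P ! i)) v (vec2 t 0)) \<ge> 0"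
proof -
  let ?b = "\<lambda>i. LBINT t:{t. vec2 t 0 \<in> coord_image (fst (P ! i))}.
      snd (P ! i) (param (fst (P ! i)) (vec2 t 0)) * fl2 (fst (P ! i)) v (vec2 t 0)"
  let ?d = "\<lambda>i. integral (coord_image (fst (P ! i))) (dirichlet (fst (P ! i)) (snd (P ! i)) v)"
  have "- ?b i \<le> ?d i" if i: "i < length P" for i
  proof -
    note f = support_facts[OF i]
    define c \<rho> where "c = fst (P ! i)" and "\<rho> = snd (P ! i)"
    note f = f[folded c_def \<rho>_def]
    interpret immersed_patch "coord_image c" "\<lambda>z. \<phi> (param c z)" by (rule patch[OF f(1)])
    let ?S = "coord_image c" and ?r = "\<lambda>z. \<rho> (param c z)"
    note C = image_chart_compact[OF f(1,4,5)]
    note sr = smooth_map_chart[OF f(2,1)]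
    note sf = smooth_flux[OF smooth_map_chart[OF v f(1)]]
    have r0: "?r z = 0" if "z \<in> ?S" "z \<notin> snd c ` supp_set P i" for z
      by (rule f(6)[OF param_topspace[OF f(1) that(1)] outside_chart_support[OF f(1) that]])
    let ?div = "\<lambda>z. dir_deriv ?S e1 (fl1 c v) z + dir_deriv ?S e2 (fl2 c v) z"
    have split: "dir_deriv ?S e1 (\<lambda>z. ?r z * fl1 c v z) z + dir_deriv ?S e2 (\<lambda>z. ?r z * fl2 c v z) z
      = ?r z * ?div z + dirichlet c \<rho> v z" if z: "z \<in> ?S" for z
      unfolding dir_deriv_mult[OF S z sr sf(1)] dir_deriv_mult[OF S z sr sf(2)] dirichlet_def
      by (simp add: algebra_simps)
    have "- ?b i = integral ?S (\<lambda>z. dir_deriv ?S e1 (\<lambda>z. ?r z * fl1 c v z) z + dir_deriv ?S e2 (\<lambda>z. ?r z * fl2 c v z) z)"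
      unfolding c_def[symmetric] \<rho>_def[symmetric]
      by (rule divergence_theorem_patch[OF chart_facts(3)[OF f(1)] C smooth_on_mult[OF sr sf(1)] smooth_on_mult[OF sr sf(2)], symmetric])
         (simp_all add: r0)
    also have "\<dots> = integral ?S (\<lambda>z. ?r z * ?div z + dirichlet c \<rho> v z)"
      by (rule integral_cong) (rule split)
    also have "\<dots> \<le> integral ?S (dirichlet c \<rho> v)"
    proof (rule integral_le)
      have sd: "smooth_on ?S (\<lambda>z. ?r z * ?div z)"
        by (rule smooth_on_mult[OF sr smooth_on_add[OF smooth_on_dir_deriv[OF S sf(1)] smooth_on_dir_deriv[OF S sf(2)]]])
      have dz: "dirichlet c \<rho> v z = 0" if "z \<in> ?S" "z \<notin> snd c ` supp_set P i" for z
        using dirichlet_outside[OF i] that unfolding c_def \<rho>_def by blast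
      show "dirichlet c \<rho> v integrable_on ?S"
        by (rule set_lebesgue_integral_eq_integral(1)[OF integrable_compact_support(2)[OF C
              smooth_on_imp_continuous_on[OF smooth_dirichlet[OF f(1,2) v]]]]) (rule dz)
      show "(\<lambda>z. ?r z * ?div z + dirichlet c \<rho> v z) integrable_on ?S"
        by (rule set_lebesgue_integral_eq_integral(1)[OF integrable_compact_support(2)[OF C
              smooth_on_imp_continuous_on[OF smooth_on_add[OF sd smooth_dirichlet[OF f(1,2) v]]]]]) (simp add: r0 dz)
      fix z assume z: "z \<in> ?S"
      have "?r z * ?div z \<le> 0"
        using super[OF f(1) z] f(3)[OF param_topspace[OF f(1) z]] by (simp add: mult_nonneg_nonpos)
      then show "?r z * ?div z + dirichlet c \<rho> v z \<le> dirichlet c \<rho> v z" by simp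
    qed
    finally show ?thesis unfolding c_def \<rho>_def .
  qed
  then have "(\<Sum>i<length P. - ?b i) \<le> (\<Sum>i<length P. ?d i)" by (intro sum_mono) auto
  then show ?thesis unfolding sum_integral_dirichlet by (simp add: sum_negf)
qed

end

end

section \<open>Smooth partitions of unity\<close>

text \<open>The case \<open>n = 0\<close> is the usual flat function. The powers of
  \<open>inverse t\<close> are included to make the family closed under differentiation up to linear
  combinations, so that smoothness follows by one induction over all \<open>n\<close>.\<close>

definition flat_exp :: "nat \<Rightarrow> real \<Rightarrow> real" where
  "flat_exp n t = (if t > 0 then inverse t ^ n * exp (- inverse t) else 0)"

lemma power_le_exp:
  fixes x :: real assumes "x \<ge> 0" "m > 0" shows "x ^ m \<le> real m ^ m * exp x"
proof -
  have "x / m \<le> exp (x / m)" using exp_ge_add_one_self[of "x / m"] by linarith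
  then have "(x / m) ^ m \<le> exp (x / m) ^ m" using assms by (intro power_mono) auto
  also have "\<dots> = exp x" using assms by (simp flip: exp_of_nat_mult)
  finally show ?thesis using assms by (simp add: power_divide field_simps)
qed

text \<open>The exponent \<open>n + 2\<close> in \<open>power_le_exp\<close> buys two spare powers
  of \<open>t\<close>, and a quadratic bound is what differentiability at 0 needs; the constant is
  the one of \<open>power_le_exp\<close> for that exponent.\<close>

lemma flat_exp_bound: "\<bar>flat_exp n t\<bar> \<le> real (n + 2) ^ (n + 2) * t\<^sup>2"
proof (cases "t > 0")
  case True
  have "inverse t ^ (n + 2) * exp (- inverse t) \<le> real (n + 2) ^ (n + 2) * exp (inverse t) * exp (- inverse t)"
    using True by (intro mult_right_mono power_le_exp) auto
  then have "inverse t ^ (n + 2) * exp (- inverse t) \<le> real (n + 2) ^ (n + 2)"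
    by (simp only: mult.assoc exp_minus_inverse mult_1_right)
  then have le: "t\<^sup>2 * (inverse t ^ (n + 2) * exp (- inverse t)) \<le> t\<^sup>2 * real (n + 2) ^ (n + 2)"
    by (intro mult_left_mono) auto
  have eq: "t\<^sup>2 * (inverse t ^ (n + 2) * exp (- inverse t)) = inverse t ^ n * exp (- inverse t)"
    using True by (simp add: power_add power2_eq_square field_simps)
  have "inverse t ^ n * exp (- inverse t) \<le> t\<^sup>2 * real (n + 2) ^ (n + 2)"
    using le unfolding eq .
  then show ?thesis using True by (simp only: flat_exp_def mult.commute[of "t\<^sup>2"]) simp
qed (simp add: flat_exp_def)

lemma flat_exp_deriv:
  "(flat_exp n has_real_derivative (flat_exp (n + 2) t + (- real n) * flat_exp (n + 1) t)) (at t)"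
proof -
  consider "t > 0" | "t < 0" | "t = 0" by linarith
  then show ?thesis
  proof cases
    case 1
    have p: "((\<lambda>t. inverse t ^ n) has_real_derivative - real n * inverse t ^ (n + 1)) (at t)"
    proof (cases n)
      case (Suc m)
      have "((\<lambda>t. inverse t ^ Suc m) has_real_derivative
          (1 + real m) * (- (inverse t ^ Suc (Suc 0)) * inverse t ^ m)) (at t)"
        using DERIV_power_Suc[OF DERIV_inverse[of t], of m] 1 by simp
      then show ?thesis using Suc by (simp add: algebra_simps)
    qed simp
    have "((\<lambda>t. exp (- inverse t)) has_real_derivative exp (- inverse t) * inverse t ^ 2) (at t)"
      using 1 by (auto intro!: derivative_eq_intros simp: power2_eq_square)
    from DERIV_mult[OF p this]
    have "((\<lambda>t. inverse t ^ n * exp (- inverse t)) has_real_derivative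
        (flat_exp (n + 2) t + (- real n) * flat_exp (n + 1) t)) (at t)"
      using 1 by (simp add: flat_exp_def power_add power2_eq_square algebra_simps)
    then show ?thesis
      by (rule has_field_derivative_transform_within_open[where S = "{0<..}"]) (use 1 in \<open>auto simp: flat_exp_def\<close>)
  next
    case 2
    have "((\<lambda>t. 0) has_real_derivative 0) (at t)" by simp
    then have "(flat_exp n has_real_derivative 0) (at t)"
      by (rule has_field_derivative_transform_within_open[where S = "{..<0}"]) (use 2 in \<open>auto simp: flat_exp_def\<close>)
    then show ?thesis using 2 by (simp add: flat_exp_def)
  next
    case 3
    define M where "M = real (n + 2) ^ (n + 2)"
    \<comment> \<open>The quadratic bound leaves a factor \<open>\<bar>h\<bar>\<close> in the
      difference quotient.\<close>
    have "((\<lambda>h. (flat_exp n (0 + h) - flat_exp n 0) / h) \<longlongrightarrow> 0) (at 0)"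
    proof (rule Lim_null_comparison)
      show "\<forall>\<^sub>F h in at 0. norm ((flat_exp n (0 + h) - flat_exp n 0) / h) \<le> M * \<bar>h\<bar>"
      proof (rule eventually_at_topological[THEN iffD2], intro exI[of _ UNIV] conjI ballI impI)
        fix h :: real assume "h \<noteq> 0"
        then have "\<bar>flat_exp n h\<bar> / \<bar>h\<bar> \<le> M * h\<^sup>2 / \<bar>h\<bar>"
          using flat_exp_bound[of n h] unfolding M_def by (intro divide_right_mono) auto
        also have "\<dots> = M * \<bar>h\<bar>" using \<open>h \<noteq> 0\<close> by (simp add: power2_eq_square abs_if)
        finally show "norm ((flat_exp n (0 + h) - flat_exp n 0) / h) \<le> M * \<bar>h\<bar>"
          by (simp add: flat_exp_def[of n 0])
      qed auto
      show "((\<lambda>h. M * \<bar>h\<bar>) \<longlongrightarrow> 0) (at 0)"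
        by (auto intro!: tendsto_eq_intros)
    qed
    then show ?thesis using 3 by (simp add: DERIV_def flat_exp_def[of _ 0])
  qed
qed

lemma Ck_on_flat_exp: "Ck_on k UNIV (flat_exp n)"
proof (induction k arbitrary: n)
  case 0
  then show ?case
    by (auto intro!: continuous_at_imp_continuous_on DERIV_isCont[OF flat_exp_deriv])
next
  case (Suc k)
  show ?case
    by (rule Ck_on_real_deriv[OF _ flat_exp_deriv]) (intro open_UNIV Ck_on_add Ck_on_mult Ck_on_const Suc.IH)+
qed

text \<open>The squared distance is used because it is smooth at the centre too.\<close>

definition bump :: "'a::euclidean_space \<Rightarrow> real \<Rightarrow> 'a \<Rightarrow> real" where
  "bump a r z = flat_exp 0 (r\<^sup>2 - (z - a) \<bullet> (z - a))"

lemma bump_nonneg: "bump a r z \<ge> 0"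
  by (simp add: bump_def flat_exp_def)

lemma bump_pos_iff: "r > 0 \<Longrightarrow> bump a r z > 0 \<longleftrightarrow> z \<in> ball a r"
  by (simp add: bump_def flat_exp_def dist_norm norm_minus_commute[of a] norm_lt_square)

lemma smooth_on_bump: "smooth_on S (bump a r)"
proof -
  have "smooth_on S (\<lambda>z. r\<^sup>2 - (z - a) \<bullet> (z - a))"
    by (intro smooth_on_diff smooth_on_inner smooth_on_const smooth_on_id)
  then show ?thesis unfolding bump_def[abs_def]
    by (rule smooth_on_compose[OF _ smooth_on_open[OF open_UNIV Ck_on_flat_exp]]) simp
qed

section \<open>From bumps in charts to a partition of unity on the surface\<close>

context compact_surface
begin

lemma smooth_mapI:
  "(\<And>c. c \<in> A \<Longrightarrow> smooth_on (coord_image c) (\<lambda>z. h (param c z))) \<Longrightarrow> smooth_map A h"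
  unfolding smooth_map_def comp_def by blast

text \<open>Because \<open>K\<close> lies inside the chart \<open>c\<close>, every point is either
  in \<open>c\<close>, where the function is \<open>\<beta>\<close> after a transition map, or off
  \<open>K\<close>, near which it is zero.\<close>

lemma smooth_map_compact_support:
  fixes h :: "'a \<Rightarrow> 'b::euclidean_space"
  assumes c: "c \<in> A" and \<beta>: "smooth_on (coord_image c) \<beta>" and h: "\<And>p. p \<in> fst c \<Longrightarrow> h p = \<beta> (snd c p)"
    and K: "closedin X K" "K \<subseteq> fst c" and zero: "\<And>p. p \<in> topspace X \<Longrightarrow> p \<notin> K \<Longrightarrow> h p = 0"
  shows "smooth_map A h"
proof (rule smooth_mapI, rule smooth_on_local)
  fix d z assume d: "d \<in> A" and z: "z \<in> coord_image d"
  show "\<exists>T. openin (top_of_set (coord_image d)) T \<and> z \<in> T \<and> smooth_on T (\<lambda>z. h (param d z))"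
  proof (cases "param d z \<in> fst c")
    case True
    note ov = overlap_facts[OF d c]
    have "smooth_on (overlap d c) (\<lambda>z. \<beta> (transition d c z))"
    proof (rule smooth_on_compose[OF ov(4) \<beta>])
      show "transition d c ` overlap d c \<subseteq> coord_image c"
        unfolding ov(5) using mem_overlap[OF c] by blast
    qed
    then have "smooth_on (overlap d c) (\<lambda>z. h (param d z))"
      by (rule smooth_on_cong) (use mem_overlap[OF d] h in \<open>simp add: transition_def\<close>)
    then show ?thesis using ov(1) z True mem_overlap[OF d] by blast
  next
    case False
    let ?T = "snd d ` (fst d \<inter> (topspace X - K))"
    have "openin (top_of_set (coord_image d)) ?T" using image_chart_open[OF d] K(1) by blast
    moreover have "z \<in> ?T"
      using z d K(2) False chart_facts(2)[OF d] param_inverse(3)[OF d z]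
      by (intro image_eqI[of _ _ "param d z"]) auto
    moreover have "smooth_on ?T (\<lambda>z. h (param d z))"
      by (rule smooth_on_cong[OF smooth_on_const[of _ 0]]) (use d zero in auto)
    ultimately show ?thesis by blast
  qed
qed

text \<open>A closed coordinate ball inside the chart image pulls back to a compact set, which is
  closed in \<open>X\<close> by the Hausdorff property. This keeps the closed support of the bump
  inside the chart.\<close>

lemma exists_bump:
  assumes p: "p \<in> topspace X"
  obtains c and \<rho> :: "'a \<Rightarrow> real" where "c \<in> A" "smooth_map A \<rho>" "\<And>q. q \<in> topspace X \<Longrightarrow> 0 \<le> \<rho> q"
    "X closure_of {q \<in> topspace X. \<rho> q \<noteq> 0} \<subseteq> fst c" "openin X {q \<in> topspace X. 0 < \<rho> q}" "0 < \<rho> p"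
proof -
  have "p \<in> (\<Union>c\<in>A. fst c)" using p surface unfolding smooth_surface_def by simp
  then obtain c where c: "c \<in> A" "p \<in> fst c" by blast
  note cf = chart_facts[OF c(1)] and pi = param_inverse[OF c(1)]
  obtain U where U: "open U" "coord_image c = half_plane \<inter> U" using cf(3) by (auto simp: openin_open)
  have "snd c p \<in> U" using pi(4)[OF c(2)] U(2) by blast
  then obtain r where r: "r > 0" "cball (snd c p) r \<subseteq> U" using U(1) open_contains_cball by blast
  \<comment> \<open>Near a boundary point the ball sticks out of the half plane, so only its part
    inside is a subset of the chart image.\<close>
  let ?C = "half_plane \<inter> cball (snd c p) r"
  have C: "compact ?C" "?C \<subseteq> coord_image c"
    using closed_half_plane r(2) U(2) by (auto intro: closed_Int_compact)
  define K where "K = param c ` ?C"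
  define \<beta> where "\<beta> = bump (snd c p) r"
  define \<rho> where "\<rho> q = (if q \<in> fst c then \<beta> (snd c q) else 0)" for q
  \<comment> \<open>Identifies \<open>param c\<close>, defined by choice, with the continuous
    inverse of the chart; continuity is needed to carry compactness back to
    \<open>X\<close>.\<close>
  have hm: "homeomorphic_maps (subtopology X (fst c)) (top_of_set (coord_image c)) (snd c) (param c)"
  proof -
    obtain g where g: "homeomorphic_maps (subtopology X (fst c)) (top_of_set (coord_image c)) (snd c) g"
      using cf(4) by (auto simp: homeomorphic_map_maps)
    have "g z = param c z" if "z \<in> coord_image c" for z
    proof -
      have "g (snd c (param c z)) = param c z"
        using g pi(3)[OF that] cf(2) unfolding homeomorphic_maps_def by auto
      then show ?thesis using pi(2)[OF that] by simp
    qed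
    then show ?thesis by (intro homeomorphic_maps_eq[OF g]) auto
  qed
  have "compactin (subtopology X (fst c)) K"
    unfolding K_def
  proof (rule image_compactin)
    show "compactin (top_of_set (coord_image c)) ?C" using C by (simp add: compactin_subtopology)
    show "continuous_map (top_of_set (coord_image c)) (subtopology X (fst c)) (param c)"
      using hm by (simp add: homeomorphic_maps_def)
  qed
  then have "compactin X K" and Kc: "K \<subseteq> fst c" by (auto simp: compactin_subtopology)
  then have Kcl: "closedin X K"
    using compactin_imp_closedin surface unfolding smooth_surface_def by blast
  have zero: "\<rho> q = 0" if q: "q \<notin> K" for q
  proof (cases "q \<in> fst c")
    case True
    have "snd c q \<notin> ?C" using q pi(1)[OF True] unfolding K_def by (metis imageI)
    moreover have "snd c q \<in> half_plane" using pi(4)[OF True] U(2) by blast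
    ultimately have "snd c q \<notin> ball (snd c p) r" by auto
    then have "\<not> \<beta> (snd c q) > 0" using bump_pos_iff[OF r(1)] unfolding \<beta>_def by blast
    then show ?thesis using bump_nonneg[of "snd c p" r "snd c q"] by (simp add: \<rho>_def \<beta>_def)
  qed (simp add: \<rho>_def)
  show ?thesis
  proof (rule that[of c \<rho>])
    show "c \<in> A" by (rule c(1))
    show "smooth_map A \<rho>"
      by (rule smooth_map_compact_support[OF c(1) _ _ Kcl Kc, where \<beta> = \<beta> and h = \<rho>])
         (use zero in \<open>auto simp: \<rho>_def \<beta>_def intro: smooth_on_bump\<close>)
    show "0 \<le> \<rho> q" for q by (simp add: \<rho>_def \<beta>_def bump_nonneg)
    have "X closure_of {q \<in> topspace X. \<rho> q \<noteq> 0} \<subseteq> K"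
      by (rule closure_of_minimal[OF _ Kcl]) (use zero in blast)
    then show "X closure_of {q \<in> topspace X. \<rho> q \<noteq> 0} \<subseteq> fst c" using Kc by blast
    show "0 < \<rho> p" using c(2) r(1) bump_pos_iff[of r "snd c p" "snd c p"] by (simp add: \<rho>_def \<beta>_def)
    have "openin (subtopology X (fst c))
        {q \<in> topspace (subtopology X (fst c)). snd c q \<in> coord_image c \<inter> ball (snd c p) r}"
    proof (rule openin_continuous_map_preimage)
      show "continuous_map (subtopology X (fst c)) (top_of_set (coord_image c)) (snd c)"
        by (rule homeomorphic_imp_continuous_map[OF cf(4)])
    qed (auto intro: openin_open_Int)
    then have "openin X {q \<in> topspace (subtopology X (fst c)). snd c q \<in> coord_image c \<inter> ball (snd c p) r}"
      using openin_trans_full[OF _ cf(1)] by blast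
    also have "{q \<in> topspace (subtopology X (fst c)). snd c q \<in> coord_image c \<inter> ball (snd c p) r}
       = {q \<in> topspace X. 0 < \<rho> q}"
      using bump_pos_iff[OF r(1)] pi(4) by (auto simp: \<rho>_def \<beta>_def split: if_splits)
    finally show "openin X {q \<in> topspace X. 0 < \<rho> q}" .
  qed
qed

text \<open>Compactness selects finitely many bumps that are positive somewhere at every point, and
  division by their sum normalizes them. The result ensures that the choice inside
  \<open>boundary_length\<close> yields a genuine partition of unity.\<close>

lemma partition_of_unity_exists: "\<exists>P. partition_of_unity X A P"
proof -
  have "\<forall>p\<in>topspace X. \<exists>cr :: 'a chart \<times> ('a \<Rightarrow> real). fst cr \<in> A \<and> smooth_map A (snd cr) \<and> (\<forall>q\<in>topspace X. 0 \<le> snd cr q) \<and>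
      X closure_of {q \<in> topspace X. snd cr q \<noteq> 0} \<subseteq> fst (fst cr) \<and> openin X {q \<in> topspace X. 0 < snd cr q} \<and> 0 < snd cr p"
  proof
    fix p assume "p \<in> topspace X"
    then obtain c and \<rho> :: "'a \<Rightarrow> real" where f: "c \<in> A" "smooth_map A \<rho>" "\<And>q. q \<in> topspace X \<Longrightarrow> 0 \<le> \<rho> q"
      "X closure_of {q \<in> topspace X. \<rho> q \<noteq> 0} \<subseteq> fst c" "openin X {q \<in> topspace X. 0 < \<rho> q}" "0 < \<rho> p"
      by (rule exists_bump) (rule that)
    show "\<exists>cr :: 'a chart \<times> ('a \<Rightarrow> real). fst cr \<in> A \<and> smooth_map A (snd cr) \<and> (\<forall>q\<in>topspace X. 0 \<le> snd cr q) \<and>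
      X closure_of {q \<in> topspace X. snd cr q \<noteq> 0} \<subseteq> fst (fst cr) \<and> openin X {q \<in> topspace X. 0 < snd cr q} \<and> 0 < snd cr p"
      by (rule exI[of _ "(c, \<rho>)"]) (simp add: f)
  qed
  then obtain b :: "'a \<Rightarrow> 'a chart \<times> ('a \<Rightarrow> real)" where b: "\<forall>p\<in>topspace X. fst (b p) \<in> A \<and> smooth_map A (snd (b p)) \<and> (\<forall>q\<in>topspace X. 0 \<le> snd (b p) q) \<and>
      X closure_of {q \<in> topspace X. snd (b p) q \<noteq> 0} \<subseteq> fst (fst (b p)) \<and>
      openin X {q \<in> topspace X. 0 < snd (b p) q} \<and> 0 < snd (b p) p"
    by (rule bchoice[THEN exE]) (rule that)
  let ?V = "\<lambda>p. {q \<in> topspace X. 0 < snd (b p) q}"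
  have "\<exists>\<F>. finite \<F> \<and> \<F> \<subseteq> ?V ` topspace X \<and> topspace X \<subseteq> \<Union>\<F>"
    using compact_X unfolding compact_space_alt by (rule allE[of _ "?V ` topspace X"]) (use b in blast)
  then obtain F where F: "finite F" "F \<subseteq> topspace X" "topspace X \<subseteq> \<Union> (?V ` F)"
    by (metis (no_types, lifting) finite_subset_image)
  define s where "s q = (\<Sum>p\<in>F. snd (b p) q)" for q
  have s_pos: "s q > 0" if q: "q \<in> topspace X" for q
  proof -
    obtain p where p: "p \<in> F" "0 < snd (b p) q" using F(3) q by blast
    then have "snd (b p) q \<le> s q" unfolding s_def
      using F b q by (intro member_le_sum) auto
    then show ?thesis using p by simp
  qed
  obtain xs where xs: "set xs = F" "distinct xs" using finite_distinct_list[OF F(1)] by blast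
  let ?P = "map (\<lambda>p. (fst (b p), \<lambda>q. snd (b p) q / s q)) xs"
  have smooth: "smooth_map A (\<lambda>q. snd (b p) q / s q)" if p: "p \<in> F" for p
  proof (rule smooth_mapI)
    fix c assume c: "c \<in> A"
    have sb: "smooth_on (coord_image c) (\<lambda>z. snd (b p) (param c z))" if "p \<in> F" for p
      using smooth_map_chart[OF _ c] b F(2) that by blast
    show "smooth_on (coord_image c) (\<lambda>z. snd (b p) (param c z) / s (param c z))"
    proof (rule smooth_on_divide[OF sb[OF p]])
      show "smooth_on (coord_image c) (\<lambda>z. s (param c z))" unfolding s_def by (rule smooth_on_sum) (rule sb)
      show "s (param c z) \<noteq> 0" if "z \<in> coord_image c" for z
        using s_pos[of "param c z"] param_inverse(3)[OF c that] chart_facts(2)[OF c] by auto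
    qed
  qed
  have "partition_of_unity X A ?P"
    unfolding partition_of_unity_def
  proof (intro conjI ballI)
    fix x assume "x \<in> set ?P"
    then obtain p where p: "p \<in> F" "x = (fst (b p), \<lambda>q. snd (b p) q / s q)" using xs by auto
    have bp: "fst (b p) \<in> A" "\<forall>q\<in>topspace X. 0 \<le> snd (b p) q"
      "X closure_of {q \<in> topspace X. snd (b p) q \<noteq> 0} \<subseteq> fst (fst (b p))" using b F(2) p(1) by blast+
    have sup: "X closure_of {q \<in> topspace X. snd (b p) q / s q \<noteq> 0} \<subseteq> X closure_of {q \<in> topspace X. snd (b p) q \<noteq> 0}"
      by (rule closure_of_mono) auto
    have nonneg: "\<forall>q\<in>topspace X. 0 \<le> snd (b p) q / s q" using bp(2) s_pos by (simp add: less_imp_le)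
    show "case x of (c, \<rho>) \<Rightarrow> c \<in> A \<and> smooth_map A \<rho> \<and> (\<forall>p\<in>topspace X. 0 \<le> \<rho> p) \<and>
        X closure_of {p \<in> topspace X. \<rho> p \<noteq> 0} \<subseteq> fst c"
      unfolding p(2) prod.case by (intro conjI bp(1) smooth[OF p(1)] nonneg subset_trans[OF sup bp(3)])
  next
    fix q assume q: "q \<in> topspace X"
    have "(\<Sum>(c, \<rho>)\<leftarrow>?P. \<rho> q) = (\<Sum>p\<in>F. snd (b p) q / s q)"
      using xs by (simp add: comp_def sum_list_distinct_conv_sum_set)
    also have "\<dots> = 1" using s_pos[OF q] by (simp add: s_def flip: sum_divide_distrib)
    finally show "(\<Sum>(c, \<rho>)\<leftarrow>?P. \<rho> q) = 1" .
  qed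
  then show ?thesis by blast
qed

end

section \<open>Free boundary minimal surfaces\<close>

text \<open>\<open>matrix_inv\<close> is a choice among two-sided inverses, so the adjugate formula
  must be exhibited as one and uniqueness invoked.\<close>

lemma matrix_inv_2:
  fixes a b c d :: real and M :: "real^2^2"
  assumes M: "M $ 1 $ 1 = a" "M $ 1 $ 2 = b" "M $ 2 $ 1 = c" "M $ 2 $ 2 = d" and det: "a * d - b * c \<noteq> 0"
  shows "matrix_inv M $ 1 $ 1 = d / (a * d - b * c)" "matrix_inv M $ 1 $ 2 = - b / (a * d - b * c)"
    "matrix_inv M $ 2 $ 1 = - c / (a * d - b * c)" "matrix_inv M $ 2 $ 2 = a / (a * d - b * c)"
proof -
  define \<delta> where "\<delta> = a * d - b * c"
  define N :: "real^2^2" where "N = vector [vector [d / \<delta>, - b / \<delta>], vector [- c / \<delta>, a / \<delta>]]"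
  have \<delta>: "\<delta> \<noteq> 0" using det by (simp add: \<delta>_def)
  have "M ** N = mat 1"
    using \<delta> by (simp add: vec_eq_iff forall_2 matrix_matrix_mult_def sum_2 mat_def N_def M field_simps)
      (simp add: \<delta>_def algebra_simps)
  moreover have "N ** M = mat 1"
    using \<delta> by (simp add: vec_eq_iff forall_2 matrix_matrix_mult_def sum_2 mat_def N_def M field_simps)
      (simp add: \<delta>_def algebra_simps)
  ultimately have "M ** matrix_inv M = mat 1 \<and> matrix_inv M ** M = mat 1"
    unfolding matrix_inv_def by (intro someI[of "\<lambda>A'. M ** A' = mat 1 \<and> A' ** M = mat 1" N]) simp
  then have "matrix_inv M = N"
    using \<open>N ** M = mat 1\<close> by (metis matrix_mul_assoc matrix_mul_lid matrix_mul_rid)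
  then show "matrix_inv M $ 1 $ 1 = d / (a * d - b * c)" "matrix_inv M $ 1 $ 2 = - b / (a * d - b * c)"
    "matrix_inv M $ 2 $ 1 = - c / (a * d - b * c)" "matrix_inv M $ 2 $ 2 = a / (a * d - b * c)"
    by (simp_all add: N_def \<delta>_def)
qed

lemma chart_partial_eq: "chart_partial c i F = dir_deriv (coord_image c) (axis i 1) F"
  by (simp add: chart_partial_def chart_deriv_def dir_deriv_def fun_eq_iff)

lemma chart_deriv_eq: "chart_deriv c F z = (\<lambda>v. dir_deriv (coord_image c) v F z)"
  by (simp add: chart_deriv_def dir_deriv_def fun_eq_iff)

context immersed_compact_surface
begin

text \<open>Vanishing mean curvature equates the metric trace of the second derivatives with that of
  their projections, which lies in the tangent plane; this is the assumption of
  \<open>divY_zero\<close>.\<close>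

lemma minimal_tangential:
  fixes g :: "'a tensor2"
  assumes c: "c \<in> A" and z: "z \<in> coord_image c"
    and g: "g c z $ 1 $ 1 = gE c z" "g c z $ 1 $ 2 = gF c z" "g c z $ 2 $ 1 = gF c z" "g c z $ 2 $ 2 = gG c z"
    and w: "\<And>i j. w i j = dir_deriv (coord_image c) (axis i 1) (dir_deriv (coord_image c) (axis j 1) (\<lambda>z. \<phi> (param c z))) z"
    and min: "(\<Sum>i\<in>UNIV. \<Sum>j\<in>UNIV. (matrix_inv (g c z) $ i $ j) *\<^sub>R
       (w i j - closest_point (range (chart_deriv c (\<lambda>z. \<phi> (param c z)) z)) (w i j))) = 0"
  shows "immersed_patch.divY (coord_image c) (\<lambda>z. \<phi> (param c z)) z = 0"
proof -
  interpret immersed_patch "coord_image c" "\<lambda>z. \<phi> (param c z)" by (rule patch[OF c])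
  let ?T = "range (chart_deriv c (\<lambda>z. \<phi> (param c z)) z)"
  define \<delta> where "\<delta> = E z * G z - F z * F z"
  have \<delta>: "\<delta> > 0" using W_pos(1)[OF z] by (simp add: \<delta>_def power2_eq_square)
  have lin: "linear (chart_deriv c (\<lambda>z. \<phi> (param c z)) z)"
    unfolding chart_deriv_eq by (rule linear_dir_deriv[OF \<Phi> z])
  have sub: "subspace ?T" by (rule linear_subspace_image[OF lin subspace_UNIV])
  have cp: "closest_point ?T u \<in> ?T" for u
    by (rule closest_point_in_set) (auto intro: closed_subspace[OF sub])
  have inv: "matrix_inv (g c z) $ 1 $ 1 = G z / \<delta>" "matrix_inv (g c z) $ 1 $ 2 = - F z / \<delta>"
    "matrix_inv (g c z) $ 2 $ 1 = - F z / \<delta>" "matrix_inv (g c z) $ 2 $ 2 = E z / \<delta>"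
    using matrix_inv_2[OF g] \<delta> unfolding \<delta>_def by simp_all
  let ?q = "\<lambda>i j. closest_point ?T (w i j)"
  have w21: "w 2 1 = w 1 2" unfolding w by (rule dir_deriv_commute[OF S \<Phi> z])
  \<comment> \<open>The metric trace of the tangential projections; the factor \<delta> clears the
    denominators of the inverse metric.\<close>
  define t where "t = (1 / \<delta>) *\<^sub>R (G z *\<^sub>R ?q 1 1 - F z *\<^sub>R ?q 1 2 - F z *\<^sub>R ?q 2 1 + E z *\<^sub>R ?q 2 2)"
  have tT: "\<delta> *\<^sub>R t \<in> ?T"
    unfolding t_def by (intro subspace_scale[OF sub] subspace_add[OF sub] subspace_diff[OF sub] cp)
  have "(1 / \<delta>) *\<^sub>R (G z *\<^sub>R w 1 1 - (2 * F z) *\<^sub>R w 1 2 + E z *\<^sub>R w 2 2) - t = 0"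
  proof -
    have two: "(2 * F z / \<delta>) *\<^sub>R u = (F z / \<delta>) *\<^sub>R u + (F z / \<delta>) *\<^sub>R u" for u :: 'b
      by (simp flip: scaleR_add_left)
    show ?thesis using min unfolding sum_2 inv t_def w21 by (simp add: algebra_simps two)
  qed
  then have "(1 / \<delta>) *\<^sub>R (G z *\<^sub>R w 1 1 - (2 * F z) *\<^sub>R w 1 2 + E z *\<^sub>R w 2 2) = t" by simp
  then have "\<delta> *\<^sub>R ((1 / \<delta>) *\<^sub>R (G z *\<^sub>R w 1 1 - (2 * F z) *\<^sub>R w 1 2 + E z *\<^sub>R w 2 2)) \<in> ?T" using tT by simp
  then have "G z *\<^sub>R w 1 1 - (2 * F z) *\<^sub>R w 1 2 + E z *\<^sub>R w 2 2 \<in> ?T" using \<delta> by simp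
  then obtain v where "G z *\<^sub>R w 1 1 - (2 * F z) *\<^sub>R w 1 2 + E z *\<^sub>R w 2 2
      = chart_deriv c (\<lambda>z. \<phi> (param c z)) z v" by blast
  also have "\<dots> = chart_deriv c (\<lambda>z. \<phi> (param c z)) z (v $ 1 *\<^sub>R e1 + v $ 2 *\<^sub>R e2)"
    by (simp add: vec2_eq[symmetric] vec2_components)
  also have "\<dots> = v $ 1 *\<^sub>R p1 z + v $ 2 *\<^sub>R p2 z"
    unfolding linear_add[OF lin] linear_scale[OF lin] by (simp add: chart_deriv_eq)
  finally show ?thesis unfolding w by (rule divY_zero[OF z])
qed

end

text \<open>The partition chosen in \<open>boundary_length\<close> depends on the surface but not on
  the metric. Obtaining it before the quantifier over \<open>g\<close> lets lengths in different
  metrics be compared term by term.\<close>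

lemma boundary_length_eq_sum:
  assumes "\<exists>P. partition_of_unity X A P"
  obtains P where "partition_of_unity X A P"
    "\<And>g. boundary_length X A g = (\<Sum>i<length P. LBINT t:{t. vec2 t 0 \<in> coord_image (fst (P ! i))}.
       snd (P ! i) (param (fst (P ! i)) (vec2 t 0)) * sqrt (g (fst (P ! i)) (vec2 t 0) $ 1 $ 1))"
proof
  show "partition_of_unity X A (SOME P. partition_of_unity X A P)"
    using assms by (rule someI_ex)
  show "boundary_length X A g = (\<Sum>i<length (SOME P. partition_of_unity X A P).
      LBINT t:{t. vec2 t 0 \<in> coord_image (fst ((SOME P. partition_of_unity X A P) ! i))}.
       snd ((SOME P. partition_of_unity X A P) ! i) (param (fst ((SOME P. partition_of_unity X A P) ! i)) (vec2 t 0))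
       * sqrt (g (fst ((SOME P. partition_of_unity X A P) ! i)) (vec2 t 0) $ 1 $ 1))" for g
    unfolding boundary_length_def by (simp add: sum_list_sum_nth case_prod_unfold atLeast0LessThan)
qed

lemma borel_line: "S \<in> sets borel \<Longrightarrow> {t. vec2 t 0 \<in> S} \<in> sets lborel"
proof -
  assume S: "S \<in> sets borel"
  have "(\<lambda>t. vec2 t 0) \<in> borel_measurable borel"
    by (intro borel_measurable_continuous_onI continuous_intros)
  from measurable_sets[OF this S] show ?thesis by (simp add: vimage_def)
qed

locale free_boundary_minimal_surface =
  fixes X :: "'a topology" and A :: "'a chart set" and g :: "'a tensor2" and \<phi> :: "'a \<Rightarrow> real^'n"
  assumes surface: "smooth_surface X A" and compact_X: "compact_space X"
    and isom: "isometric_immersion A g \<phi>" and minimal: "minimal_immersion A g \<phi>"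
    and ball: "\<phi> ` topspace X \<subseteq> cball 0 1" and sphere: "\<phi> ` surface_boundary A \<subseteq> sphere 0 1"
    and orth: "meets_sphere_orthogonally A g \<phi>"
begin

sublocale immersed_compact_surface X A \<phi>
  using surface compact_X isom by unfold_locales (auto simp: isometric_immersion_def)

lemma metric_eq:
  assumes c: "c \<in> A" and z: "z \<in> coord_image c"
  shows "g c z $ i $ j = dir_deriv (coord_image c) (axis i 1) (\<lambda>z. \<phi> (param c z)) z
     \<bullet> dir_deriv (coord_image c) (axis j 1) (\<lambda>z. \<phi> (param c z)) z"
proof -
  have "g c z = pullback_metric \<phi> c z" using isom c z by (simp add: isometric_immersion_def)
  then show ?thesis by (simp add: pullback_metric_def chart_partial_eq comp_def)
qed

lemma metric_EFG:
  assumes c: "c \<in> A" and z: "z \<in> coord_image c"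
  shows "g c z $ 1 $ 1 = gE c z" "g c z $ 1 $ 2 = gF c z" "g c z $ 2 $ 1 = gF c z" "g c z $ 2 $ 2 = gG c z"
proof -
  interpret immersed_patch "coord_image c" "\<lambda>z. \<phi> (param c z)" by (rule patch[OF c])
  show "g c z $ 1 $ 1 = gE c z" "g c z $ 1 $ 2 = gF c z" "g c z $ 2 $ 1 = gF c z" "g c z $ 2 $ 2 = gG c z"
    unfolding metric_eq[OF c z] E_def F_def G_def by (simp_all add: inner_commute)
qed

lemma divY_zero_chart:
  assumes c: "c \<in> A" and z: "z \<in> coord_image c"
  shows "immersed_patch.divY (coord_image c) (\<lambda>z. \<phi> (param c z)) z = 0"
proof (rule minimal_tangential[where g = g, OF c z metric_EFG[OF c z] refl])
  have "mean_curvature g \<phi> c z = 0" using minimal c z by (simp add: minimal_immersion_def)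
  then show "(\<Sum>i\<in>UNIV. \<Sum>j\<in>UNIV. (matrix_inv (g c z) $ i $ j) *\<^sub>R
       (dir_deriv (coord_image c) (axis i 1) (dir_deriv (coord_image c) (axis j 1) (\<lambda>z. \<phi> (param c z))) z -
        closest_point (range (chart_deriv c (\<lambda>z. \<phi> (param c z)) z))
          (dir_deriv (coord_image c) (axis i 1) (dir_deriv (coord_image c) (axis j 1) (\<lambda>z. \<phi> (param c z))) z))) = 0"
    by (simp add: mean_curvature_def second_fundamental_form_def Let_def chart_partial_eq comp_def)
qed

lemma image_ball: "c \<in> A \<Longrightarrow> (\<lambda>z. \<phi> (param c z)) ` coord_image c \<subseteq> cball 0 1"
  using ball param_inverse(3) chart_facts(2) by blast

text \<open>The orthogonality condition makes the position vector the outward unit conormal, so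
  \<open>conormal\<close> applies with the coordinates of \<open>\<eta>\<close> as
  coefficients.\<close>

lemma conormal_chart:
  assumes c: "c \<in> A" and z: "z \<in> coord_image c" "z $ 2 = 0"
  defines "x \<equiv> \<phi> (param c z)"
  shows "norm x = 1" "x \<bullet> dir_deriv (coord_image c) e1 (\<lambda>z. \<phi> (param c z)) z = 0"
    "immersed_patch.Y2 (coord_image c) (\<lambda>z. \<phi> (param c z)) z = - sqrt (gE c z) *\<^sub>R x"
proof -
  interpret immersed_patch "coord_image c" "\<lambda>z. \<phi> (param c z)" by (rule patch[OF c])
  obtain \<eta> where \<eta>: "outward_unit_conormal g c z \<eta>" "chart_deriv c (\<phi> \<circ> param c) z \<eta> = \<phi> (param c z)"
    using orth c z unfolding meets_sphere_orthogonally_def by blast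
  note lin = linear_dir_deriv[OF \<Phi> z(1)]
  have "x = dir_deriv (coord_image c) (\<eta> $ 1 *\<^sub>R e1 + \<eta> $ 2 *\<^sub>R e2) (\<lambda>z. \<phi> (param c z)) z"
    using \<eta>(2) by (simp add: x_def chart_deriv_eq comp_def vec2_eq[symmetric] vec2_components)
  then have x: "x = \<eta> $ 1 *\<^sub>R p1 z + \<eta> $ 2 *\<^sub>R p2 z"
    unfolding linear_add[OF lin] linear_scale[OF lin] .
  have "param c z \<in> surface_boundary A"
    using c z param_inverse(2,3)[OF c z(1)] unfolding surface_boundary_def by force
  then show nx: "norm x = 1" using sphere by (auto simp: x_def)
  have "\<eta> \<bullet> (g c z *v axis 1 1) = 0" using \<eta>(1) by (simp add: outward_unit_conormal_def)
  then have "\<eta> $ 1 * gE c z + \<eta> $ 2 * gF c z = 0"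
    by (simp add: inner_vec_def sum_2 matrix_vector_mult_def axis_def metric_EFG[OF c z(1)])
  then show xp: "x \<bullet> p1 z = 0"
    by (simp add: x inner_add_left E_def F_def inner_commute[of "p2 z"])
  show "Y2 z = - sqrt (gE c z) *\<^sub>R x"
    by (rule conormal[OF z(1) x _ xp]) (use nx \<eta>(1) in \<open>simp_all add: norm_eq_1 outward_unit_conormal_def\<close>)
qed

text \<open>Where the geometry at the edge enters: \<open>Y2\<close> is minus the position vector
  times the length element, and the radial derivative of ln \<sigma> is known on the sphere. The
  flux is thus twice the old length element minus twice the new one.\<close>

lemma flux_boundary:
  assumes f: "f \<in> conformal_ball_diffeos" and c: "c \<in> A" and z: "z \<in> coord_image c" "z $ 2 = 0"
  shows "fl2 c (\<lambda>p. ln (conformal_factor f (\<phi> p))) z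
     = - 2 * sqrt (gE c z) * (sqrt (conformal_factor f (\<phi> (param c z))) - 1)"
proof -
  interpret f: conformal_ball_diffeo f by unfold_locales (rule f)
  interpret immersed_patch "coord_image c" "\<lambda>z. \<phi> (param c z)" by (rule patch[OF c])
  let ?x = "\<phi> (param c z)" and ?L = "\<lambda>y. ln (conformal_factor f y)"
  note con = conormal_chart[OF c z]
  have xB: "?x \<in> cball 0 1" using con(1) by simp
  have "p1 z \<noteq> 0" using E_pos[OF z(1)] by (auto simp: E_def)
  \<comment> \<open>The unit tangent of the boundary curve serves as the auxiliary vector for
    \<open>dir_deriv_ln_sphere\<close>.\<close>
  then have "norm ((1 / norm (p1 z)) *\<^sub>R p1 z) = 1" "?x \<bullet> ((1 / norm (p1 z)) *\<^sub>R p1 z) = 0" using con(2) by simp_all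
  note dl = f.dir_deriv_ln_sphere[OF con(1) this]
  have "fl2 c (\<lambda>p. ?L (\<phi> p)) z = dir_deriv (cball 0 1) (Y2 z) ?L ?x"
    by (rule flux_along(2)[OF f.smooth_ln image_ball[OF c] z(1)])
  also have "\<dots> = - sqrt (gE c z) * dir_deriv (cball 0 1) ?x ?L ?x"
    unfolding con(3) linear_scale[OF linear_dir_deriv[OF f.smooth_ln xB]] by simp
  finally show ?thesis unfolding dl by simp
qed

lemma pullback_conformal:
  assumes f: "f \<in> conformal_ball_diffeos" and c: "c \<in> A" and z: "z \<in> coord_image c"
  shows "pullback_metric (f \<circ> \<phi>) c z $ 1 $ 1 = conformal_factor f (\<phi> (param c z)) * gE c z"
proof -
  interpret f: conformal_ball_diffeo f by unfold_locales (rule f)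
  interpret immersed_patch "coord_image c" "\<lambda>z. \<phi> (param c z)" by (rule patch[OF c])
  have "\<phi> (param c z) \<in> cball 0 1" using image_ball[OF c] z by blast
  then show ?thesis
    by (simp add: pullback_metric_def chart_partial_eq comp_def
        dir_deriv_compose[OF S z \<Phi> f.smooth_f image_ball[OF c]] f.conf E_def)
qed

text \<open>By \<open>flux_boundary\<close> the loss of length in each term of the partition is
  exactly half its boundary flux. Single terms have no definite sign; nonnegativity holds for their
  sum by \<open>sum_boundary_flux\<close>.\<close>

lemma boundary_length_conformal_le:
  assumes f: "f \<in> conformal_ball_diffeos"
  shows "boundary_length X A (pullback_metric (f \<circ> \<phi>)) \<le> boundary_length X A g"
proof -
  interpret f: conformal_ball_diffeo f by unfold_locales (rule f)
  let ?\<sigma> = "conformal_factor f" and ?L = "\<lambda>y. ln (conformal_factor f y)"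
  define v where "v p = ?L (\<phi> p)" for p
  have v: "smooth_map A v" unfolding v_def
  proof (rule smooth_mapI)
    fix c assume c: "c \<in> A"
    show "smooth_on (coord_image c) (\<lambda>z. ?L (\<phi> (param c z)))"
      by (rule smooth_on_compose[OF smooth_map_chart[OF \<phi> c] f.smooth_ln image_ball[OF c]])
  qed
  have super: "dir_deriv (coord_image c) e1 (fl1 c v) z + dir_deriv (coord_image c) e2 (fl2 c v) z \<le> 0"
    if c: "c \<in> A" and z: "z \<in> coord_image c" for c z
  proof -
    interpret immersed_patch "coord_image c" "\<lambda>z. \<phi> (param c z)" by (rule patch[OF c])
    have "\<phi> (param c z) \<in> cball 0 1" using image_ball[OF c] z by blast
    from divergence_nonpos[OF regular_domain_cball f.smooth_ln image_ball[OF c] z f.ln_laplacian_nonpos[OF this]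
        divY_zero_chart[OF c z]]
    show ?thesis unfolding v_def .
  qed
  obtain P where P: "partition_of_unity X A P"
    and len: "\<And>g. boundary_length X A g = (\<Sum>i<length P. LBINT t:{t. vec2 t 0 \<in> coord_image (fst (P ! i))}.
       snd (P ! i) (param (fst (P ! i)) (vec2 t 0)) * sqrt (g (fst (P ! i)) (vec2 t 0) $ 1 $ 1))"
    by (rule boundary_length_eq_sum[OF partition_of_unity_exists]) (rule that)
  let ?b = "\<lambda>i. LBINT t:{t. vec2 t 0 \<in> coord_image (fst (P ! i))}.
      snd (P ! i) (param (fst (P ! i)) (vec2 t 0)) * fl2 (fst (P ! i)) v (vec2 t 0)"
  let ?l = "\<lambda>g i. LBINT t:{t. vec2 t 0 \<in> coord_image (fst (P ! i))}.
       snd (P ! i) (param (fst (P ! i)) (vec2 t 0)) * sqrt (g (fst (P ! i)) (vec2 t 0) $ 1 $ 1)"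
  have "?l g i - ?l (pullback_metric (f \<circ> \<phi>)) i = 1 / 2 * ?b i" if i: "i < length P" for i
  proof -
    define c \<rho> K where "c = fst (P ! i)" and "\<rho> = snd (P ! i)" and "K = supp_set P i"
    note pf = partition_facts[OF P i, folded c_def \<rho>_def K_def]
    note c = pf(1)
    interpret immersed_patch "coord_image c" "\<lambda>z. \<phi> (param c z)" by (rule patch[OF c])
    let ?S = "coord_image c" and ?A = "{t. vec2 t 0 \<in> coord_image c}"
    note C = image_chart_compact[OF c pf(4,5)]
    have r0: "\<rho> (param c z) = 0" if "z \<in> ?S" "z \<notin> snd c ` K" for z
      by (rule pf(6)[OF param_topspace[OF c that(1)] outside_chart_support[OF c that]])
    have A_meas: "?A \<in> sets lborel" by (rule borel_line[OF borel_openin_half_plane[OF chart_facts(3)[OF c]]])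
    have c\<rho>: "continuous_on ?S (\<lambda>z. \<rho> (param c z))" by (rule smooth_on_imp_continuous_on[OF smooth_map_chart[OF pf(2) c]])
    have cE: "continuous_on ?S (\<lambda>z. sqrt (gE c z))"
      by (intro continuous_on_real_sqrt smooth_on_imp_continuous_on smooth_EFG)
    have c\<sigma>: "continuous_on ?S (\<lambda>z. sqrt (?\<sigma> (\<phi> (param c z))))"
      by (intro continuous_on_real_sqrt smooth_on_imp_continuous_on smooth_on_compose[OF \<Phi> f.smooth_\<sigma> image_ball[OF c]])
    have l1: "?l g i = (LBINT t:?A. \<rho> (param c (vec2 t 0)) * sqrt (gE c (vec2 t 0)))"
      unfolding c_def[symmetric] \<rho>_def[symmetric]
      by (rule set_lebesgue_integral_cong[OF A_meas]) (simp add: metric_EFG(1)[OF c])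
    have l2: "?l (pullback_metric (f \<circ> \<phi>)) i =
        (LBINT t:?A. \<rho> (param c (vec2 t 0)) * (sqrt (?\<sigma> (\<phi> (param c (vec2 t 0)))) * sqrt (gE c (vec2 t 0))))"
      unfolding c_def[symmetric] \<rho>_def[symmetric]
      by (rule set_lebesgue_integral_cong[OF A_meas]) (simp add: pullback_conformal[OF f c] real_sqrt_mult)
    have i1: "set_integrable lborel ?A (\<lambda>t. \<rho> (param c (vec2 t 0)) * sqrt (gE c (vec2 t 0)))"
      by (rule set_integrable_line(1)[OF C continuous_on_mult[OF c\<rho> cE]]) (simp add: r0)
    have i2: "set_integrable lborel ?A (\<lambda>t. \<rho> (param c (vec2 t 0)) * (sqrt (?\<sigma> (\<phi> (param c (vec2 t 0)))) * sqrt (gE c (vec2 t 0))))"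
      by (rule set_integrable_line(1)[OF C continuous_on_mult[OF c\<rho> continuous_on_mult[OF c\<sigma> cE]]]) (simp add: r0)
    have "?l g i - ?l (pullback_metric (f \<circ> \<phi>)) i =
       (LBINT t:?A. \<rho> (param c (vec2 t 0)) * sqrt (gE c (vec2 t 0))
         - \<rho> (param c (vec2 t 0)) * (sqrt (?\<sigma> (\<phi> (param c (vec2 t 0)))) * sqrt (gE c (vec2 t 0))))"
      unfolding l1 l2 by (rule set_integral_diff(2)[OF i1 i2, symmetric])
    also have "\<dots> = (LBINT t:?A. 1 / 2 * (\<rho> (param c (vec2 t 0)) * fl2 c v (vec2 t 0)))"
      by (rule set_lebesgue_integral_cong[OF A_meas])
         (simp add: v_def flux_boundary[OF f c] algebra_simps)
    also have "\<dots> = 1 / 2 * ?b i" unfolding c_def[symmetric] \<rho>_def[symmetric] by (rule set_integral_mult_right)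
    finally show ?thesis .
  qed
  then have "(\<Sum>i<length P. ?l g i - ?l (pullback_metric (f \<circ> \<phi>)) i) = (\<Sum>i<length P. 1 / 2 * ?b i)"
    by (intro sum.cong) auto
  also have "\<dots> = 1 / 2 * (\<Sum>i<length P. ?b i)" by (rule sum_distrib_left[symmetric])
  also have "\<dots> \<ge> 0"
    using sum_boundary_flux[OF P v super] by simp
  finally show ?thesis unfolding len sum_subtractf by linarith
qed

lemma boundary_length_id: "boundary_length X A (pullback_metric (id \<circ> \<phi>)) = boundary_length X A g"
proof -
  obtain P where P: "partition_of_unity X A P"
    and len: "\<And>g. boundary_length X A g = (\<Sum>i<length P. LBINT t:{t. vec2 t 0 \<in> coord_image (fst (P ! i))}.
       snd (P ! i) (param (fst (P ! i)) (vec2 t 0)) * sqrt (g (fst (P ! i)) (vec2 t 0) $ 1 $ 1))"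
    by (rule boundary_length_eq_sum[OF partition_of_unity_exists]) (rule that)
  have "pullback_metric \<phi> c z = g c z" if "c \<in> A" "z \<in> coord_image c" for c z
    using isom that by (simp add: isometric_immersion_def)
  then show ?thesis
    unfolding len id_comp
    by (intro sum.cong[OF refl] set_lebesgue_integral_cong borel_line borel_openin_half_plane chart_facts(3))
       (use partition_facts(1)[OF P] in auto)
qed

end

theorem theorem5p3:
  fixes X :: "'a topology" and A :: "'a chart set" and g :: "'a tensor2"
    and \<phi> :: "'a \<Rightarrow> real^'n"
  assumes "smooth_surface X A" and "compact_space X" and "surface_boundary A \<noteq> {}"
    and "riemannian_metric A g"
    and "isometric_immersion A g \<phi>"
    and "minimal_immersion A g \<phi>"
    and "\<phi> ` topspace X \<subseteq> cball 0 1"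
    and "\<phi> ` surface_boundary A \<subseteq> sphere 0 1"
    and "meets_sphere_orthogonally A g \<phi>"
  shows "boundary_conformal_volume X A \<phi> = ereal (boundary_length X A g)"
proof -
  interpret free_boundary_minimal_surface X A g \<phi> by unfold_locales fact+
  show ?thesis
    unfolding boundary_conformal_volume_def
  proof (rule antisym)
    show "(SUP f\<in>conformal_ball_diffeos. ereal (boundary_length X A (pullback_metric (f \<circ> \<phi>))))
        \<le> ereal (boundary_length X A g)"
      by (rule SUP_least) (simp add: boundary_length_conformal_le)
    show "ereal (boundary_length X A g)
        \<le> (SUP f\<in>conformal_ball_diffeos. ereal (boundary_length X A (pullback_metric (f \<circ> \<phi>))))"
      by (rule SUP_upper2[OF id_conformal_ball_diffeo]) (simp add: boundary_length_id del: id_comp)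
  qed
qed

end
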